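(* Let $G$ be a planar trivalent graph with perfect matching $M$. If $\Gamma_M$ is a perfect matching graph for the pair $(G,M)$, let $\langle \Gamma_M\rangle\in\mathbb{Z}[A,B,C]$ be its bracket, i.e. the element obtained by the following rules: each perfect matching edge is resolved, $\langle \Gamma_M\rangle = A\langle \Gamma_M^{0,e}\rangle + B\langle \Gamma_M^{1,e}\rangle$ for $e\in M$ (where $\Gamma_M^{0,e}$ and $\Gamma_M^{1,e}$ are obtained by the $0$-smoothing and the $1$-smoothing of $e$); each (possibly immersed) vertexless circle has value $\langle\bigcirc\rangle=C$; and $\langle\Gamma_1\sqcup\Gamma_2\rangle=\langle\Gamma_1\rangle\cdot\langle\Gamma_2\rangle$. Then $\langle\Gamma_M\rangle$ depends only on the pair $(G,M)$ and not on the perfect matching graph used to define it.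
   Context: Graphs are finite multigraphs; loops, multiple edges, vertexless "circle" edges (edges with no endpoints) and the empty graph are allowed. A graph is trivalent if every vertex has degree $3$ (loops counted twice), and planar if it embeds in $S^2$. A plane graph of $G$ is (the image $\Gamma\subset S^2$ of) an embedding $G\to S^2$. A perfect matching of $G$ is a set $M$ of edges, none of which is a loop or a vertexless circle, such that every vertex is an endpoint of exactly one edge of $M$. A perfect matching graph $\Gamma_M$ for $(G,M)$ is a plane graph $\Gamma$ of $G$ together with $M$. Smoothings. Let $e\in M$ have end vertices $u,v$. Going counterclockwise around $u$ in $\Gamma$ starting from $e$, let $x_1,x_2$ be the other two half-edges; going counterclockwise around $v$ starting from $e$, let $y_1,y_2$ be the other two half-edges. The $0$-smoothing of $e$ replaces a small neighborhood of $e$ by two disjoint arcs running parallel to $e$, one on each side, joining $x_1$ to $y_2$ and $x_2$ to $y_1$. The $1$-smoothing replaces it by two arcs crossing each other once transversely, joining $x_1$ to $y_1$ and $x_2$ to $y_2$. State sum form of the bracket. Write $M=\{e_1,\dots,e_n\}$. For $\alpha\in\{0,1\}^n$ the state $\Gamma_\alpha$ is the collection of (possibly immersed) circles obtained by performing the $\alpha_i$-smoothing at $e_i$ for every $i$; $k_\alpha$ is its number of circles (vertexless circle components of $\Gamma$ included) and $|\alpha|=\alpha_1+\dots+\alpha_n$. Then $\langle\Gamma_M\rangle=\sum_{\alpha\in\{0,1\}^n}A^{n-|\alpha|}B^{|\alpha|}C^{k_\alpha}$, with $\langle\emptyset\rangle=1$. *)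

theory Defs
  imports "HOL-Analysis.Analysis" "HOL-Library.Multiset" "HOL-Computational_Algebra.Polynomial"
begin

section \<open>Multigraphs and perfect matchings\<close>

text \<open>
  The ends of an edge form a multiset: \<open>{#u, v#}\<close> for an edge between \<open>u\<close> and \<open>v\<close>,
  \<open>{#v, v#}\<close> for a loop, and \<open>{#}\<close> for a vertexless circle.
\<close>

record ('v, 'e) multigraph =
  verts :: "'v set"
  edges :: "'e set"
  ends :: "'e \<Rightarrow> 'v multiset"

definition finite_multigraph :: "('v, 'e) multigraph \<Rightarrow> bool" where
  "finite_multigraph G \<longleftrightarrow> finite (verts G) \<and> finite (edges G) \<and>
     (\<forall>e\<in>edges G. set_mset (ends G e) \<subseteq> verts G \<and> (size (ends G e) = 2 \<or> ends G e = {#}))"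

definition degree :: "('v, 'e) multigraph \<Rightarrow> 'v \<Rightarrow> nat" where
  "degree G v = (\<Sum>e\<in>edges G. count (ends G e) v)"

definition trivalent :: "('v, 'e) multigraph \<Rightarrow> bool" where
  "trivalent G \<longleftrightarrow> (\<forall>v\<in>verts G. degree G v = 3)"

definition perfect_matching :: "('v, 'e) multigraph \<Rightarrow> 'e set \<Rightarrow> bool" where
  "perfect_matching G M \<longleftrightarrow> M \<subseteq> edges G \<and>
     (\<forall>e\<in>M. \<exists>u v. u \<noteq> v \<and> ends G e = {#u, v#}) \<and>
     (\<forall>v\<in>verts G. \<exists>!e. e \<in> M \<and> v \<in># ends G e)"


section \<open>Plane graphs\<close>

text \<open>
  An embedding of the geometric realization is given by the points representing the vertices
  and by parametrizations of the edges. The direction in which an edge is parametrized is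
  arbitrary. Since the realization is compact, an embedding is the same as a continuous
  injection.
\<close>

record ('v, 'e) drawing =
  vertex_point :: "'v \<Rightarrow> real^3"
  edge_curve :: "'e \<Rightarrow> real \<Rightarrow> real^3"

definition sphere2 :: "(real^3) set" where
  "sphere2 = sphere 0 1"

definition plane_graph :: "('v, 'e) multigraph \<Rightarrow> ('v, 'e) drawing \<Rightarrow> bool" where
  "plane_graph G \<Gamma> \<longleftrightarrow>
     vertex_point \<Gamma> ` verts G \<subseteq> sphere2 \<and> inj_on (vertex_point \<Gamma>) (verts G) \<and>
     (\<forall>e\<in>edges G. let g = edge_curve \<Gamma> e in
        simple_path g \<and> path_image g \<subseteq> sphere2 \<and>
        (if ends G e = {#} then pathfinish g = pathstart g
         else {#pathstart g, pathfinish g#} = image_mset (vertex_point \<Gamma>) (ends G e)) \<and>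
        path_image g \<inter> vertex_point \<Gamma> ` verts G = vertex_point \<Gamma> ` set_mset (ends G e)) \<and>
     (\<forall>e\<in>edges G. \<forall>f\<in>edges G. e \<noteq> f \<longrightarrow>
        path_image (edge_curve \<Gamma> e) \<inter> path_image (edge_curve \<Gamma> f) \<subseteq> vertex_point \<Gamma> ` verts G)"

definition planar :: "('v, 'e) multigraph \<Rightarrow> bool" where
  "planar G \<longleftrightarrow> (\<exists>\<Gamma>. plane_graph G \<Gamma>)"


section \<open>Counterclockwise order at a vertex\<close>

text \<open>
  The half-edge \<open>(e, False)\<close> is the beginning, and \<open>(e, True)\<close> the end, of the
  parametrized edge \<open>e\<close>.
\<close>

type_synonym 'e half_edge = "'e \<times> bool"

definition half_edge_curve :: "('v, 'e) drawing \<Rightarrow> 'e half_edge \<Rightarrow> real \<Rightarrow> real^3" where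
  "half_edge_curve \<Gamma> h =
     (if snd h then reversepath (edge_curve \<Gamma> (fst h)) else edge_curve \<Gamma> (fst h))"

definition half_edges_at ::
    "('v, 'e) multigraph \<Rightarrow> ('v, 'e) drawing \<Rightarrow> 'v \<Rightarrow> 'e half_edge set" where
  "half_edges_at G \<Gamma> v =
     {h. fst h \<in> edges G \<and> pathstart (half_edge_curve \<Gamma> h) = vertex_point \<Gamma> v}"

text \<open>
  The first point of the curve \<open>g\<close> at distance \<open>r\<close> from its starting point.
\<close>

definition exit_point :: "(real \<Rightarrow> real^3) \<Rightarrow> real \<Rightarrow> real^3" where
  "exit_point g r = g (Inf {t \<in> {0..1}. dist (pathstart g) (g t) = r})"

text \<open>
  Three points \<open>a\<close>, \<open>b\<close>, \<open>c\<close> on a circle of the unit sphere with centre \<open>u\<close> are met in this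
  order when going around \<open>u\<close> counterclockwise, the sphere being viewed from outside, iff the
  triangle \<open>a\<close>, \<open>b\<close>, \<open>c\<close> is positively oriented with respect to the outer normal \<open>u\<close>.
\<close>

definition ccw_points :: "real^3 \<Rightarrow> real^3 \<Rightarrow> real^3 \<Rightarrow> real^3 \<Rightarrow> bool" where
  "ccw_points u a b c \<longleftrightarrow> cross3 (b - a) (c - a) \<bullet> u > 0"

text \<open>
  The vertex \<open>v\<close> has exactly the half-edges \<open>h\<^sub>1\<close>, \<open>h\<^sub>2\<close>, \<open>h\<^sub>3\<close>, and they leave every
  sufficiently small disc around \<open>v\<close> in this counterclockwise order. As the edges are arbitrary
  topological arcs, they need not have tangent directions at \<open>v\<close>.
\<close>

definition ccw ::
    "('v, 'e) multigraph \<Rightarrow> ('v, 'e) drawing \<Rightarrow> 'v \<Rightarrow>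
     'e half_edge \<Rightarrow> 'e half_edge \<Rightarrow> 'e half_edge \<Rightarrow> bool" where
  "ccw G \<Gamma> v h\<^sub>1 h\<^sub>2 h\<^sub>3 \<longleftrightarrow> v \<in> verts G \<and> half_edges_at G \<Gamma> v = {h\<^sub>1, h\<^sub>2, h\<^sub>3} \<and>
     (\<forall>\<^sub>F r in at_right 0. ccw_points (vertex_point \<Gamma> v)
        (exit_point (half_edge_curve \<Gamma> h\<^sub>1) r)
        (exit_point (half_edge_curve \<Gamma> h\<^sub>2) r)
        (exit_point (half_edge_curve \<Gamma> h\<^sub>3) r))"


section \<open>Smoothings, states and the bracket\<close>

text \<open>
  A state is given by the set \<open>S \<subseteq> M\<close> of matching edges that receive the 1-smoothing.
  The two arcs of a smoothing are recorded by the half-edges that they join.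
\<close>

inductive smoothing_arc ::
    "('v, 'e) multigraph \<Rightarrow> 'e set \<Rightarrow> ('v, 'e) drawing \<Rightarrow> 'e set \<Rightarrow>
     'e half_edge \<Rightarrow> 'e half_edge \<Rightarrow> bool"
  for G M \<Gamma> S where
  zero_12: "\<lbrakk>e \<in> M; e \<notin> S; ccw G \<Gamma> u (e, False) x\<^sub>1 x\<^sub>2; ccw G \<Gamma> v (e, True) y\<^sub>1 y\<^sub>2\<rbrakk>
      \<Longrightarrow> smoothing_arc G M \<Gamma> S x\<^sub>1 y\<^sub>2"
| zero_21: "\<lbrakk>e \<in> M; e \<notin> S; ccw G \<Gamma> u (e, False) x\<^sub>1 x\<^sub>2; ccw G \<Gamma> v (e, True) y\<^sub>1 y\<^sub>2\<rbrakk>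
      \<Longrightarrow> smoothing_arc G M \<Gamma> S x\<^sub>2 y\<^sub>1"
| one_11: "\<lbrakk>e \<in> M; e \<in> S; ccw G \<Gamma> u (e, False) x\<^sub>1 x\<^sub>2; ccw G \<Gamma> v (e, True) y\<^sub>1 y\<^sub>2\<rbrakk>
      \<Longrightarrow> smoothing_arc G M \<Gamma> S x\<^sub>1 y\<^sub>1"
| one_22: "\<lbrakk>e \<in> M; e \<in> S; ccw G \<Gamma> u (e, False) x\<^sub>1 x\<^sub>2; ccw G \<Gamma> v (e, True) y\<^sub>1 y\<^sub>2\<rbrakk>
      \<Longrightarrow> smoothing_arc G M \<Gamma> S x\<^sub>2 y\<^sub>2"

text \<open>
  The circles of a state are glued from the edges outside \<open>M\<close> along the smoothing arcs, so a
  circle is an equivalence class of such edges. A vertexless circle of the graph is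
  a class by itself.
\<close>

definition same_circle ::
    "('v, 'e) multigraph \<Rightarrow> 'e set \<Rightarrow> ('v, 'e) drawing \<Rightarrow> 'e set \<Rightarrow> ('e \<times> 'e) set" where
  "same_circle G M \<Gamma> S =
     {(e, f). equivclp (\<lambda>e f. \<exists>i j. smoothing_arc G M \<Gamma> S (e, i) (f, j)) e f}"

definition circle_count ::
    "('v, 'e) multigraph \<Rightarrow> 'e set \<Rightarrow> ('v, 'e) drawing \<Rightarrow> 'e set \<Rightarrow> nat" where
  "circle_count G M \<Gamma> S = card ((edges G - M) // same_circle G M \<Gamma> S)"

text \<open>The ring \<open>\<int>[A, B, C]\<close>, as iterated polynomials \<open>\<int>[A][B][C]\<close>.\<close>

type_synonym int_poly3 = "int poly poly poly"

definition var_A :: int_poly3 where "var_A = [:[:[:0, 1:]:]:]"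
definition var_B :: int_poly3 where "var_B = [:[:0, 1:]:]"
definition var_C :: int_poly3 where "var_C = [:0, 1:]"

definition bracket ::
    "('v, 'e) multigraph \<Rightarrow> 'e set \<Rightarrow> ('v, 'e) drawing \<Rightarrow> int_poly3" where
  "bracket G M \<Gamma> =
     (\<Sum>S\<in>Pow M. var_A ^ (card M - card S) * var_B ^ card S * var_C ^ circle_count G M \<Gamma> S)"

end

theory Submission
  imports Defs
begin

text \<open>
  In a fixed state the number of circles is already independent of the drawing. A drawing enters
  only through the cyclic orders at the vertices, and at each vertex two drawings either agree or
  differ by a flip. By a planar argument, the cyclic orders at the two branch vertices of a theta
  subgraph are opposite in every drawing, so by Menger's theorem two vertices of which exactly one
  is flipped are separated by a cut of at most 2 edges. As the cut function is submodular, the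
  set of flipped vertices is then a symmetric difference of sets with such small cuts. Flipping all
  vertices of one such set only affects the smoothings of matching edges in its cut. There are at
  most two of these, and a parity argument shows that the number of circles does not change.
\<close>

section \<open>Three planar arcs with a common starting point\<close>

text \<open>Continuous logarithms of differences of two arcs take their place. They also spare the
  Jordan curve theorem: comparing the two branch points of a theta graph amounts to exchanging two
  corners of a parameter square. Two drawings are not deformed into each other by flips of plane
  pieces. The vertices where they differ are treated as a vector over the field with two elements,
  and the rotations met while flipping one small-cut set after another need not belong to any
  drawing. This is why circles are counted for abstract rotations and why invariance under a flip
  cannot rest on planarity. Trivalence enters Menger's theorem decisively: of edge-disjoint paths at
  most one passes an inner vertex, since two passages would need four edge ends there.\<close>

text \<open>
  Pairs of parameters of two arcs that may only meet at their common starting point and at their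
  common end point.
\<close>

definition corner_square :: "(real \<times> real) set" where
  "corner_square = {0..1} \<times> {0..1} - {(0, 0), (1, 1)}"

text \<open>The coordinate sum is 0 only at one removed corner and 2 only at the other, so the set
  is the square cut by an open strip. Convexity makes it contractible, which is what a global
  logarithm needs.\<close>

lemma convex_corner_square: "convex corner_square"
proof (rule convexI)
  fix x y :: "real \<times> real" and a b :: real
  assume xy: "x \<in> corner_square" "y \<in> corner_square" and ab: "0 \<le> a" "0 \<le> b" "a + b = 1"
  obtain x1 x2 where x: "x = (x1, x2)" by force
  obtain y1 y2 where y: "y = (y1, y2)" by force
  have x': "x1 \<in> {0..1}" "x2 \<in> {0..1}" "x1 + x2 > 0" "x1 + x2 < 2"
    using xy(1) unfolding x corner_square_def by (auto simp: prod_eq_iff)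
  have y': "y1 \<in> {0..1}" "y2 \<in> {0..1}" "y1 + y2 > 0" "y1 + y2 < 2"
    using xy(2) unfolding y corner_square_def by (auto simp: prod_eq_iff)
  have "convex ({0..1::real} \<times> {0..1::real})" by (intro convex_Times convex_real_interval)
  then have 1: "a *\<^sub>R x + b *\<^sub>R y \<in> {0..1::real} \<times> {0..1::real}"
    using x' y' ab unfolding x y by (intro convexD) auto
  have "convex {0<..<2::real}" by (rule convex_real_interval)
  then have 2: "a *\<^sub>R (x1 + x2) + b *\<^sub>R (y1 + y2) \<in> {0<..<2::real}"
    using x' y' ab by (intro convexD) auto
  show "a *\<^sub>R x + b *\<^sub>R y \<in> corner_square"
    using 1 2 unfolding corner_square_def x y by (auto simp: algebra_simps)
qed

section \<open>Continuous logarithms of the difference of two arcs\<close>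

definition is_log :: "(real \<Rightarrow> complex) \<Rightarrow> (real \<Rightarrow> complex) \<Rightarrow> (real \<times> real \<Rightarrow> complex) \<Rightarrow> bool" where
  "is_log g h L \<longleftrightarrow> continuous_on corner_square L \<and> (\<forall>(s, t)\<in>corner_square. exp (L (s, t)) = g s - h t)"

lemma is_log_exists:
  assumes "continuous_on {0..1} g" "continuous_on {0..1} h"
    and "\<And>s t. (s, t) \<in> corner_square \<Longrightarrow> g s \<noteq> h t"
  obtains L where "is_log g h L"
proof -
  have "continuous_on corner_square (\<lambda>x. g (fst x) - h (snd x))"
    by (intro continuous_intros continuous_on_compose2[OF assms(1)] continuous_on_compose2[OF assms(2)])
      (auto simp: corner_square_def)
  moreover have "contractible corner_square"
    by (simp add: convex_corner_square convex_imp_contractible)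
  moreover have "g (fst x) - h (snd x) \<noteq> 0" if "x \<in> corner_square" for x
    using assms(3)[of "fst x" "snd x"] that by auto
  ultimately obtain L where "continuous_on corner_square L"
      "\<And>x. x \<in> corner_square \<Longrightarrow> g (fst x) - h (snd x) = exp (L x)"
    using continuous_logarithm_on_contractible by blast
  then have "is_log g h L" unfolding is_log_def by force
  then show thesis by (rule that)
qed

text \<open>Two different logarithms of one number are at least \<open>2 * pi\<close> apart, so a
  continuous choice on a connected set cannot jump.\<close>

lemma exp_constant_imp_constant:
  fixes f :: "real \<Rightarrow> complex"
  assumes "connected S" "continuous_on S f" "\<And>x. x \<in> S \<Longrightarrow> exp (f x) = c" "x \<in> S" "y \<in> S"
  shows "f x = f y"
proof -
  have "f constant_on S"
  proof (rule continuous_discrete_range_constant[OF assms(1,2)])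
    fix x assume x: "x \<in> S"
    have "2 * pi \<le> norm (f y - f x)" if y: "y \<in> S" "f y \<noteq> f x" for y
    proof -
      have "exp (f y) = exp (f x)" using assms(3) x y by simp
      then obtain n :: int where n: "f y = f x + of_int (2 * n) * pi * \<i>" using exp_eq by blast
      then have "n \<noteq> 0" using y by auto
      have "norm (f y - f x) = 2 * \<bar>n\<bar> * pi" using n by (simp add: norm_mult)
      moreover have "2 * 1 * pi \<le> 2 * \<bar>n\<bar> * pi"
        using \<open>n \<noteq> 0\<close> by (intro mult_right_mono mult_left_mono) auto
      ultimately show ?thesis by simp
    qed
    then show "\<exists>e>0. \<forall>y. y \<in> S \<and> f y \<noteq> f x \<longrightarrow> e \<le> norm (f y - f x)"
      by (intro exI[of _ "2 * pi"]) auto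
  qed
  then show ?thesis using assms(4,5) unfolding constant_on_def by auto
qed

lemma is_log_continuous:
  assumes "is_log g h L" "continuous_on S a" "continuous_on S b"
    and "\<And>x. x \<in> S \<Longrightarrow> (a x, b x) \<in> corner_square"
  shows "continuous_on S (\<lambda>x. L (a x, b x))"
proof (rule continuous_on_compose2[of corner_square L])
  show "continuous_on corner_square L" using assms(1) unfolding is_log_def by blast
  show "continuous_on S (\<lambda>x. (a x, b x))" using assms(2,3) by (rule continuous_on_Pair)
qed (use assms(4) in auto)

lemma is_log_exp:
  "is_log g h L \<Longrightarrow> (s, t) \<in> corner_square \<Longrightarrow> exp (L (s, t)) = g s - h t"
  unfolding is_log_def by auto

text \<open>The two values are logarithms of \<open>u - h t\<close> and of its negative, so their
  difference is a logarithm of -1 and stays constant while \<open>t\<close> runs through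
  \<open>{0<..1}\<close>. This lets the middle arc \<open>h\<close> be truncated at
  \<open>t\<close>.\<close>

lemma is_log_corner:
  assumes L: "is_log g h L" "is_log h k L'" and u: "g 0 = u" "k 0 = u"
    and t: "0 < t" "t \<le> 1"
  shows "L (0, t) - L' (t, 0) = L (0, 1) - L' (1, 0)"
proof -
  have sq: "(0, t) \<in> corner_square" "(t, 0) \<in> corner_square" if "t \<in> {0<..1}" for t :: real
    using that by (auto simp: corner_square_def)
  have "exp (L (0, t) - L' (t, 0)) = -1" if "t \<in> {0<..1}" for t
  proof -
    have *: "exp (L (0, t)) = u - h t" "exp (L' (t, 0)) = h t - u"
      using is_log_exp[OF L(1) sq(1)[OF that]] is_log_exp[OF L(2) sq(2)[OF that]] u by auto
    then have "h t - u \<noteq> 0" by (metis exp_not_eq_zero)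
    then show ?thesis unfolding exp_diff * by (simp add: field_simps)
  qed
  moreover have "continuous_on {0<..1} (\<lambda>t. L (0, t) - L' (t, 0))"
    using sq by (intro continuous_intros is_log_continuous[OF L(1)] is_log_continuous[OF L(2)]) auto
  ultimately show ?thesis
    using t by (intro exp_constant_imp_constant[of "{0<..1}" "\<lambda>t. L (0, t) - L' (t, 0)"]) auto
qed

text \<open>A chord of a disc that ends at the boundary point \<open>z\<close> has a positive
  outward radial component there. The quotient thus lies in the right half-plane, where the
  principal \<open>Ln\<close> is continuous.\<close>

lemma chord_half_plane:
  fixes z x c :: complex
  assumes "dist c z = r" "dist c x \<le> r" "x \<noteq> z"
  shows "Re ((z - x) / (z - c)) > 0"
proof -
  have "z \<noteq> c" using assms by auto
  have 1: "(Re z - Re c)\<^sup>2 + (Im z - Im c)\<^sup>2 = r\<^sup>2"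
    using assms(1) by (metis cmod_power2 dist_commute dist_norm minus_complex.sel)
  have r: "r \<ge> 0" using assms by auto
  have "dist c x ^ 2 \<le> r\<^sup>2" using assms(2) by (simp add: power_mono)
  then have 2: "(Re x - Re c)\<^sup>2 + (Im x - Im c)\<^sup>2 \<le> r\<^sup>2"
    by (metis cmod_power2 dist_commute dist_norm minus_complex.sel)
  have "Re z \<noteq> Re x \<or> Im z \<noteq> Im x" using assms(3) complex_eq_iff by metis
  then have 3: "(Re z - Re x)\<^sup>2 + (Im z - Im x)\<^sup>2 > 0"
    by (simp add: sum_power2_gt_zero_iff)
  have "2 * Re ((z - x) * cnj (z - c)) =
      ((Re z - Re c)\<^sup>2 + (Im z - Im c)\<^sup>2) - ((Re x - Re c)\<^sup>2 + (Im x - Im c)\<^sup>2)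
       + ((Re z - Re x)\<^sup>2 + (Im z - Im x)\<^sup>2)"
    by (simp add: power2_eq_square algebra_simps)
  then have "Re ((z - x) * cnj (z - c)) > 0" using 1 2 3 by linarith
  moreover have "(z - x) / (z - c) = ((z - x) * cnj (z - c)) / of_real ((cmod (z - c))\<^sup>2)"
    using complex_div_cnj by blast
  ultimately show ?thesis using \<open>z \<noteq> c\<close> by (simp add: Re_divide_of_real)
qed

text \<open>\<open>S\<close> and \<open>T\<close> are times at which the arcs lie on the boundary of
  a disc that they have not left before. The way from (S, 0) to (0, T) leads through (S, T); along
  each side one of the two points stays fixed on the circle, so \<open>L\<close> can be compared
  with a principal logarithm.\<close>

lemma is_log_chord:
  assumes L: "is_log g h L" and g: "g 0 = u" and h: "h 0 = u"
    and cont: "continuous_on {0..1} g" "continuous_on {0..1} h"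
    and S: "0 < S" "S < 1" "\<And>s. s \<in> {0..S} \<Longrightarrow> dist c (g s) \<le> r" "dist c (g S) = r"
    and T: "0 < T" "T < 1" "\<And>t. t \<in> {0..T} \<Longrightarrow> dist c (h t) \<le> r" "dist c (h T) = r"
  shows "L (0, T) - L (S, 0) =
     Ln ((g S - h T) / (g S - c)) - Ln ((g S - u) / (g S - c)) +
     Ln ((h T - u) / (h T - c)) - Ln ((h T - g S) / (h T - c))"
proof -
  have sq1: "(S, t) \<in> corner_square" if "t \<in> {0..T}" for t
    using S T that by (auto simp: corner_square_def)
  have sq2: "(s, T) \<in> corner_square" if "s \<in> {0..S}" for s
    using S T that by (auto simp: corner_square_def)
  have ne: "g s \<noteq> h t" if "(s, t) \<in> corner_square" for s t
    using is_log_exp[OF L that] by (metis exp_not_eq_zero right_minus_eq)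
  \<comment> \<open>In a disc of radius 0 both arcs would be constant up to \<open>S\<close> and
    \<open>T\<close>, hence meet at the parameters (S, 0).\<close>
  have r: "r > 0"
  proof -
    have "r \<ge> 0" using S(4) by auto
    moreover have False if "r = 0"
    proof -
      have "g S = c" "h 0 = c" using S(4) T(3)[of 0] T(1) that by auto
      then show False using ne[of S 0] sq1[of 0] S T by auto
    qed
    ultimately show ?thesis by force
  qed
  have c: "g S \<noteq> c" "h T \<noteq> c" using S(4) T(4) r by auto
  have 1: "Re ((g S - h t) / (g S - c)) > 0" if "t \<in> {0..T}" for t
    using chord_half_plane[OF S(4) T(3)[OF that]] ne[OF sq1[OF that]] S by auto
  have 2: "Re ((h T - g s) / (h T - c)) > 0" if "s \<in> {0..S}" for s
    using chord_half_plane[OF T(4) S(3)[OF that]] ne[OF sq2[OF that]] T by auto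
  have nonneg: "z \<notin> \<real>\<^sub>\<le>\<^sub>0" if "Re z > 0" for z using that complex_nonpos_Reals_iff by auto
  have ch: "continuous_on {0..T} h" "continuous_on {0..S} g"
    using cont S T by (auto elim: continuous_on_subset)
  have A: "L (S, T) - Ln ((g S - h T) / (g S - c)) = L (S, 0) - Ln ((g S - h 0) / (g S - c))"
  proof (rule exp_constant_imp_constant[of "{0..T}" "\<lambda>t. L (S, t) - Ln ((g S - h t) / (g S - c))" "g S - c"])
    show "continuous_on {0..T} (\<lambda>t. L (S, t) - Ln ((g S - h t) / (g S - c)))"
      using 1 nonneg S sq1 c
      by (intro continuous_intros is_log_continuous[OF L] ch) auto
    show "exp (L (S, t) - Ln ((g S - h t) / (g S - c))) = g S - c" if "t \<in> {0..T}" for t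
    proof -
      have "(g S - h t) / (g S - c) \<noteq> 0" using 1[OF that] by force
      moreover have "g S - h t \<noteq> 0" using ne[OF sq1[OF that]] S by auto
      ultimately show ?thesis
        by (simp add: exp_diff is_log_exp[OF L sq1[OF that]])
    qed
  qed (use T in auto)
  \<comment> \<open>Here \<open>h T\<close> is the fixed point, and \<open>g s - h T\<close> is the
    negative of the chord ending there; hence the constant \<open>c - h T\<close> instead of
    \<open>h T - c\<close>.\<close>
  have B: "L (S, T) - Ln ((h T - g S) / (h T - c)) = L (0, T) - Ln ((h T - g 0) / (h T - c))"
  proof (rule exp_constant_imp_constant[of "{0..S}" "\<lambda>s. L (s, T) - Ln ((h T - g s) / (h T - c))" "c - h T"])
    show "continuous_on {0..S} (\<lambda>s. L (s, T) - Ln ((h T - g s) / (h T - c)))"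
      using 2 nonneg T sq2 c
      by (intro continuous_intros is_log_continuous[OF L] ch) auto
    show "exp (L (s, T) - Ln ((h T - g s) / (h T - c))) = c - h T" if "s \<in> {0..S}" for s
    proof -
      have "(h T - g s) / (h T - c) \<noteq> 0" using 2[OF that] by force
      moreover have "h T - g s \<noteq> 0" using ne[OF sq2[OF that]] T by auto
      moreover have "exp (L (s, T)) = - (h T - g s)" using is_log_exp[OF L sq2[OF that]] by simp
      moreover have "- x / (x / y) = - y" if "x \<noteq> 0" for x y :: complex
        using that by (simp add: divide_simps)
      ultimately show ?thesis
        unfolding exp_diff by (metis exp_Ln minus_diff_eq)
    qed
  qed (use S in auto)
  have "y - x = a - b + c - d" if "p - a = x - b" "p - d = y - c" for a b c d p x y :: complex
  proof -
    have "x = p - a + b" "y = p - d + c" unfolding that by simp_all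
    then show ?thesis by simp
  qed
  from this[OF A B] show ?thesis unfolding g h .
qed

text \<open>Both arguments lie strictly between -pi/2 and pi/2, so their difference lies between -pi
  and pi, where the sine has the sign of its argument; this difference is an argument of
  \<open>a * cnj b\<close>.\<close>

lemma sgn_Im_Ln_diff:
  assumes "Re a > 0" "Re b > 0"
  shows "sgn (Im (Ln a) - Im (Ln b)) = sgn (Im (a * cnj b))"
proof -
  have nz: "a \<noteq> 0" "b \<noteq> 0" using assms by auto
  define d where "d = Im (Ln a) - Im (Ln b)"
  have "\<bar>Im (Ln a)\<bar> < pi / 2" "\<bar>Im (Ln b)\<bar> < pi / 2"
    using assms nz Re_Ln_pos_lt by auto
  then have d: "- pi < d" "d < pi" unfolding d_def by linarith+
  have "exp (cnj (Ln b)) = cnj b" using nz by (metis exp_cnj exp_Ln)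
  then have "a * cnj b = exp (Ln a + cnj (Ln b))" using nz by (simp add: exp_add)
  then have "Im (a * cnj b) = exp (Re (Ln a + cnj (Ln b))) * sin d"
    by (simp add: d_def Im_exp)
  then have "sgn (Im (a * cnj b)) = sgn (sin d)"
    by (simp add: sgn_mult)
  moreover have "sgn (sin d) = sgn d"
  proof (cases d "0 :: real" rule: linorder_cases)
    case less
    then have "sin (-d) > 0" using d by (intro sin_gt_zero) auto
    then show ?thesis using less by simp
  next
    case greater
    then show ?thesis using d sin_gt_zero by simp
  qed auto
  ultimately show ?thesis unfolding d_def by simp
qed

text \<open>
  For logarithms of the differences \<open>g\<^sub>1 s - g\<^sub>2 t\<close>, \<open>g\<^sub>2 s - g\<^sub>3 t\<close>, \<open>g\<^sub>3 s - g\<^sub>1 t\<close> of three arcs with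
  a common starting point, the terms below do not change when the arcs are truncated. This is why
  their sum, an odd multiple of \<open>\<pi>\<close>, detects the order in which the arcs leave every small disc.
\<close>

definition turning :: "(real \<times> real \<Rightarrow> complex) \<Rightarrow> (real \<times> real \<Rightarrow> complex) \<Rightarrow> (real \<times> real \<Rightarrow> complex) \<Rightarrow> real" where
  "turning L1 L2 L3 = Im ((L1 (0, 1) - L1 (1, 0)) + (L2 (0, 1) - L2 (1, 0)) + (L3 (0, 1) - L3 (1, 0)))"

text \<open>Twice the signed area of the triangle, positive iff \<open>x\<close>, \<open>y\<close>,
  \<open>z\<close> run counterclockwise.\<close>

definition plane_orientation :: "complex \<Rightarrow> complex \<Rightarrow> complex \<Rightarrow> real" where
  "plane_orientation x y z = Im (cnj (y - x) * (z - x))"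

text \<open>The exponentials cancel in pairs up to sign and leave (-1)^3 = -1. A logarithm of -1 is
  never real.\<close>

lemma turning_nonzero:
  assumes "is_log g1 g2 L12" "is_log g2 g3 L23" "is_log g3 g1 L31"
    and "g1 0 = u" "g2 0 = u" "g3 0 = u"
  shows "turning L12 L23 L31 \<noteq> 0"
proof
  define E where "E = (L12 (0, 1) - L12 (1, 0)) + (L23 (0, 1) - L23 (1, 0)) + (L31 (0, 1) - L31 (1, 0))"
  assume "turning L12 L23 L31 = 0"
  then have "Im E = 0" unfolding turning_def E_def .
  have sq: "(0, 1) \<in> corner_square" "(1, 0) \<in> corner_square" by (auto simp: corner_square_def)
  have e: "exp (L12 (0, 1)) = u - g2 1" "exp (L12 (1, 0)) = g1 1 - u"
     "exp (L23 (0, 1)) = u - g3 1" "exp (L23 (1, 0)) = g2 1 - u"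
     "exp (L31 (0, 1)) = u - g1 1" "exp (L31 (1, 0)) = g3 1 - u"
    using is_log_exp[OF assms(1)] is_log_exp[OF assms(2)] is_log_exp[OF assms(3)] sq assms(4-) by auto
  have nz: "g1 1 - u \<noteq> 0" "g2 1 - u \<noteq> 0" "g3 1 - u \<noteq> 0" using e by (metis exp_not_eq_zero)+
  then have "exp E = -1"
    unfolding E_def exp_add exp_diff e by (simp add: divide_simps) (simp add: algebra_simps)
  moreover have "Re (exp E) > 0" using \<open>Im E = 0\<close> by (simp add: Re_exp)
  ultimately show False by simp
qed

text \<open>After truncation to a disc the sum becomes the sum of the three signed angles of the
  triangle inscribed in the boundary circle. All three have the sign fixed by the orientation of the
  triangle, so nothing can cancel.\<close>

lemma sgn_turning:
  assumes L: "is_log g1 g2 L12" "is_log g2 g3 L23" "is_log g3 g1 L31"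
    and cont: "continuous_on {0..1} g1" "continuous_on {0..1} g2" "continuous_on {0..1} g3"
    and u: "g1 0 = u" "g2 0 = u" "g3 0 = u"
    and T1: "0 < T1" "T1 < 1" "\<And>t. t \<in> {0..T1} \<Longrightarrow> dist c (g1 t) \<le> r" "dist c (g1 T1) = r"
    and T2: "0 < T2" "T2 < 1" "\<And>t. t \<in> {0..T2} \<Longrightarrow> dist c (g2 t) \<le> r" "dist c (g2 T2) = r"
    and T3: "0 < T3" "T3 < 1" "\<And>t. t \<in> {0..T3} \<Longrightarrow> dist c (g3 t) \<le> r" "dist c (g3 T3) = r"
  shows "sgn (plane_orientation (g1 T1) (g2 T2) (g3 T3)) = - sgn (turning L12 L23 L31)"
proof -
  have sq: "(T1, T2) \<in> corner_square" "(T2, T3) \<in> corner_square" "(T3, T1) \<in> corner_square"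
    using T1 T2 T3 by (auto simp: corner_square_def)
  have ne: "g1 T1 \<noteq> g2 T2" "g2 T2 \<noteq> g3 T3" "g3 T3 \<noteq> g1 T1"
    using is_log_exp[OF L(1) sq(1)] is_log_exp[OF L(2) sq(2)] is_log_exp[OF L(3) sq(3)]
    by (metis exp_not_eq_zero right_minus_eq)+
  define p where "p = plane_orientation (g1 T1) (g2 T2) (g3 T3)"
  \<comment> \<open>The signed angle of the triangle at its vertex \<open>x\<close>, measured
    against the radial direction \<open>x - c\<close> so that both principal arguments are below a
    right angle.\<close>
  have ang: "sgn (Im (Ln ((x - y) / (x - c))) - Im (Ln ((x - z) / (x - c)))) = - sgn (plane_orientation x y z)"
    if "dist c x = r" "dist c y = r" "dist c z = r" "x \<noteq> y" "x \<noteq> z" for x y z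
  proof -
    have xc: "x \<noteq> c" using that by auto
    have "(x - y) / (x - c) * cnj ((x - z) / (x - c)) = ((x - y) * cnj (x - z)) / ((x - c) * cnj (x - c))"
      by simp
    also have "(x - c) * cnj (x - c) = of_real ((cmod (x - c))\<^sup>2)"
      by (rule complex_norm_square[symmetric])
    finally have "Im ((x - y) / (x - c) * cnj ((x - z) / (x - c))) = Im ((x - y) * cnj (x - z)) / (cmod (x - c))\<^sup>2"
      by (simp only: Im_divide_of_real)
    moreover have "Im ((x - y) * cnj (x - z)) = - plane_orientation x y z"
      unfolding plane_orientation_def by (simp add: algebra_simps)
    ultimately have "sgn (Im ((x - y) / (x - c) * cnj ((x - z) / (x - c)))) = - sgn (plane_orientation x y z)"
      using xc by (simp add: sgn_divide)
    moreover have "Re ((x - y) / (x - c)) > 0" "Re ((x - z) / (x - c)) > 0"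
      using chord_half_plane[of c x r y] chord_half_plane[of c x r z] that by auto
    ultimately show ?thesis using sgn_Im_Ln_diff by metis
  qed
  have rot: "plane_orientation (g2 T2) (g3 T3) (g1 T1) = p" "plane_orientation (g3 T3) (g1 T1) (g2 T2) = p"
    unfolding p_def plane_orientation_def by (simp_all add: algebra_simps)
  \<comment> \<open>Regrouping by arcs: the two values that belong to one truncated arc come from
    consecutive logarithms, which is the setting of \<open>is_log_corner\<close>.\<close>
  have "(L12 (0, 1) - L12 (1, 0)) + (L23 (0, 1) - L23 (1, 0)) + (L31 (0, 1) - L31 (1, 0)) =
     (L12 (0, T2) - L12 (T1, 0)) + (L23 (0, T3) - L23 (T2, 0)) + (L31 (0, T1) - L31 (T3, 0))"
  proof -
    have "L12 (0, T2) - L23 (T2, 0) = L12 (0, 1) - L23 (1, 0)"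
      "L23 (0, T3) - L31 (T3, 0) = L23 (0, 1) - L31 (1, 0)"
      "L31 (0, T1) - L12 (T1, 0) = L31 (0, 1) - L12 (1, 0)"
      by (fact is_log_corner[OF L(1,2) u(1,3) T2(1) less_imp_le[OF T2(2)]]
        is_log_corner[OF L(2,3) u(2,1) T3(1) less_imp_le[OF T3(2)]]
        is_log_corner[OF L(3,1) u(3,2) T1(1) less_imp_le[OF T1(2)]])+
    then have "(L12 (0, T2) - L23 (T2, 0)) + (L23 (0, T3) - L31 (T3, 0)) + (L31 (0, T1) - L12 (T1, 0)) =
      (L12 (0, 1) - L23 (1, 0)) + (L23 (0, 1) - L31 (1, 0)) + (L31 (0, 1) - L12 (1, 0))"
      by (simp only:)
    moreover have "(L12 (0, T2) - L23 (T2, 0)) + (L23 (0, T3) - L31 (T3, 0)) + (L31 (0, T1) - L12 (T1, 0)) =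
      (L12 (0, T2) - L12 (T1, 0)) + (L23 (0, T3) - L23 (T2, 0)) + (L31 (0, T1) - L31 (T3, 0))" by simp
    moreover have "(L12 (0, 1) - L23 (1, 0)) + (L23 (0, 1) - L31 (1, 0)) + (L31 (0, 1) - L12 (1, 0)) =
      (L12 (0, 1) - L12 (1, 0)) + (L23 (0, 1) - L23 (1, 0)) + (L31 (0, 1) - L31 (1, 0))" by simp
    ultimately show ?thesis by (simp only:)
  qed
  also have "\<dots> = 
     (Ln ((g1 T1 - g2 T2) / (g1 T1 - c)) - Ln ((g1 T1 - g3 T3) / (g1 T1 - c))) +
     (Ln ((g2 T2 - g3 T3) / (g2 T2 - c)) - Ln ((g2 T2 - g1 T1) / (g2 T2 - c))) +
     (Ln ((g3 T3 - g1 T1) / (g3 T3 - c)) - Ln ((g3 T3 - g2 T2) / (g3 T3 - c)))"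
  proof -
    have "L12 (0, T2) - L12 (T1, 0) =
       Ln ((g1 T1 - g2 T2) / (g1 T1 - c)) - Ln ((g1 T1 - u) / (g1 T1 - c)) +
       Ln ((g2 T2 - u) / (g2 T2 - c)) - Ln ((g2 T2 - g1 T1) / (g2 T2 - c))"
      by (rule is_log_chord[OF L(1) u(1,2) cont(1,2) T1 T2])
    moreover have "L23 (0, T3) - L23 (T2, 0) =
       Ln ((g2 T2 - g3 T3) / (g2 T2 - c)) - Ln ((g2 T2 - u) / (g2 T2 - c)) +
       Ln ((g3 T3 - u) / (g3 T3 - c)) - Ln ((g3 T3 - g2 T2) / (g3 T3 - c))"
      by (rule is_log_chord[OF L(2) u(2,3) cont(2,3) T2 T3])
    moreover have "L31 (0, T1) - L31 (T3, 0) =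
       Ln ((g3 T3 - g1 T1) / (g3 T3 - c)) - Ln ((g3 T3 - u) / (g3 T3 - c)) +
       Ln ((g1 T1 - u) / (g1 T1 - c)) - Ln ((g1 T1 - g3 T3) / (g1 T1 - c))"
      by (rule is_log_chord[OF L(3) u(3,1) cont(3,1) T3 T1])
    \<comment> \<open>Each principal logarithm involving \<open>u\<close> occurs twice with opposite
      signs, once for each pair in which its arc takes part.\<close>
    moreover have "A + B + C = (p - s'') + (p' - s) + (p'' - s')"
      if "A = p - q + r - s" "B = p' - r + t - s'" "C = p'' - t + q - s''"
      for A B C p p' p'' q r t s s' s'' :: complex
      unfolding that by simp
    ultimately show ?thesis by blast
  qed
  finally have "turning L12 L23 L31 = 
     (Im (Ln ((g1 T1 - g2 T2) / (g1 T1 - c))) - Im (Ln ((g1 T1 - g3 T3) / (g1 T1 - c)))) +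
     (Im (Ln ((g2 T2 - g3 T3) / (g2 T2 - c))) - Im (Ln ((g2 T2 - g1 T1) / (g2 T2 - c)))) +
     (Im (Ln ((g3 T3 - g1 T1) / (g3 T3 - c))) - Im (Ln ((g3 T3 - g2 T2) / (g3 T3 - c))))"
    (is "_ = ?a + ?b + ?c")
    unfolding turning_def by simp
  moreover have "sgn ?a = - sgn p"
    unfolding p_def by (rule ang[OF T1(4) T2(4) T3(4) ne(1) ne(3)[symmetric]])
  moreover have "sgn ?b = - sgn p"
    unfolding rot(1)[symmetric] by (rule ang[OF T2(4) T3(4) T1(4) ne(2) ne(1)[symmetric]])
  moreover have "sgn ?c = - sgn p"
    unfolding rot(2)[symmetric] by (rule ang[OF T3(4) T1(4) T2(4) ne(3) ne(2)[symmetric]])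
  ultimately have "sgn (turning L12 L23 L31) = - sgn p"
    by (cases p "0 :: real" rule: linorder_cases) (auto simp: sgn_if split: if_splits)
  then show ?thesis unfolding p_def by simp
qed

section \<open>Transfer to the sphere\<close>

lemma inner_real3: "x \<bullet> y = x $ 1 * y $ 1 + x $ 2 * y $ 2 + x $ 3 * y $ 3" for x y :: "real^3"
  by (simp add: inner_vec_def sum_3)

lemma sphere2_coords:
  assumes "x \<in> sphere2" shows "x \<bullet> x = 1" "(x $ 1)\<^sup>2 + (x $ 2)\<^sup>2 + (x $ 3)\<^sup>2 = 1"
proof -
  show "x \<bullet> x = 1" using assms by (simp add: sphere2_def dot_square_norm)
  then show "(x $ 1)\<^sup>2 + (x $ 2)\<^sup>2 + (x $ 3)\<^sup>2 = 1" by (simp add: inner_real3 power2_eq_square)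
qed

lemma dist_sphere2:
  assumes "x \<in> sphere2" "y \<in> sphere2" shows "(dist x y)\<^sup>2 = 2 - 2 * (x \<bullet> y)"
  using sphere2_coords(1)[OF assms(1)] sphere2_coords(1)[OF assms(2)]
  by (simp add: dist_norm power2_norm_eq_inner inner_diff inner_commute)

section \<open>Stereographic projection\<close>

definition north :: "real^3" where "north = axis 3 1"

text \<open>Stereographic projection from \<open>north\<close> onto the equatorial plane. It
  reverses the orientation of the sphere seen from outside, which explains the minus signs
  below.\<close>

definition stereo :: "real^3 \<Rightarrow> complex" where
  "stereo x = Complex (x $ 1 / (1 - x $ 3)) (x $ 2 / (1 - x $ 3))"

lemma north_coords: "north $ 1 = 0" "north $ 2 = 0" "north $ 3 = 1"
  by (simp_all add: north_def axis_def)

lemma below_north: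
  assumes "x \<in> sphere2" "x \<noteq> north" shows "x $ 3 < 1"
proof -
  have *: "(x $ 1)\<^sup>2 + (x $ 2)\<^sup>2 + (x $ 3)\<^sup>2 = 1" using sphere2_coords(2)[OF assms(1)] .
  then have "(x $ 3)\<^sup>2 \<le> 1" by (smt (verit) zero_le_power2)
  then have "x $ 3 \<le> 1" unfolding abs_square_le_1 by simp
  moreover have False if "x $ 3 = 1"
  proof -
    have "x $ 1 = 0" "x $ 2 = 0" using * that by (simp_all add: sum_power2_eq_zero_iff)
    then have "x = north" using that by (simp add: vec_eq_iff forall_3 north_coords)
    then show False using assms by simp
  qed
  ultimately show ?thesis by fastforce
qed

lemma cmod_stereo:
  assumes "x \<in> sphere2" "x \<noteq> north" shows "(cmod (stereo x))\<^sup>2 = (1 + x $ 3) / (1 - x $ 3)"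
proof -
  have 1: "1 - x $ 3 \<noteq> 0" using below_north[OF assms] by simp
  have "(cmod (stereo x))\<^sup>2 = ((x $ 1)\<^sup>2 + (x $ 2)\<^sup>2) / (1 - x $ 3)\<^sup>2"
    unfolding stereo_def cmod_power2 by (simp add: power_divide add_divide_distrib)
  also have "(x $ 1)\<^sup>2 + (x $ 2)\<^sup>2 = (1 + x $ 3) * (1 - x $ 3)"
    using sphere2_coords(2)[OF assms(1)] by (simp add: power2_eq_square algebra_simps)
  finally show ?thesis using 1 by (simp add: power2_eq_square)
qed

lemma inj_on_stereo: "inj_on stereo (sphere2 - {north})"
proof (rule inj_onI)
  fix x y assume x: "x \<in> sphere2 - {north}" and y: "y \<in> sphere2 - {north}" and eq: "stereo x = stereo y"
  have 1: "1 - x $ 3 > 0" "1 - y $ 3 > 0" using below_north x y by auto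
  have "(1 + x $ 3) / (1 - x $ 3) = (1 + y $ 3) / (1 - y $ 3)"
    using cmod_stereo[of x] cmod_stereo[of y] x y eq by auto
  then have 3: "x $ 3 = y $ 3" using 1 by (simp add: field_simps)
  then have "x $ 1 = y $ 1" "x $ 2 = y $ 2"
    using eq 1 unfolding stereo_def by auto
  then show "x = y" using 3 by (simp add: vec_eq_iff forall_3)
qed

lemma continuous_on_stereo: "continuous_on (sphere2 - {north}) stereo"
proof -
  have "continuous_on (sphere2 - {north}) (\<lambda>x. complex_of_real (x $ 1 / (1 - x $ 3)) + \<i> * complex_of_real (x $ 2 / (1 - x $ 3)))"
    using below_north by (intro continuous_intros) force+
  then show ?thesis unfolding stereo_def Complex_eq .
qed

text \<open>A cap is the part of the sphere in a half-space. The power of an image point with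
  respect to the image circle is a positive multiple of the defect of the point from that
  half-space, so the cap goes into a disc and its boundary into the circle.\<close>

lemma stereo_cap:
  assumes u: "u \<in> sphere2" and r: "0 < r" "r < dist u north"
  obtains c \<rho> where "\<And>x. x \<in> sphere2 - {north} \<Longrightarrow> dist u x \<le> r \<Longrightarrow> dist c (stereo x) \<le> \<rho>"
    "\<And>x. x \<in> sphere2 - {north} \<Longrightarrow> dist u x = r \<Longrightarrow> dist c (stereo x) = \<rho>"
proof -
  have n: "north \<in> sphere2" by (simp add: sphere2_def north_def)
  \<comment> \<open>By \<open>dist_sphere2\<close> the cap of radius \<open>r\<close> is where
    \<open>x \<bullet> u\<close> is at least \<open>k\<close>; that the pole is outside means
    \<open>u $ 3 < k\<close>.\<close>
  define k where "k = 1 - r\<^sup>2 / 2"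
  have "r\<^sup>2 < (dist u north)\<^sup>2" using r by (intro power_strict_mono) auto
  then have k: "k - u $ 3 > 0"
    unfolding dist_sphere2[OF u n] k_def by (simp add: inner_real3 north_coords)
  define c where "c = Complex (u $ 1 / (k - u $ 3)) (u $ 2 / (k - u $ 3))"
  \<comment> \<open>The squared radius of the image circle with centre \<open>c\<close>.\<close>
  define d where "d = (cmod c)\<^sup>2 - (k + u $ 3) / (k - u $ 3)"
  have *: "(dist c (stereo x))\<^sup>2 - d = 2 * (k - x \<bullet> u) / ((k - u $ 3) * (1 - x $ 3))"
    if x: "x \<in> sphere2 - {north}" for x
  proof -
    have 1: "1 - x $ 3 > 0" using below_north x by auto
    have "(dist c (stereo x))\<^sup>2 = (cmod (stereo x))\<^sup>2 + (cmod c)\<^sup>2 - 2 * (Re (stereo x) * Re c + Im (stereo x) * Im c)"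
      unfolding dist_norm cmod_power2 by (simp add: power2_eq_square algebra_simps)
    then have "(dist c (stereo x))\<^sup>2 - d = (1 + x $ 3) / (1 - x $ 3) + (k + u $ 3) / (k - u $ 3)
      - 2 * (x $ 1 / (1 - x $ 3) * (u $ 1 / (k - u $ 3)) + x $ 2 / (1 - x $ 3) * (u $ 2 / (k - u $ 3)))"
      using cmod_stereo[of x] x unfolding d_def by (simp add: stereo_def c_def)
    also have "\<dots> = ((1 + x $ 3) * (k - u $ 3) + (k + u $ 3) * (1 - x $ 3)
      - 2 * (x $ 1 * u $ 1 + x $ 2 * u $ 2)) / ((k - u $ 3) * (1 - x $ 3))"
      using 1 k by (simp add: divide_simps)
    also have "(1 + x $ 3) * (k - u $ 3) + (k + u $ 3) * (1 - x $ 3) - 2 * (x $ 1 * u $ 1 + x $ 2 * u $ 2) = 2 * (k - x \<bullet> u)"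
      by (simp add: inner_real3 algebra_simps)
    finally show ?thesis .
  qed
  have kx: "k - x \<bullet> u = ((dist u x)\<^sup>2 - r\<^sup>2) / 2" if "x \<in> sphere2 - {north}" for x
    using dist_sphere2[OF u, of x] that unfolding k_def by (simp add: inner_commute field_simps)
  show thesis
  proof (rule that[of c "sqrt d"])
    fix x assume x: "x \<in> sphere2 - {north}"
    have 1: "(k - u $ 3) * (1 - x $ 3) > 0" using below_north[of x] x k by auto
    show "dist c (stereo x) \<le> sqrt d" if "dist u x \<le> r"
    proof -
      have "(dist u x)\<^sup>2 \<le> r\<^sup>2" using that by (simp add: power_mono)
      then have "2 * (k - x \<bullet> u) \<le> 0" using kx[OF x] by simp
      then have "(dist c (stereo x))\<^sup>2 - d \<le> 0" unfolding *[OF x] using 1 by (simp add: divide_nonpos_pos)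
      then show ?thesis by (intro real_le_rsqrt) simp
    qed
    show "dist c (stereo x) = sqrt d" if "dist u x = r"
    proof -
      have "(dist c (stereo x))\<^sup>2 - d = 0" unfolding *[OF x] kx[OF x] using that by simp
      then have "d = (dist c (stereo x))\<^sup>2" by simp
      then show ?thesis by simp
    qed
  qed
qed

text \<open>With \<open>w\<close> the cross product of two sides,
  \<open>w $ 3 - a \<bullet> w\<close> is six times the signed volume of the tetrahedron on
  \<open>a\<close>, \<open>b\<close>, \<open>c\<close> and \<open>north\<close>. The orientation of
  the projected triangle therefore depends on the side of the plane of the circle on which the pole
  lies, and the pole is outside the cap.\<close>

lemma stereo_orientation:
  assumes S: "u \<in> sphere2" "a \<in> sphere2" "b \<in> sphere2" "c \<in> sphere2"
    and r: "0 < r" "r < dist u north" "dist u a = r" "dist u b = r" "dist u c = r"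
  shows "sgn (plane_orientation (stereo a) (stereo b) (stereo c)) = - sgn (cross3 (b - a) (c - a) \<bullet> u)"
proof -
  have n: "north \<in> sphere2" by (simp add: sphere2_def north_def)
  define k where "k = 1 - r\<^sup>2 / 2"
  have "r\<^sup>2 < (dist u north)\<^sup>2" using r by (intro power_strict_mono) auto
  then have k: "k - u $ 3 > 0"
    unfolding dist_sphere2[OF S(1) n] k_def by (simp add: inner_real3 north_coords)
  have "u \<bullet> x = k" if "x \<in> sphere2" "dist u x = r" for x
    using dist_sphere2[OF S(1) that(1)] that(2) unfolding k_def by (simp add: field_simps)
  then have ku: "u \<bullet> a = k" "u \<bullet> b = k" "u \<bullet> c = k" using S r by auto
  define w where "w = cross3 (b - a) (c - a)"
  \<comment> \<open>The three points lie in a plane orthogonal to \<open>u\<close>, so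
    \<open>w\<close> is a multiple of \<open>u\<close>.\<close>
  have "cross3 u w = (u \<bullet> (c - a)) *\<^sub>R (b - a) - (u \<bullet> (b - a)) *\<^sub>R (c - a)"
    unfolding w_def Lagrange by simp
  then have "cross3 u w = 0" using ku by (simp add: inner_diff_right)
  then have "(u \<bullet> w) *\<^sub>R u - (u \<bullet> u) *\<^sub>R w = 0" using Lagrange[of u u w] by simp
  then have w: "w = (w \<bullet> u) *\<^sub>R u" using sphere2_coords(1)[OF S(1)] by (simp add: inner_commute)
  have "w $ 3 = (w \<bullet> u) * u $ 3" using w by (metis vector_scaleR_component real_scaleR_def)
  moreover have "a \<bullet> w = (w \<bullet> u) * k" using w ku by (metis inner_scaleR_right inner_commute)
  ultimately have w3: "w $ 3 - a \<bullet> w = - ((w \<bullet> u) * (k - u $ 3))" by (simp add: algebra_simps)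
  have "x $ 3 < 1" if "x \<in> sphere2" "dist u x = r" for x
    using below_north[OF that(1)] that r by (metis less_irrefl)
  then have pos: "1 - a $ 3 > 0" "1 - b $ 3 > 0" "1 - c $ 3 > 0" using S r by auto
  define A B C where "A = 1 - a $ 3" and "B = 1 - b $ 3" and "C = 1 - c $ 3"
  have abc: "a $ 3 = 1 - A" "b $ 3 = 1 - B" "c $ 3 = 1 - C" by (auto simp: A_def B_def C_def)
  have "plane_orientation (stereo a) (stereo b) (stereo c) * (A * B * C) = w $ 3 - a \<bullet> w"
    using pos unfolding plane_orientation_def stereo_def w_def A_def[symmetric] B_def[symmetric] C_def[symmetric]
    by (simp add: inner_real3 cross_components abc divide_simps) (simp add: algebra_simps)
  then have "plane_orientation (stereo a) (stereo b) (stereo c) * (A * B * C) = - ((w \<bullet> u) * (k - u $ 3))"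
    using w3 by simp
  then have "sgn (plane_orientation (stereo a) (stereo b) (stereo c) * (A * B * C)) = - sgn ((w \<bullet> u) * (k - u $ 3))"
    by simp
  moreover have "A > 0" "B > 0" "C > 0" using pos by (simp_all add: A_def B_def C_def)
  ultimately show ?thesis using k by (simp add: sgn_mult w_def)
qed

text \<open>The properties of a stereographic projection that are used later, for an arbitrary
  centre \<open>p\<close>: the arcs to be compared must miss the centre, so it has to be chosen
  after them.\<close>

definition chart :: "real^3 \<Rightarrow> (real^3 \<Rightarrow> complex) \<Rightarrow> bool" where
  "chart p \<phi> \<longleftrightarrow> continuous_on (sphere2 - {p}) \<phi> \<and> inj_on \<phi> (sphere2 - {p}) \<and>
     (\<forall>u\<in>sphere2. \<forall>r. 0 < r \<and> r < dist u p \<longrightarrow>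
        (\<exists>c \<rho>. \<forall>x\<in>sphere2 - {p}. (dist u x \<le> r \<longrightarrow> dist c (\<phi> x) \<le> \<rho>) \<and> (dist u x = r \<longrightarrow> dist c (\<phi> x) = \<rho>)) \<and>
        (\<forall>x y z. x \<in> sphere2 \<and> y \<in> sphere2 \<and> z \<in> sphere2 \<and> dist u x = r \<and> dist u y = r \<and> dist u z = r \<longrightarrow>
           sgn (plane_orientation (\<phi> x) (\<phi> y) (\<phi> z)) = - sgn (cross3 (y - x) (z - x) \<bullet> u)))"

lemma chart_exists:
  assumes "p \<in> sphere2"
  obtains \<phi> where "chart p \<phi>"
proof -
  have "norm p = norm north" using assms by (simp add: sphere2_def north_def)
  \<comment> \<open>Determinant 1 is essential: a rotation commutes with \<open>cross3\<close>, a
    reflection would change its sign.\<close>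
  then obtain f :: "real^3 \<Rightarrow> real^3" where f: "orthogonal_transformation f" "det (matrix f) = 1" "f p = north"
    using rotation_exists[of p north] by auto
  have lin: "linear f" using f(1) by (rule orthogonal_transformation_linear)
  have nf: "norm (f x) = norm x" for x using f(1) by (rule orthogonal_transformation_norm)
  have df: "dist (f x) (f y) = dist x y" for x y
    by (metis dist_norm lin linear_diff nf)
  have sf: "f x \<in> sphere2 \<longleftrightarrow> x \<in> sphere2" for x by (simp add: sphere2_def nf)
  have sfp: "f x \<in> sphere2 - {north} \<longleftrightarrow> x \<in> sphere2 - {p}" for x
  proof -
    have "f x = north \<longleftrightarrow> x = p" using df[of x p] f(3) by auto
    then show ?thesis using sf[of x] by simp
  qed
  have img: "f ` (sphere2 - {p}) \<subseteq> sphere2 - {north}" by (intro image_subsetI) (simp only: sfp)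
  have injf: "inj f" using df by (metis dist_eq_0_iff injI)
  have crf: "cross3 (f y - f x) (f z - f x) \<bullet> f u = cross3 (y - x) (z - x) \<bullet> u" for x y z u
    using cross_orthogonal_transformation[OF f(1), of "y - x" "z - x"] f(1,2)
    by (simp add: linear_diff[OF lin] orthogonal_transformation_def)
  have "chart p (stereo \<circ> f)"
    unfolding chart_def
  proof (intro conjI ballI allI impI)
    show "continuous_on (sphere2 - {p}) (stereo \<circ> f)"
      using lin img by (intro continuous_on_compose linear_continuous_on continuous_on_subset[OF continuous_on_stereo])
        (auto simp: linear_conv_bounded_linear)
    show "inj_on (stereo \<circ> f) (sphere2 - {p})"
      using injf img by (intro comp_inj_on) (auto intro: inj_on_subset inj_on_stereo)
    fix u r assume u: "u \<in> sphere2" and r: "0 < r \<and> r < dist u p"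
    have fu: "f u \<in> sphere2" "r < dist (f u) north" using u r sf df f(3) by (auto simp flip: f(3))
    obtain c \<rho> where
      "\<And>x. x \<in> sphere2 - {north} \<Longrightarrow> dist (f u) x \<le> r \<Longrightarrow> dist c (stereo x) \<le> \<rho>"
      "\<And>x. x \<in> sphere2 - {north} \<Longrightarrow> dist (f u) x = r \<Longrightarrow> dist c (stereo x) = \<rho>"
      using stereo_cap[OF fu(1) conjunct1[OF r] fu(2)] by blast
    then show "\<exists>c \<rho>. \<forall>x\<in>sphere2 - {p}. (dist u x \<le> r \<longrightarrow> dist c ((stereo \<circ> f) x) \<le> \<rho>) \<and>
        (dist u x = r \<longrightarrow> dist c ((stereo \<circ> f) x) = \<rho>)"
      using sfp df by (intro exI[of _ c] exI[of _ \<rho>]) (metis comp_apply)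
    fix x y z assume "x \<in> sphere2 \<and> y \<in> sphere2 \<and> z \<in> sphere2 \<and> dist u x = r \<and> dist u y = r \<and> dist u z = r"
    then show "sgn (plane_orientation ((stereo \<circ> f) x) ((stereo \<circ> f) y) ((stereo \<circ> f) z)) =
         - sgn (cross3 (y - x) (z - x) \<bullet> u)"
      using stereo_orientation[OF fu(1), of "f x" "f y" "f z" r] fu(2) r sf df crf by simp
  qed
  then show thesis by (rule that)
qed

text \<open>The arc is on the circle of radius \<open>r\<close> at time \<open>T\<close> and has not
  left the closed disc before; touching the circle earlier is harmless. \<open>T < 1\<close> keeps
  pairs of such times away from the removed corner (1, 1).\<close>

definition reaches :: "(real \<Rightarrow> real^3) \<Rightarrow> real \<Rightarrow> real^3 \<Rightarrow> bool" where
  "reaches g r z \<longleftrightarrow> (\<exists>T. 0 < T \<and> T < 1 \<and> g T = z \<and> dist (g 0) z = r \<and> (\<forall>t\<in>{0..T}. dist (g 0) (g t) \<le> r))"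

definition disjoint_arms :: "(real \<Rightarrow> real^3) \<Rightarrow> (real \<Rightarrow> real^3) \<Rightarrow> bool" where
  "disjoint_arms g h \<longleftrightarrow> (\<forall>(s, t)\<in>corner_square. g s \<noteq> h t)"

definition arm :: "real^3 \<Rightarrow> real^3 \<Rightarrow> (real \<Rightarrow> real^3) \<Rightarrow> bool" where
  "arm p u g \<longleftrightarrow> path g \<and> path_image g \<subseteq> sphere2 - {p} \<and> g 0 = u"

lemma arm_in:
  assumes "arm p u g" "t \<in> {0..1}" shows "g t \<in> sphere2 - {p}"
  using assms unfolding arm_def path_image_def by blast

lemma chart_continuous:
  assumes "chart p \<phi>" "arm p u g"
  shows "continuous_on {0..1} (\<phi> \<circ> g)"
proof (rule continuous_on_compose)
  show "continuous_on {0..1} g" using assms(2) unfolding arm_def path_def by blast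
  show "continuous_on (g ` {0..1}) \<phi>"
    using assms unfolding arm_def path_image_def chart_def by (blast intro: continuous_on_subset)
qed

lemma chart_log_exists:
  assumes "chart p \<phi>" "arm p u g" "arm p u h" "disjoint_arms g h"
  obtains L where "is_log (\<phi> \<circ> g) (\<phi> \<circ> h) L"
proof (rule is_log_exists)
  have *: "continuous_on (sphere2 - {p}) \<phi>" "inj_on \<phi> (sphere2 - {p})" using assms(1) unfolding chart_def by auto
  show "continuous_on {0..1} (\<phi> \<circ> g)" "continuous_on {0..1} (\<phi> \<circ> h)"
    by (rule chart_continuous[OF assms(1,2)], rule chart_continuous[OF assms(1,3)])
  fix s t assume st: "(s, t) \<in> corner_square"
  then have "s \<in> {0..1}" "t \<in> {0..1}" unfolding corner_square_def by auto
  then have "g s \<in> sphere2 - {p}" "h t \<in> sphere2 - {p}"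
    using assms(2,3) arm_in by blast+
  moreover have "g s \<noteq> h t" using assms(4) st unfolding disjoint_arms_def by auto
  ultimately show "(\<phi> \<circ> g) s \<noteq> (\<phi> \<circ> h) t" using *(2) by (auto dest: inj_onD)
qed

text \<open>The projection and \<open>sgn_turning\<close> contribute one minus sign each, so none is
  left.\<close>

lemma sgn_turning_sphere:
  assumes \<phi>: "chart p \<phi>" and arms: "arm p u g1" "arm p u g2" "arm p u g3"
    and L: "is_log (\<phi> \<circ> g1) (\<phi> \<circ> g2) L12" "is_log (\<phi> \<circ> g2) (\<phi> \<circ> g3) L23" "is_log (\<phi> \<circ> g3) (\<phi> \<circ> g1) L31"
    and r: "0 < r" "r < dist u p"
    and z: "reaches g1 r z1" "reaches g2 r z2" "reaches g3 r z3"
  shows "sgn (cross3 (z2 - z1) (z3 - z1) \<bullet> u) = sgn (turning L12 L23 L31)"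
proof -
  have S: "g t \<in> sphere2 - {p}" if "arm p u g" "0 \<le> t" "t \<le> 1" for g t
    using arm_in[OF that(1), of t] that by simp
  have u: "u \<in> sphere2" using S[OF arms(1), of 0] arms(1) unfolding arm_def by auto
  obtain c \<rho> where c: "\<And>x. x \<in> sphere2 - {p} \<Longrightarrow> dist u x \<le> r \<Longrightarrow> dist c (\<phi> x) \<le> \<rho>"
      "\<And>x. x \<in> sphere2 - {p} \<Longrightarrow> dist u x = r \<Longrightarrow> dist c (\<phi> x) = \<rho>"
    using \<phi> u r unfolding chart_def by meson
  have T: "\<exists>T. 0 < T \<and> T < 1 \<and> g T = z \<and> dist u (g T) = r \<and> (\<forall>t\<in>{0..T}. dist c ((\<phi> \<circ> g) t) \<le> \<rho>) \<and> dist c ((\<phi> \<circ> g) T) = \<rho>"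
    if a: "arm p u g" and rz: "reaches g r z" for g z
  proof -
    obtain T where T: "0 < T" "T < 1" "g T = z" "dist u z = r" "\<forall>t\<in>{0..T}. dist u (g t) \<le> r"
      using a rz unfolding reaches_def arm_def by auto
    then show ?thesis using S[OF a] c by (intro exI[of _ T]) auto
  qed
  obtain T1 where T1: "0 < T1" "T1 < 1" "\<And>t. t \<in> {0..T1} \<Longrightarrow> dist c ((\<phi> \<circ> g1) t) \<le> \<rho>" "dist c ((\<phi> \<circ> g1) T1) = \<rho>"
     "g1 T1 = z1" "dist u (g1 T1) = r"
    using T[OF arms(1) z(1)] by blast
  obtain T2 where T2: "0 < T2" "T2 < 1" "\<And>t. t \<in> {0..T2} \<Longrightarrow> dist c ((\<phi> \<circ> g2) t) \<le> \<rho>" "dist c ((\<phi> \<circ> g2) T2) = \<rho>"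
     "g2 T2 = z2" "dist u (g2 T2) = r"
    using T[OF arms(2) z(2)] by blast
  obtain T3 where T3: "0 < T3" "T3 < 1" "\<And>t. t \<in> {0..T3} \<Longrightarrow> dist c ((\<phi> \<circ> g3) t) \<le> \<rho>" "dist c ((\<phi> \<circ> g3) T3) = \<rho>"
     "g3 T3 = z3" "dist u (g3 T3) = r"
    using T[OF arms(3) z(3)] by blast
  have 0: "(\<phi> \<circ> g1) 0 = \<phi> u" "(\<phi> \<circ> g2) 0 = \<phi> u" "(\<phi> \<circ> g3) 0 = \<phi> u" using arms unfolding arm_def by auto
  have "sgn (plane_orientation ((\<phi> \<circ> g1) T1) ((\<phi> \<circ> g2) T2) ((\<phi> \<circ> g3) T3)) = - sgn (turning L12 L23 L31)"
    by (rule sgn_turning[OF L chart_continuous[OF \<phi> arms(1)] chart_continuous[OF \<phi> arms(2)] chart_continuous[OF \<phi> arms(3)] 0 T1(1-4) T2(1-4) T3(1-4)])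
  moreover have "sgn (plane_orientation (\<phi> z1) (\<phi> z2) (\<phi> z3)) = - sgn (cross3 (z2 - z1) (z3 - z1) \<bullet> u)"
  proof -
    have "z1 \<in> sphere2" "z2 \<in> sphere2" "z3 \<in> sphere2"
      using S[OF arms(1), of T1] S[OF arms(2), of T2] S[OF arms(3), of T3] T1 T2 T3 by auto
    moreover have "\<forall>x y z. x \<in> sphere2 \<and> y \<in> sphere2 \<and> z \<in> sphere2 \<and> dist u x = r \<and> dist u y = r \<and> dist u z = r \<longrightarrow>
           sgn (plane_orientation (\<phi> x) (\<phi> y) (\<phi> z)) = - sgn (cross3 (y - x) (z - x) \<bullet> u)"
      using \<phi>[unfolded chart_def] u r by blast
    ultimately show ?thesis using T1(5,6) T2(5,6) T3(5,6) by blast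
  qed
  ultimately show ?thesis using T1(5) T2(5) T3(5) by simp
qed

text \<open>\<open>\<tau>\<close> is the turning number in a chart centred at \<open>p\<close>. The
  common end is a premise of the last clause only, so that the lemma also serves three arcs that do
  not meet again.\<close>

lemma triod_order:
  assumes p: "p \<in> sphere2" and arms: "arm p u g1" "arm p u g2" "arm p u g3"
    and disj: "disjoint_arms g1 g2" "disjoint_arms g2 g3" "disjoint_arms g3 g1"
  obtains \<tau> :: real where "\<tau> \<noteq> 0"
    "\<And>r z1 z2 z3. 0 < r \<Longrightarrow> r < dist u p \<Longrightarrow> reaches g1 r z1 \<Longrightarrow> reaches g2 r z2 \<Longrightarrow> reaches g3 r z3
       \<Longrightarrow> sgn (cross3 (z2 - z1) (z3 - z1) \<bullet> u) = sgn \<tau>"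
    "\<And>v r z1 z2 z3. g1 1 = v \<Longrightarrow> g2 1 = v \<Longrightarrow> g3 1 = v \<Longrightarrow> 0 < r \<Longrightarrow> r < dist v p \<Longrightarrow>
       reaches (reversepath g1) r z1 \<Longrightarrow> reaches (reversepath g2) r z2 \<Longrightarrow> reaches (reversepath g3) r z3
       \<Longrightarrow> sgn (cross3 (z2 - z1) (z3 - z1) \<bullet> v) = - sgn \<tau>"
proof -
  obtain \<phi> where \<phi>: "chart p \<phi>" using chart_exists[OF p] by blast
  obtain L12 where L12: "is_log (\<phi> \<circ> g1) (\<phi> \<circ> g2) L12" using chart_log_exists[OF \<phi> arms(1,2) disj(1)] by blast
  obtain L23 where L23: "is_log (\<phi> \<circ> g2) (\<phi> \<circ> g3) L23" using chart_log_exists[OF \<phi> arms(2,3) disj(2)] by blast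
  obtain L31 where L31: "is_log (\<phi> \<circ> g3) (\<phi> \<circ> g1) L31" using chart_log_exists[OF \<phi> arms(3,1) disj(3)] by blast
  \<comment> \<open>The half turn of the parameter square: it swaps the two corners that
    \<open>turning\<close> evaluates.\<close>
  define rv :: "real \<times> real \<Rightarrow> real \<times> real" where "rv = (\<lambda>x. (1 - fst x, 1 - snd x))"
  have rv: "rv x \<in> corner_square" if "x \<in> corner_square" for x
    using that unfolding rv_def corner_square_def by (cases x) auto
  have rev_log: "is_log (\<phi> \<circ> reversepath g) (\<phi> \<circ> reversepath h) (L \<circ> rv)"
    if "is_log (\<phi> \<circ> g) (\<phi> \<circ> h) L" for g h L
    unfolding is_log_def
  proof (intro conjI)
    have "continuous_on corner_square L" using that unfolding is_log_def by blast
    moreover have "continuous_on corner_square rv" unfolding rv_def by (intro continuous_intros)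
    ultimately show "continuous_on corner_square (L \<circ> rv)"
      using rv by (metis continuous_on_compose continuous_on_subset image_subsetI)
    show "\<forall>(s, t)\<in>corner_square. exp ((L \<circ> rv) (s, t)) = (\<phi> \<circ> reversepath g) s - (\<phi> \<circ> reversepath h) t"
    proof clarify
      fix s t assume "(s, t) \<in> corner_square"
      then have "(1 - s, 1 - t) \<in> corner_square" using rv[of "(s, t)"] by (simp add: rv_def)
      then show "exp ((L \<circ> rv) (s, t)) = (\<phi> \<circ> reversepath g) s - (\<phi> \<circ> reversepath h) t"
        using is_log_exp[OF that] by (simp add: rv_def reversepath_def)
    qed
  qed
  have rev_turn: "turning (L12 \<circ> rv) (L23 \<circ> rv) (L31 \<circ> rv) = - turning L12 L23 L31"
    unfolding turning_def rv_def by simp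
  have rev_arm: "arm p v (reversepath g)" if "arm p u g" "g 1 = v" for g v
  proof -
    have "reversepath g 0 = v" using that(2) by (simp add: reversepath_def)
    then show ?thesis using that(1) unfolding arm_def by simp
  qed
  show thesis
  proof (rule that)
    show "turning L12 L23 L31 \<noteq> 0"
      by (rule turning_nonzero[OF L12 L23 L31]) (use arms in \<open>auto simp: arm_def\<close>)
    show "sgn (cross3 (z2 - z1) (z3 - z1) \<bullet> u) = sgn (turning L12 L23 L31)"
      if "0 < r" "r < dist u p" "reaches g1 r z1" "reaches g2 r z2" "reaches g3 r z3" for r z1 z2 z3
      by (rule sgn_turning_sphere[OF \<phi> arms L12 L23 L31 that])
    show "sgn (cross3 (z2 - z1) (z3 - z1) \<bullet> v) = - sgn (turning L12 L23 L31)"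
      if v: "g1 1 = v" "g2 1 = v" "g3 1 = v" and r: "0 < r" "r < dist v p" and
        "reaches (reversepath g1) r z1" "reaches (reversepath g2) r z2" "reaches (reversepath g3) r z3"
      for v r z1 z2 z3
      using sgn_turning_sphere[OF \<phi> rev_arm[OF arms(1) v(1)] rev_arm[OF arms(2) v(2)] rev_arm[OF arms(3) v(3)]
          rev_log[OF L12] rev_log[OF L23] rev_log[OF L31] that(4-8)]
      unfolding rev_turn by (simp add: sgn_minus)
  qed
qed

text \<open>Equality of initial pieces up to linear changes of parameter. Since
  \<open>joinpaths\<close> runs each part at double speed, this is how a concatenation is related to
  its first edge.\<close>

definition same_germ :: "(real \<Rightarrow> real^3) \<Rightarrow> (real \<Rightarrow> real^3) \<Rightarrow> bool" where
  "same_germ g h \<longleftrightarrow> (\<exists>a b. 0 < a \<and> a \<le> 1 \<and> 0 < b \<and> b \<le> 1 \<and> (\<forall>t\<in>{0..1}. g (a * t) = h (b * t)))"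

text \<open>The first exit of \<open>h\<close> from a small disc falls into the piece shared with
  \<open>g\<close>; the same point then witnesses \<open>reaches\<close> on \<open>g\<close>, at a
  rescaled time.\<close>

lemma exit_point_reaches:
  assumes "same_germ g h" "path h" "\<And>t. 0 < t \<Longrightarrow> t < 1 \<Longrightarrow> h t \<noteq> h 0"
  shows "\<forall>\<^sub>F r in at_right 0. reaches g r (exit_point h r)"
proof -
  obtain a b where ab: "0 < a" "a \<le> 1" "0 < b" "b \<le> 1" and gh: "\<And>t. t \<in> {0..1} \<Longrightarrow> g (a * t) = h (b * t)"
    using assms(1) unfolding same_germ_def by blast
  define f where "f t = dist (h 0) (h t)" for t
  have cf: "continuous_on {0..1} f"
    using assms(2) unfolding path_def f_def by (intro continuous_intros)
  have g0: "g 0 = h 0" using gh[of 0] by simp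
  \<comment> \<open>Radii below the distance attained at \<open>b / 2\<close> keep the exit time at
    most \<open>b / 2\<close>; the corresponding time on \<open>g\<close> is at most 1/2 and thus
    below 1.\<close>
  have pos: "f (b / 2) > 0" using assms(3)[of "b / 2"] ab unfolding f_def by (simp add: eq_commute)
  have "reaches g r (exit_point h r)" if r: "0 < r" "r < f (b / 2)" for r
  proof -
    define K where "K = {t \<in> {0..1}. f t = r}"
    have ivt: "\<exists>x\<in>{0..t}. f x = r" if "0 \<le> t" "t \<le> 1" "r \<le> f t" for t
    proof -
      have "\<exists>x\<ge>0. x \<le> t \<and> f x = r"
        by (rule IVT') (use that r in \<open>auto simp: f_def intro: continuous_on_subset[OF cf, unfolded f_def]\<close>)
      then show ?thesis by auto
    qed
    have "closed K"
      unfolding K_def using cf by (intro continuous_closed_preimage_constant) auto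
    moreover have bb: "bdd_below K" unfolding K_def by (auto intro: bdd_belowI[of _ 0])
    moreover have Kb: "\<exists>x\<in>K. x \<le> b / 2" using ivt[of "b / 2"] ab r unfolding K_def by force
    ultimately have sK: "Inf K \<in> K" by (intro closed_contains_Inf) auto
    define s where "s = Inf K"
    have s: "s \<in> {0..1}" "f s = r" using sK unfolding s_def K_def by auto
    have "s \<noteq> 0" using s r by (auto simp: f_def)
    have sb: "s \<le> b / 2" using Kb cInf_lower[OF _ bb] unfolding s_def by force
    have before: "f t \<le> r" if ts: "t \<in> {0..s}" for t
    proof (rule ccontr)
      assume "\<not> f t \<le> r"
      then obtain x where x: "x \<in> {0..t}" "f x = r" using ivt[of t] ts s by force
      then have "x \<in> K" using ts s unfolding K_def by auto
      then have "s \<le> x" unfolding s_def by (rule cInf_lower[OF _ bb])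
      then have "x = t" using x ts by auto
      then show False using x \<open>\<not> f t \<le> r\<close> by auto
    qed
    have ep: "exit_point h r = h s"
      unfolding exit_point_def s_def K_def f_def pathstart_def by simp
    have gT: "g t = h (b * (t / a))" if "0 \<le> t" "t \<le> a" for t
      using gh[of "t / a"] that ab by (simp add: divide_simps)
    show ?thesis unfolding reaches_def
    proof (intro exI[of _ "a * (s / b)"] conjI ballI)
      show "0 < a * (s / b)" using ab s \<open>s \<noteq> 0\<close> by simp
      have sb': "s / b \<le> 1 / 2" using sb ab by (simp add: field_simps)
      have "a * (s / b) \<le> 1 * (1 / 2)" using ab s sb' by (intro mult_mono) auto
      then show "a * (s / b) < 1" by (rule le_less_trans) simp
      have *: "a * (s / b) \<le> a" using ab s sb' by (intro mult_left_le) auto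
      show "g (a * (s / b)) = exit_point h r"
        unfolding ep using gT[OF _ *] ab s by simp
      show "dist (g 0) (exit_point h r) = r" unfolding ep g0 using s f_def by simp
      fix t assume t: "t \<in> {0..a * (s / b)}"
      then have "b * (t / a) \<in> {0..s}" using ab by (simp add: field_simps)
      then have "f (b * (t / a)) \<le> r" by (rule before)
      then show "dist (g 0) (g t) \<le> r" unfolding g0 using gT[of t] t * f_def by simp
    qed
  qed
  then show ?thesis using pos unfolding eventually_at_right_field by auto
qed

section \<open>Finitely many arcs with common ends do not fill the sphere\<close>

lemma connected_sphere2_diff_finite:
  assumes m: "m \<in> sphere2" and F: "finite F" "F \<subseteq> sphere2 - {m}"
  shows "connected (sphere2 - {m} - F)"
proof -
  define H where "H = {x :: real^3. axis 1 1 \<bullet> x = 0}"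
  have nz: "axis 1 1 \<noteq> (0 :: real^3)" by simp
  have "(sphere2 - {m}) homeomorphic H"
    unfolding sphere2_def H_def
    by (rule homeomorphic_punctured_sphere_hyperplane[OF _ _ nz]) (use m in \<open>simp_all add: sphere2_def\<close>)
  then obtain h k where hk: "homeomorphism (sphere2 - {m}) H h k" unfolding homeomorphic_def by blast
  have "aff_dim H = 2" unfolding H_def using aff_dim_hyperplane[OF nz, of 0] by simp
  then have "\<not> collinear H" by (simp add: collinear_aff_dim)
  moreover have "convex H" unfolding H_def by (rule convex_hyperplane)
  moreover have "countable (h ` F)" using F(1) by (simp add: countable_finite)
  ultimately have conn: "connected (H - h ` F)"
    by (intro connected_convex_diff_countable)
  have hk': "continuous_on H k" "\<And>x. x \<in> sphere2 - {m} \<Longrightarrow> h x \<in> H \<and> k (h x) = x"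
    "\<And>y. y \<in> H \<Longrightarrow> k y \<in> sphere2 - {m} \<and> h (k y) = y"
    using hk unfolding homeomorphism_def by blast+
  have "continuous_on (H - h ` F) k"
    using hk'(1) by (rule continuous_on_subset) blast
  then have "connected (k ` (H - h ` F))" using conn by (rule connected_continuous_image)
  moreover have "k ` (H - h ` F) = sphere2 - {m} - F"
  proof
    show "k ` (H - h ` F) \<subseteq> sphere2 - {m} - F"
    proof (rule image_subsetI)
      fix y assume y: "y \<in> H - h ` F"
      then have "k y \<in> sphere2 - {m}" "h (k y) = y" using hk'(3)[of y] by simp_all
      then show "k y \<in> sphere2 - {m} - F" using y by (metis DiffD2 DiffI image_eqI)
    qed
    show "sphere2 - {m} - F \<subseteq> k ` (H - h ` F)"
    proof
      fix x assume x: "x \<in> sphere2 - {m} - F"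
      then have hx: "h x \<in> H" "k (h x) = x" using hk'(2)[of x] by simp_all
      have "h x \<notin> h ` F"
      proof
        assume "h x \<in> h ` F"
        then obtain y where y: "y \<in> F" "h x = h y" by auto
        then have "k (h y) = y" using hk'(2)[of y] F(2) by auto
        then have "x = y" unfolding y(2)[symmetric] hx(2) .
        then show False using x y by simp
      qed
      then show "x \<in> k ` (H - h ` F)" using hx by (metis DiffI image_eqI)
    qed
  qed
  ultimately show ?thesis by simp
qed

text \<open>If the arcs covered the sphere, deleting their midpoints would split it into the halves
  at \<open>u\<close> and the halves at \<open>v\<close>, two closed pieces; but finitely many
  points do not disconnect the sphere. A point off the arcs is needed as centre of
  projection.\<close>

lemma theta_not_sphere2:
  fixes g :: "'i \<Rightarrow> real \<Rightarrow> real^3"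
  assumes I: "finite I" "I \<noteq> {}" and arc: "\<And>i. i \<in> I \<Longrightarrow> arc (g i)" 
    and S: "\<And>i. i \<in> I \<Longrightarrow> path_image (g i) \<subseteq> sphere2"
    and ends: "\<And>i. i \<in> I \<Longrightarrow> g i 0 = u" "\<And>i. i \<in> I \<Longrightarrow> g i 1 = v"
    and disj: "\<And>i j. i \<in> I \<Longrightarrow> j \<in> I \<Longrightarrow> i \<noteq> j \<Longrightarrow> path_image (g i) \<inter> path_image (g j) \<subseteq> {u, v}"
  shows "\<exists>p\<in>sphere2. \<forall>i\<in>I. p \<notin> path_image (g i)"
proof (rule ccontr)
  assume "\<not> ?thesis"
  then have cover: "sphere2 \<subseteq> (\<Union>i\<in>I. path_image (g i))" by blast
  obtain i0 where i0: "i0 \<in> I" using I by blast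
  have gin: "g i s \<in> path_image (g i)" if "s \<in> {0..1}" for i s
    using that unfolding path_image_def by (rule imageI)
  have inj: "s = t" if "i \<in> I" "s \<in> {0..1}" "t \<in> {0..1}" "g i s = g i t" for i s t
    using arc[OF that(1)] that(2-4) unfolding arc_def inj_on_def by blast
  have inj2: "i = j \<and> s = t" if ij: "i \<in> I" "j \<in> I" "s \<in> {0<..<1}" "t \<in> {0..1}" "g i s = g j t" for i j s t
  proof (cases "i = j")
    case True
    then show ?thesis using inj[of i s t] ij by auto
  next
    case False
    have s01: "s \<in> {0..1}" using ij(3) by simp
    have "g i s \<in> path_image (g i)" "g i s \<in> path_image (g j)" using gin[OF s01, of i] gin[OF ij(4), of j] ij(5) by auto
    then have "g i s = u \<or> g i s = v" using disj[OF ij(1,2) False] by auto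
    then have "g i s = g i 0 \<or> g i s = g i 1" using ends ij(1) by auto
    then have "s = 0 \<or> s = 1" using inj[OF ij(1) s01, of 0] inj[OF ij(1) s01, of 1] by auto
    then show ?thesis using ij(3) by auto
  qed
  define F where "F = (\<lambda>i. g i (1 / 2)) ` I"
  define A where "A = (\<Union>i\<in>I. g i ` {0..1 / 2})"
  define B where "B = (\<Union>i\<in>I. g i ` {1 / 2..1})"
  define X where "X = sphere2 - F"
  have pathg: "continuous_on {0..1} (g i)" if "i \<in> I" for i using arc[OF that] unfolding arc_def path_def by blast
  have "compact (g i ` {0..1 / 2})" "compact (g i ` {1 / 2..1})" if "i \<in> I" for i
    using continuous_on_subset[OF pathg[OF that], of "{0..1 / 2}"] continuous_on_subset[OF pathg[OF that], of "{1 / 2..1}"]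
    by (auto intro!: compact_continuous_image)
  then have "compact A" "compact B"
    unfolding A_def B_def using I(1) by (auto intro!: compact_UN)
  then have cl: "closed A" "closed B" by (auto intro: compact_imp_closed)
  have F: "F \<subseteq> sphere2" using S gin[of "1 / 2"] unfolding F_def by auto
  have m: "g i0 (1 / 2) \<in> F" using i0 unfolding F_def by blast
  then have "connected (sphere2 - {g i0 (1 / 2)} - (F - {g i0 (1 / 2)}))"
    using I F by (intro connected_sphere2_diff_finite) (auto simp: F_def)
  moreover have "sphere2 - {g i0 (1 / 2)} - (F - {g i0 (1 / 2)}) = X" using m unfolding X_def by auto
  ultimately have conn: "connected X" by simp
  have XAB: "X \<subseteq> A \<union> B"
  proof
    fix x assume "x \<in> X"
    then obtain i where i: "i \<in> I" "x \<in> path_image (g i)" using cover unfolding X_def by blast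
    then obtain t where t: "t \<in> {0..1}" "x = g i t" unfolding path_image_def by blast
    then have "t \<in> {0..1 / 2} \<or> t \<in> {1 / 2..1}" by auto
    then show "x \<in> A \<union> B" using i(1) t(2) unfolding A_def B_def by blast
  qed
  have disjAB: "A \<inter> B \<inter> X = {}"
  proof -
    have False if x: "x \<in> A" "x \<in> B" "x \<in> X" for x
    proof -
      obtain i s where i: "i \<in> I" "s \<in> {0..1 / 2}" "x = g i s" using x(1) unfolding A_def by blast
      obtain j t where j: "j \<in> I" "t \<in> {1 / 2..1}" "x = g j t" using x(2) unfolding B_def by blast
      have nF: "x \<noteq> g k (1 / 2)" if "k \<in> I" for k using x(3) that unfolding X_def F_def by blast
      have s: "s < 1 / 2" using i nF[OF i(1)] by (cases "s = 1 / 2") auto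
      have t: "t > 1 / 2" using j nF[OF j(1)] by (cases "t = 1 / 2") auto
      show False
      proof (cases "i = j")
        case True
        then show False using inj[of i s t] i j s t by auto
      next
        case False
        have "s = 0" using inj2[of i j s t] i j s t False by force
        moreover have "t = 1" using inj2[of j i t s] i j s t False by force
        ultimately have "u = g j 1" "x = u" using ends i j by auto
        then have "g j 0 = g j 1" using ends j by simp
        then show False using inj[of j 0 1] j(1) by auto
      qed
    qed
    then show ?thesis by blast
  qed
  \<comment> \<open>The other interior points survive the deletion; those at 1/4 and 3/4 show that
    neither piece is empty.\<close>
  have q: "g i0 q \<in> X" if "q \<in> {0<..<1}" "q \<noteq> 1 / 2" for q
  proof -
    have "g i0 q \<in> sphere2" using S[OF i0] gin[of q i0] that by auto
    moreover have "g i0 q \<notin> F" using inj2[of i0 _ q "1 / 2"] i0 that unfolding F_def by auto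
    ultimately show ?thesis unfolding X_def by simp
  qed
  have "1 / 4 \<in> {0..1 / 2::real}" "3 / 4 \<in> {1 / 2..1::real}" by auto
  then have "g i0 (1 / 4) \<in> A" "g i0 (3 / 4) \<in> B" using i0 unfolding A_def B_def by blast+
  then have "g i0 (1 / 4) \<in> A \<inter> X" "g i0 (3 / 4) \<in> B \<inter> X"
    using q[of "1 / 4"] q[of "3 / 4"] by simp_all
  then show False
    using conn cl XAB disjAB unfolding connected_closed by blast
qed

section \<open>Arcs in plane graphs\<close>

lemma plane_graph_edge:
  assumes "plane_graph G \<Gamma>" "e \<in> edges G"
  shows "simple_path (edge_curve \<Gamma> e)" "path_image (edge_curve \<Gamma> e) \<subseteq> sphere2"
    "path_image (edge_curve \<Gamma> e) \<inter> vertex_point \<Gamma> ` verts G = vertex_point \<Gamma> ` set_mset (ends G e)"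
    "ends G e \<noteq> {#} \<Longrightarrow> {#pathstart (edge_curve \<Gamma> e), pathfinish (edge_curve \<Gamma> e)#} = image_mset (vertex_point \<Gamma>) (ends G e)"
  using assms unfolding plane_graph_def Let_def by (auto split: if_splits)

lemma plane_graph_disjoint:
  assumes "plane_graph G \<Gamma>" "e \<in> edges G" "f \<in> edges G" "e \<noteq> f"
  shows "path_image (edge_curve \<Gamma> e) \<inter> path_image (edge_curve \<Gamma> f) \<subseteq> vertex_point \<Gamma> ` verts G"
  using assms unfolding plane_graph_def by blast

lemma plane_graph_inj:
  "plane_graph G \<Gamma> \<Longrightarrow> inj_on (vertex_point \<Gamma>) (verts G)"
  unfolding plane_graph_def by blast

lemma plane_graph_vertex:
  assumes "plane_graph G \<Gamma>" "v \<in> verts G" shows "vertex_point \<Gamma> v \<in> sphere2"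
proof -
  have "vertex_point \<Gamma> ` verts G \<subseteq> sphere2" using assms(1) unfolding plane_graph_def by (rule conjunct1)
  then show ?thesis using assms(2) by blast
qed

section \<open>Half-edges and the arcs traced by graph paths\<close>

lemma half_edge_curve_simps:
  "path_image (half_edge_curve \<Gamma> h) = path_image (edge_curve \<Gamma> (fst h))"
  "half_edge_curve \<Gamma> (e, \<not> i) = reversepath (half_edge_curve \<Gamma> (e, i))"
  by (auto simp: half_edge_curve_def)

lemma half_edge_curve_simple:
  assumes "plane_graph G \<Gamma>" "fst h \<in> edges G"
  shows "simple_path (half_edge_curve \<Gamma> h)"
  using plane_graph_edge(1)[OF assms] by (simp add: half_edge_curve_def simple_path_reversepath)

lemma half_edge_exists:
  assumes "plane_graph G \<Gamma>" "e \<in> edges G" "ends G e = {#u, w#}"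
  obtains i where "pathstart (half_edge_curve \<Gamma> (e, i)) = vertex_point \<Gamma> u"
    "pathfinish (half_edge_curve \<Gamma> (e, i)) = vertex_point \<Gamma> w"
proof -
  have "{#pathstart (edge_curve \<Gamma> e), pathfinish (edge_curve \<Gamma> e)#} = {#vertex_point \<Gamma> u, vertex_point \<Gamma> w#}"
    using plane_graph_edge(4)[OF assms(1,2)] assms(3) by simp
  then have "pathstart (edge_curve \<Gamma> e) = vertex_point \<Gamma> u \<and> pathfinish (edge_curve \<Gamma> e) = vertex_point \<Gamma> w \<or>
      pathstart (edge_curve \<Gamma> e) = vertex_point \<Gamma> w \<and> pathfinish (edge_curve \<Gamma> e) = vertex_point \<Gamma> u"
    by (auto simp: add_eq_conv_ex)
  then show thesis using that[of False] that[of True] by (auto simp: half_edge_curve_def)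
qed

text \<open>\<open>a\<close> and \<open>b\<close> are the first and the last edge, \<open>X\<close>
  and \<open>D\<close> the vertices and the edges passed. The extreme edges are recorded because
  they decide where the arc leaves its two ends.\<close>

inductive gpath :: "('v, 'e) multigraph \<Rightarrow> 'v \<Rightarrow> 'e \<Rightarrow> 'v set \<Rightarrow> 'e set \<Rightarrow> 'e \<Rightarrow> 'v \<Rightarrow> bool"
  for G u where
  single: "\<lbrakk>e \<in> edges G; ends G e = {#u, w#}; u \<noteq> w\<rbrakk> \<Longrightarrow> gpath G u e {u, w} {e} e w"
| extend: "\<lbrakk>gpath G u a X D b w; e \<in> edges G; ends G e = {#w, z#}; z \<notin> X\<rbrakk>
    \<Longrightarrow> gpath G u a (insert z X) (insert e D) e z"

lemma gpath_props:
  assumes "gpath G u a X D b w"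
  shows "D \<subseteq> edges G" "X = (\<Union>e\<in>D. set_mset (ends G e))" "u \<in> X" "w \<in> X" "u \<noteq> w" "a \<in> D" "b \<in> D"
proof -
  have "D \<subseteq> edges G \<and> X = (\<Union>e\<in>D. set_mset (ends G e)) \<and> u \<in> X \<and> w \<in> X \<and> u \<noteq> w \<and> a \<in> D \<and> b \<in> D"
    using assms by induction auto
  then show "D \<subseteq> edges G" "X = (\<Union>e\<in>D. set_mset (ends G e))" "u \<in> X" "w \<in> X" "u \<noteq> w" "a \<in> D" "b \<in> D"
    by blast+
qed

text \<open>The edges are joined one after another. The germs at both ends are tracked because the
  cyclic order at a vertex sees nothing else of the arc.\<close>

lemma gpath_arc:
  assumes pg: "plane_graph G \<Gamma>" and fin: "finite_multigraph G" and "gpath G u a X D b w"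
  shows "\<exists>P. arc P \<and> pathstart P = vertex_point \<Gamma> u \<and> pathfinish P = vertex_point \<Gamma> w \<and>
     path_image P = (\<Union>e\<in>D. path_image (edge_curve \<Gamma> e)) \<and>
     (\<exists>i. pathstart (half_edge_curve \<Gamma> (a, i)) = vertex_point \<Gamma> u \<and> same_germ P (half_edge_curve \<Gamma> (a, i))) \<and>
     (\<exists>j. pathstart (half_edge_curve \<Gamma> (b, j)) = vertex_point \<Gamma> w \<and> same_germ (reversepath P) (half_edge_curve \<Gamma> (b, j)))"
  using assms(3)
proof induction
  case (single e w)
  obtain i where i: "pathstart (half_edge_curve \<Gamma> (e, i)) = vertex_point \<Gamma> u"
    "pathfinish (half_edge_curve \<Gamma> (e, i)) = vertex_point \<Gamma> w"
    using half_edge_exists[OF pg single(1,2)] by blast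
  have uw: "u \<in> verts G" "w \<in> verts G"
    using fin single(1,2) unfolding finite_multigraph_def by force+
  have "vertex_point \<Gamma> u \<noteq> vertex_point \<Gamma> w"
    using plane_graph_inj[OF pg] uw single(3) by (auto dest: inj_onD)
  then have "arc (half_edge_curve \<Gamma> (e, i))"
    using half_edge_curve_simple[OF pg, of "(e, i)"] single(1) i by (simp add: arc_simple_path)
  moreover have "same_germ g g" for g unfolding same_germ_def by (intro exI[of _ 1]) auto
  moreover have "pathstart (half_edge_curve \<Gamma> (e, \<not> i)) = vertex_point \<Gamma> w"
    using i half_edge_curve_simps(2)[of \<Gamma> e i] by simp
  ultimately show ?case
    using i half_edge_curve_simps(1)[of \<Gamma> "(e, i)"] half_edge_curve_simps(2)[of \<Gamma> e i]
    by (intro exI[of _ "half_edge_curve \<Gamma> (e, i)"]) (auto intro: exI[of _ i] exI[of _ "\<not> i"])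
next
  case (extend a X D b w e z)
  note gp = gpath_props[OF extend.hyps(1)]
  obtain P where P: "arc P" "pathstart P = vertex_point \<Gamma> u" "pathfinish P = vertex_point \<Gamma> w"
      "path_image P = (\<Union>e\<in>D. path_image (edge_curve \<Gamma> e))"
      "\<exists>i. pathstart (half_edge_curve \<Gamma> (a, i)) = vertex_point \<Gamma> u \<and> same_germ P (half_edge_curve \<Gamma> (a, i))"
    using extend.IH by blast
  obtain i where i: "pathstart (half_edge_curve \<Gamma> (e, i)) = vertex_point \<Gamma> w"
    "pathfinish (half_edge_curve \<Gamma> (e, i)) = vertex_point \<Gamma> z"
    using half_edge_exists[OF pg extend.hyps(2,3)] by blast
  have wz: "w \<in> verts G" "z \<in> verts G"
    using fin extend.hyps(2,3) unfolding finite_multigraph_def by force+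
  have XV: "X \<subseteq> verts G" using gp(1) fin unfolding gp(2) finite_multigraph_def by blast
  have "w \<noteq> z" using gp(4) extend.hyps(4) by blast
  then have "vertex_point \<Gamma> w \<noteq> vertex_point \<Gamma> z"
    using plane_graph_inj[OF pg] wz by (auto dest: inj_onD)
  then have arch: "arc (half_edge_curve \<Gamma> (e, i))"
    using half_edge_curve_simple[OF pg, of "(e, i)"] extend.hyps(2) i by (simp add: arc_simple_path)
  have eD: "e \<notin> D" using gp(2) extend.hyps(3,4) by auto
  \<comment> \<open>A common point lies on two different edges, hence is a vertex; it belongs to
    \<open>X\<close>, which excludes the new end \<open>z\<close> and leaves the joint
    \<open>w\<close>.\<close>
  have int: "path_image P \<inter> path_image (half_edge_curve \<Gamma> (e, i)) \<subseteq> {pathstart (half_edge_curve \<Gamma> (e, i))}"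
  proof
    fix x assume x: "x \<in> path_image P \<inter> path_image (half_edge_curve \<Gamma> (e, i))"
    then obtain d where d: "d \<in> D" "x \<in> path_image (edge_curve \<Gamma> d)" unfolding P(4) by blast
    have xe: "x \<in> path_image (edge_curve \<Gamma> e)" using x by (simp add: half_edge_curve_simps)
    have dE: "d \<in> edges G" "d \<noteq> e" using d(1) gp(1) eD by blast+
    have xV: "x \<in> vertex_point \<Gamma> ` verts G"
      using plane_graph_disjoint[OF pg dE(1) extend.hyps(2) dE(2)] d(2) xe by blast
    have "x \<in> vertex_point \<Gamma> ` set_mset (ends G d)"
      using plane_graph_edge(3)[OF pg dE(1)] xV d(2) by blast
    then obtain y where y: "y \<in> X" "x = vertex_point \<Gamma> y" using d(1) gp(2) by blast
    have "x \<in> vertex_point \<Gamma> ` set_mset (ends G e)"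
      using plane_graph_edge(3)[OF pg extend.hyps(2)] xV xe by blast
    then have "x = vertex_point \<Gamma> w \<or> x = vertex_point \<Gamma> z" using extend.hyps(3) by auto
    moreover have "x \<noteq> vertex_point \<Gamma> z"
    proof
      assume "x = vertex_point \<Gamma> z"
      then have "y = z" using y inj_onD[OF plane_graph_inj[OF pg], of y z] XV wz by auto
      then show False using y extend.hyps(4) by simp
    qed
    ultimately show "x \<in> {pathstart (half_edge_curve \<Gamma> (e, i))}" using i by simp
  qed
  define Q where "Q = P +++ half_edge_curve \<Gamma> (e, i)"
  have fs: "pathfinish P = pathstart (half_edge_curve \<Gamma> (e, i))" using P i by simp
  have "arc Q" unfolding Q_def by (rule arc_join[OF P(1) arch fs int])
  moreover have "path_image Q = (\<Union>f\<in>insert e D. path_image (edge_curve \<Gamma> f))"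
    unfolding Q_def path_image_join[OF fs] P(4) half_edge_curve_simps by auto
  moreover have "same_germ Q h" if Ph: "same_germ P h" for h
  proof -
    obtain s t where st: "0 < s" "s \<le> 1" "0 < t" "t \<le> 1" "\<And>x. x \<in> {0..1} \<Longrightarrow> P (s * x) = h (t * x)"
      using Ph unfolding same_germ_def by blast
    \<comment> \<open>\<open>P\<close> occupies the first half of \<open>Q\<close>, hence the halved
      factor.\<close>
    have "Q (s / 2 * x) = h (t * x)" if x: "x \<in> {0..1}" for x
    proof -
      have "s * x \<le> 1" using st x by (auto intro: mult_le_one)
      then have "Q (s / 2 * x) = P (s * x)" unfolding Q_def joinpaths_def by simp
      then show ?thesis using st(5)[OF x] by simp
    qed
    then show ?thesis unfolding same_germ_def using st by (intro exI[of _ "s / 2"] exI[of _ t]) auto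
  qed
  moreover have "same_germ (reversepath Q) (half_edge_curve \<Gamma> (e, \<not> i))"
  proof -
    have "reversepath Q (1 / 2 * x) = half_edge_curve \<Gamma> (e, \<not> i) (1 * x)" if x: "x \<in> {0..1}" for x
    \<comment> \<open>At the joint \<open>joinpaths\<close> still evaluates its first path, so this
      one parameter needs that the ends agree.\<close>
    proof (cases "x = 1")
      case True
      then show ?thesis
        using fs unfolding Q_def half_edge_curve_simps(2)[of \<Gamma> e i] reversepath_def joinpaths_def
        by (simp add: pathfinish_def pathstart_def)
    next
      case False
      then have "1 - 1 / 2 * x > 1 / 2" using x by simp
      then show ?thesis
        unfolding Q_def half_edge_curve_simps(2)[of \<Gamma> e i] reversepath_def joinpaths_def by (simp add: algebra_simps)
    qed
    then show ?thesis unfolding same_germ_def by (intro exI[of _ "1 / 2"] exI[of _ 1]) auto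
  qed
  moreover have "pathstart (half_edge_curve \<Gamma> (e, \<not> i)) = vertex_point \<Gamma> z"
    using i half_edge_curve_simps(2)[of \<Gamma> e i] by simp
  moreover have "pathstart Q = vertex_point \<Gamma> u" "pathfinish Q = vertex_point \<Gamma> z"
    unfolding Q_def using P i by simp_all
  ultimately show ?case using P(5) by blast
qed

section \<open>The order in which half-edges leave small discs\<close>

definition turns :: "('v, 'e) drawing \<Rightarrow> 'v \<Rightarrow> 'e half_edge \<Rightarrow> 'e half_edge \<Rightarrow> 'e half_edge \<Rightarrow> bool" where
  "turns \<Gamma> v h\<^sub>1 h\<^sub>2 h\<^sub>3 \<longleftrightarrow> (\<forall>\<^sub>F r in at_right 0. ccw_points (vertex_point \<Gamma> v)
        (exit_point (half_edge_curve \<Gamma> h\<^sub>1) r)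
        (exit_point (half_edge_curve \<Gamma> h\<^sub>2) r)
        (exit_point (half_edge_curve \<Gamma> h\<^sub>3) r))"

lemma ccw_turns: "ccw G \<Gamma> v h1 h2 h3 \<longleftrightarrow> v \<in> verts G \<and> half_edges_at G \<Gamma> v = {h1, h2, h3} \<and> turns \<Gamma> v h1 h2 h3"
  by (simp add: ccw_def turns_def)

lemma ccw_points_rotate: "ccw_points u a b c \<longleftrightarrow> ccw_points u b c a"
proof -
  have "cross3 (b - a) (c - a) = cross3 (c - b) (a - b)"
    by (simp add: cross3_simps)
  then show ?thesis by (simp add: ccw_points_def)
qed

lemma ccw_points_swap: "cross3 (c - a) (b - a) \<bullet> u = - (cross3 (b - a) (c - a) \<bullet> u)"
  using cross_skew[of "c - a" "b - a"] by simp

lemma ccw_points_asym: "ccw_points u a b c \<Longrightarrow> \<not> ccw_points u a c b"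
  unfolding ccw_points_def using ccw_points_swap[of c a b u] by linarith

lemma turns_rotate: "turns \<Gamma> v h1 h2 h3 \<Longrightarrow> turns \<Gamma> v h2 h3 h1"
  unfolding turns_def by (erule eventually_mono) (rule ccw_points_rotate[THEN iffD1])

lemma turns_asym: "turns \<Gamma> v h1 h2 h3 \<Longrightarrow> \<not> turns \<Gamma> v h1 h3 h2"
proof
  assume "turns \<Gamma> v h1 h2 h3" "turns \<Gamma> v h1 h3 h2"
  then have "\<forall>\<^sub>F r in at_right (0::real). False"
    unfolding turns_def by eventually_elim (simp add: ccw_points_asym)
  then show False by simp
qed

lemma turns_distinct: 
  assumes "turns \<Gamma> v h1 h2 h3" shows "h1 \<noteq> h2" "h2 \<noteq> h3" "h1 \<noteq> h3"
proof -
  have *: "h2 \<noteq> h3" if "turns \<Gamma> v h1 h2 h3" for h1 h2 h3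
    using turns_asym[OF that] that by auto
  show "h1 \<noteq> h2" "h2 \<noteq> h3" "h1 \<noteq> h3"
    using *[OF assms] *[OF turns_rotate[OF assms]] *[OF turns_rotate[OF turns_rotate[OF assms]]] by auto
qed

text \<open>For small radii the exit point of a half-edge is reached by every arc with its germ. A
  sign that is constant for all small radii thus fixes the order, a negative one meaning the
  opposite order.\<close>

lemma turns_from_sgn:
  assumes "\<tau> \<noteq> 0" "d > 0" and u: "u = vertex_point \<Gamma> v"
    and "\<And>r z1 z2 z3. 0 < r \<Longrightarrow> r < d \<Longrightarrow> reaches g1 r z1 \<Longrightarrow> reaches g2 r z2 \<Longrightarrow> reaches g3 r z3
       \<Longrightarrow> sgn (cross3 (z2 - z1) (z3 - z1) \<bullet> u) = sgn (\<tau> :: real)"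
    and "same_germ g1 (half_edge_curve \<Gamma> h1)" "same_germ g2 (half_edge_curve \<Gamma> h2)" "same_germ g3 (half_edge_curve \<Gamma> h3)"
    and "simple_path (half_edge_curve \<Gamma> h1)" "simple_path (half_edge_curve \<Gamma> h2)" "simple_path (half_edge_curve \<Gamma> h3)"
  shows "if \<tau> > 0 then turns \<Gamma> v h1 h2 h3 else turns \<Gamma> v h1 h3 h2"
proof -
  have reach: "\<forall>\<^sub>F r in at_right 0. reaches g r (exit_point h r)" if "same_germ g h" "simple_path h" for g h
  proof (rule exit_point_reaches[OF that(1)])
    show "path h" using that(2) by (rule simple_path_imp_path)
    show "h t \<noteq> h 0" if "0 < t" "t < 1" for t
      using \<open>simple_path h\<close> that unfolding simple_path_def loop_free_def by force
  qed
  have "\<forall>\<^sub>F r in at_right 0. sgn (cross3 (exit_point (half_edge_curve \<Gamma> h2) r - exit_point (half_edge_curve \<Gamma> h1) r)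
      (exit_point (half_edge_curve \<Gamma> h3) r - exit_point (half_edge_curve \<Gamma> h1) r) \<bullet> u) = sgn \<tau>"
    using reach[OF assms(5,8)] reach[OF assms(6,9)] reach[OF assms(7,10)]
      eventually_at_right_less[of "0::real"] eventually_at_right_real[OF assms(2)]
  proof eventually_elim
    case (elim r)
    then show ?case by (intro assms(4)) auto
  qed
  then have *: "\<forall>\<^sub>F r in at_right 0. if \<tau> > 0 then ccw_points u (exit_point (half_edge_curve \<Gamma> h1) r)
      (exit_point (half_edge_curve \<Gamma> h2) r) (exit_point (half_edge_curve \<Gamma> h3) r)
      else ccw_points u (exit_point (half_edge_curve \<Gamma> h1) r)
      (exit_point (half_edge_curve \<Gamma> h3) r) (exit_point (half_edge_curve \<Gamma> h2) r)"
  proof eventually_elim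
    case (elim r)
    then show ?case
      using \<open>\<tau> \<noteq> 0\<close> ccw_points_swap[of "exit_point (half_edge_curve \<Gamma> h3) r" "exit_point (half_edge_curve \<Gamma> h1) r"
          "exit_point (half_edge_curve \<Gamma> h2) r" u]
      unfolding ccw_points_def
      by (simp add: sgn_if split: if_splits)
  qed
  show ?thesis
  proof (cases "\<tau> > 0")
    case True
    then show ?thesis using * unfolding turns_def u by simp
  next
    case False
    then show ?thesis using * unfolding turns_def u by simp
  qed
qed

lemma gpath_images_meet:
  assumes pg: "plane_graph G \<Gamma>" and fin: "finite_multigraph G"
    and p: "gpath G u a X D b v" "gpath G u' a' X' D' b' v'"
    and disj: "X \<inter> X' \<subseteq> {u, v}" "D \<inter> D' = {}"
  shows "(\<Union>e\<in>D. path_image (edge_curve \<Gamma> e)) \<inter> (\<Union>e\<in>D'. path_image (edge_curve \<Gamma> e))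
    \<subseteq> {vertex_point \<Gamma> u, vertex_point \<Gamma> v}"
proof
  fix x assume "x \<in> (\<Union>e\<in>D. path_image (edge_curve \<Gamma> e)) \<inter> (\<Union>e\<in>D'. path_image (edge_curve \<Gamma> e))"
  then obtain d e where d: "d \<in> D" "x \<in> path_image (edge_curve \<Gamma> d)" and e: "e \<in> D'" "x \<in> path_image (edge_curve \<Gamma> e)"
    by blast
  note gp = gpath_props[OF p(1)] and gp' = gpath_props[OF p(2)]
  have E: "d \<in> edges G" "e \<in> edges G" "d \<noteq> e" using d e gp(1) gp'(1) disj(2) by blast+
  have xV: "x \<in> vertex_point \<Gamma> ` verts G" using plane_graph_disjoint[OF pg E] d e by blast
  have "x \<in> vertex_point \<Gamma> ` set_mset (ends G d)" "x \<in> vertex_point \<Gamma> ` set_mset (ends G e)"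
    using plane_graph_edge(3)[OF pg E(1)] plane_graph_edge(3)[OF pg E(2)] xV d e by blast+
  then obtain y z where y: "y \<in> set_mset (ends G d)" "x = vertex_point \<Gamma> y"
    and z: "z \<in> set_mset (ends G e)" "x = vertex_point \<Gamma> z" by blast
  have V: "y \<in> verts G" "z \<in> verts G" using fin E y z unfolding finite_multigraph_def by blast+
  have "y = z" using y z V by (intro inj_onD[OF plane_graph_inj[OF pg]]) auto
  then have "y \<in> X \<inter> X'" using d(1) e(1) y(1) z(1) unfolding gp(2) gp'(2) by blast
  then show "x \<in> {vertex_point \<Gamma> u, vertex_point \<Gamma> v}" using disj(1) y(2) by blast
qed

lemma arc_disjoint_arms:
  assumes "arc P" "arc Q" "path_image P \<inter> path_image Q \<subseteq> {u, v}"
    and "P 0 = u" "Q 0 = u" "P 1 = v" "Q 1 = v"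
  shows "disjoint_arms P Q"
  unfolding disjoint_arms_def
proof clarify
  fix s t assume st: "(s, t) \<in> corner_square" and eq: "P s = Q t"
  then have s: "s \<in> {0..1}" "t \<in> {0..1}" unfolding corner_square_def by auto
  then have "P s \<in> path_image P" "P s \<in> path_image Q" unfolding path_image_def eq by auto (metis eq imageI atLeastAtMost_iff)
  then have "P s = u \<or> P s = v" using assms(3) by blast
  moreover have "s = x" if "P s = P x" "x \<in> {0..1}" for x
    using assms(1) s that unfolding arc_def inj_on_def by blast
  moreover have "t = x" if "Q t = Q x" "x \<in> {0..1}" for x
    using assms(2) s that unfolding arc_def inj_on_def by blast
  ultimately have "(s = 0 \<and> t = 0) \<or> (s = 1 \<and> t = 1)"
    using assms(4-7) eq by force
  then show False using st unfolding corner_square_def by auto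
qed

text \<open>
  At its two branch points a theta graph has opposite cyclic orders: reversing the three arcs
  negates the turning number.
\<close>

lemma theta_turns:
  assumes pg: "plane_graph G \<Gamma>" and fin: "finite_multigraph G"
    and p: "gpath G u a1 X1 D1 b1 v" "gpath G u a2 X2 D2 b2 v" "gpath G u a3 X3 D3 b3 v"
    and X: "X1 \<inter> X2 \<subseteq> {u, v}" "X2 \<inter> X3 \<subseteq> {u, v}" "X3 \<inter> X1 \<subseteq> {u, v}"
    and D: "D1 \<inter> D2 = {}" "D2 \<inter> D3 = {}" "D3 \<inter> D1 = {}"
  obtains i1 i2 i3 j1 j2 j3 where
    "pathstart (half_edge_curve \<Gamma> (a1, i1)) = vertex_point \<Gamma> u"
    "pathstart (half_edge_curve \<Gamma> (a2, i2)) = vertex_point \<Gamma> u"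
    "pathstart (half_edge_curve \<Gamma> (a3, i3)) = vertex_point \<Gamma> u"
    "pathstart (half_edge_curve \<Gamma> (b1, j1)) = vertex_point \<Gamma> v"
    "pathstart (half_edge_curve \<Gamma> (b2, j2)) = vertex_point \<Gamma> v"
    "pathstart (half_edge_curve \<Gamma> (b3, j3)) = vertex_point \<Gamma> v"
    "turns \<Gamma> u (a1, i1) (a2, i2) (a3, i3) \<and> turns \<Gamma> v (b1, j1) (b3, j3) (b2, j2) \<or>
     turns \<Gamma> u (a1, i1) (a3, i3) (a2, i2) \<and> turns \<Gamma> v (b1, j1) (b2, j2) (b3, j3)"
proof -
  let ?I = "\<lambda>D. \<Union>e\<in>D. path_image (edge_curve \<Gamma> e)"
  have arcex: "\<exists>P i j. arc P \<and> P 0 = vertex_point \<Gamma> u \<and> P 1 = vertex_point \<Gamma> v \<and> path_image P = ?I D \<and>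
     path_image P \<subseteq> sphere2 \<and>
     pathstart (half_edge_curve \<Gamma> (a, i)) = vertex_point \<Gamma> u \<and> same_germ P (half_edge_curve \<Gamma> (a, i)) \<and>
     pathstart (half_edge_curve \<Gamma> (b, j)) = vertex_point \<Gamma> v \<and> same_germ (reversepath P) (half_edge_curve \<Gamma> (b, j)) \<and>
     simple_path (half_edge_curve \<Gamma> (a, i)) \<and> simple_path (half_edge_curve \<Gamma> (b, j))"
    if gp: "gpath G u a X D b v" for a X D b
  proof -
    have E: "a \<in> edges G" "b \<in> edges G" "D \<subseteq> edges G" using gpath_props(1,6,7)[OF gp] by blast+
    then have "?I D \<subseteq> sphere2" using plane_graph_edge(2)[OF pg] by blast
    moreover have "simple_path (half_edge_curve \<Gamma> (a, i))" "simple_path (half_edge_curve \<Gamma> (b, i))" for i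
      using half_edge_curve_simple[OF pg] E by simp_all
    ultimately show ?thesis
      using gpath_arc[OF pg fin gp] unfolding pathstart_def[where ?'a = "real^3"] pathfinish_def
      by (elim exE conjE) (intro exI conjI, assumption+, simp)
  qed
  obtain P1 i1 j1 where P1: "arc P1" "P1 0 = vertex_point \<Gamma> u" "P1 1 = vertex_point \<Gamma> v" "path_image P1 = ?I D1"
     "path_image P1 \<subseteq> sphere2"
     "pathstart (half_edge_curve \<Gamma> (a1, i1)) = vertex_point \<Gamma> u" "same_germ P1 (half_edge_curve \<Gamma> (a1, i1))"
     "pathstart (half_edge_curve \<Gamma> (b1, j1)) = vertex_point \<Gamma> v" "same_germ (reversepath P1) (half_edge_curve \<Gamma> (b1, j1))"
     "simple_path (half_edge_curve \<Gamma> (a1, i1))" "simple_path (half_edge_curve \<Gamma> (b1, j1))"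
    using arcex[OF p(1)] by (elim exE conjE)
  obtain P2 i2 j2 where P2: "arc P2" "P2 0 = vertex_point \<Gamma> u" "P2 1 = vertex_point \<Gamma> v" "path_image P2 = ?I D2"
     "path_image P2 \<subseteq> sphere2"
     "pathstart (half_edge_curve \<Gamma> (a2, i2)) = vertex_point \<Gamma> u" "same_germ P2 (half_edge_curve \<Gamma> (a2, i2))"
     "pathstart (half_edge_curve \<Gamma> (b2, j2)) = vertex_point \<Gamma> v" "same_germ (reversepath P2) (half_edge_curve \<Gamma> (b2, j2))"
     "simple_path (half_edge_curve \<Gamma> (a2, i2))" "simple_path (half_edge_curve \<Gamma> (b2, j2))"
    using arcex[OF p(2)] by (elim exE conjE)
  obtain P3 i3 j3 where P3: "arc P3" "P3 0 = vertex_point \<Gamma> u" "P3 1 = vertex_point \<Gamma> v" "path_image P3 = ?I D3"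
     "path_image P3 \<subseteq> sphere2"
     "pathstart (half_edge_curve \<Gamma> (a3, i3)) = vertex_point \<Gamma> u" "same_germ P3 (half_edge_curve \<Gamma> (a3, i3))"
     "pathstart (half_edge_curve \<Gamma> (b3, j3)) = vertex_point \<Gamma> v" "same_germ (reversepath P3) (half_edge_curve \<Gamma> (b3, j3))"
     "simple_path (half_edge_curve \<Gamma> (a3, i3))" "simple_path (half_edge_curve \<Gamma> (b3, j3))"
    using arcex[OF p(3)] by (elim exE conjE)
  let ?u = "vertex_point \<Gamma> u" and ?v = "vertex_point \<Gamma> v"
  have meet: "path_image P1 \<inter> path_image P2 \<subseteq> {?u, ?v}" "path_image P2 \<inter> path_image P3 \<subseteq> {?u, ?v}"
      "path_image P3 \<inter> path_image P1 \<subseteq> {?u, ?v}"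
    using gpath_images_meet[OF pg fin p(1,2) X(1) D(1)] gpath_images_meet[OF pg fin p(2,3) X(2) D(2)]
      gpath_images_meet[OF pg fin p(3,1) X(3) D(3)] unfolding P1(4) P2(4) P3(4) by simp_all
  \<comment> \<open>The three arcs index themselves, hence \<open>id\<close> as the family.\<close>
  have "\<exists>q\<in>sphere2. \<forall>P\<in>{P1, P2, P3}. q \<notin> path_image (id P)"
  proof (rule theta_not_sphere2)
    show "path_image (id P) \<inter> path_image (id Q) \<subseteq> {?u, ?v}"
      if "P \<in> {P1, P2, P3}" "Q \<in> {P1, P2, P3}" "P \<noteq> Q" for P Q
      using that meet by (auto simp only: id_apply insert_iff empty_iff Int_commute)
  qed (use P1 P2 P3 in auto)
  then obtain q where q: "q \<in> sphere2" "q \<notin> path_image P1" "q \<notin> path_image P2" "q \<notin> path_image P3" by auto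
  have arms: "arm q ?u P1" "arm q ?u P2" "arm q ?u P3"
    unfolding arm_def using q P1(1,2,5) P2(1,2,5) P3(1,2,5) by (auto simp: arc_imp_path)
  have disj: "disjoint_arms P1 P2" "disjoint_arms P2 P3" "disjoint_arms P3 P1"
    using arc_disjoint_arms[OF P1(1) P2(1) meet(1)] arc_disjoint_arms[OF P2(1) P3(1) meet(2)]
      arc_disjoint_arms[OF P3(1) P1(1) meet(3)] P1(2,3) P2(2,3) P3(2,3) by blast+
  have "?u \<in> path_image P1" "?v \<in> path_image P1"
    using pathstart_in_path_image[of P1] pathfinish_in_path_image[of P1] P1(2,3)
    by (simp_all add: pathstart_def pathfinish_def)
  then have uq: "dist ?u q > 0" "dist ?v q > 0" using q(2) by auto
  obtain \<tau> :: real where \<tau>: "\<tau> \<noteq> 0"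
    "\<And>r z1 z2 z3. 0 < r \<Longrightarrow> r < dist ?u q \<Longrightarrow> reaches P1 r z1 \<Longrightarrow> reaches P2 r z2 \<Longrightarrow> reaches P3 r z3
       \<Longrightarrow> sgn (cross3 (z2 - z1) (z3 - z1) \<bullet> ?u) = sgn \<tau>"
    "\<And>v r z1 z2 z3. P1 1 = v \<Longrightarrow> P2 1 = v \<Longrightarrow> P3 1 = v \<Longrightarrow> 0 < r \<Longrightarrow> r < dist v q \<Longrightarrow>
       reaches (reversepath P1) r z1 \<Longrightarrow> reaches (reversepath P2) r z2 \<Longrightarrow> reaches (reversepath P3) r z3
       \<Longrightarrow> sgn (cross3 (z2 - z1) (z3 - z1) \<bullet> v) = - sgn \<tau>"
    using triod_order[OF q(1) arms disj] by blast
  have U: "if \<tau> > 0 then turns \<Gamma> u (a1, i1) (a2, i2) (a3, i3) else turns \<Gamma> u (a1, i1) (a3, i3) (a2, i2)"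
    by (rule turns_from_sgn[OF \<tau>(1) uq(1) refl \<tau>(2) P1(7) P2(7) P3(7) P1(10) P2(10) P3(10)])
  have "sgn (cross3 (z2 - z1) (z3 - z1) \<bullet> ?v) = sgn (- \<tau>)"
    if "0 < r" "r < dist ?v q" "reaches (reversepath P1) r z1" "reaches (reversepath P2) r z2" "reaches (reversepath P3) r z3"
    for r z1 z2 z3
    using \<tau>(3)[OF P1(3) P2(3) P3(3) that] by (simp add: sgn_minus)
  moreover have "- \<tau> \<noteq> 0" using \<tau>(1) by simp
  ultimately have "if - \<tau> > 0 then turns \<Gamma> v (b1, j1) (b2, j2) (b3, j3) else turns \<Gamma> v (b1, j1) (b3, j3) (b2, j2)"
    using turns_from_sgn[OF _ uq(2) refl _ P1(9) P2(9) P3(9) P1(11) P2(11) P3(11)] by blast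
  then have "turns \<Gamma> u (a1, i1) (a2, i2) (a3, i3) \<and> turns \<Gamma> v (b1, j1) (b3, j3) (b2, j2) \<or>
     turns \<Gamma> u (a1, i1) (a3, i3) (a2, i2) \<and> turns \<Gamma> v (b1, j1) (b2, j2) (b3, j3)"
    using U \<tau>(1) by (auto split: if_splits)
  then show thesis by (rule that[OF P1(6) P2(6) P3(6) P1(8) P2(8) P3(8)])
qed

section \<open>The cyclic order at a single vertex\<close>

lemma half_edge_interior:
  assumes pg: "plane_graph G \<Gamma>" and fin: "finite_multigraph G" and h: "fst h \<in> edges G" and t: "0 < t" "t < 1"
  shows "half_edge_curve \<Gamma> h t \<notin> vertex_point \<Gamma> ` verts G"
proof
  let ?g = "half_edge_curve \<Gamma> h"
  assume "?g t \<in> vertex_point \<Gamma> ` verts G"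
  moreover have gt: "?g t \<in> path_image (edge_curve \<Gamma> (fst h))"
    using t half_edge_curve_simps(1)[of \<Gamma> h] unfolding path_image_def by auto
  ultimately have in_ends: "?g t \<in> vertex_point \<Gamma> ` set_mset (ends G (fst h))"
    using plane_graph_edge(3)[OF pg h] by blast
  then have "ends G (fst h) \<noteq> {#}" by auto
  then have "{#pathstart (edge_curve \<Gamma> (fst h)), pathfinish (edge_curve \<Gamma> (fst h))#} = image_mset (vertex_point \<Gamma>) (ends G (fst h))"
    by (rule plane_graph_edge(4)[OF pg h])
  then have "set_mset {#pathstart (edge_curve \<Gamma> (fst h)), pathfinish (edge_curve \<Gamma> (fst h))#} = vertex_point \<Gamma> ` set_mset (ends G (fst h))"
    by (metis set_image_mset)
  then have "?g t \<in> {pathstart (edge_curve \<Gamma> (fst h)), pathfinish (edge_curve \<Gamma> (fst h))}" using in_ends by simp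
  then have "?g t = ?g 0 \<or> ?g t = ?g 1"
    by (auto simp: half_edge_curve_def pathstart_def pathfinish_def reversepath_def)
  moreover have "loop_free ?g" using half_edge_curve_simple[OF pg h] unfolding simple_path_def by blast
  ultimately show False using t unfolding loop_free_def by force
qed

text \<open>The bound 1/3 takes care of loops: the two half-edges of a loop are one curve run in
  opposite directions, and they meet only at the vertex or where the parameters add up to 1.\<close>

lemma half_edges_disjoint:
  assumes pg: "plane_graph G \<Gamma>" and fin: "finite_multigraph G" and v: "v \<in> verts G"
    and h: "h \<in> half_edges_at G \<Gamma> v" "h' \<in> half_edges_at G \<Gamma> v" "h \<noteq> h'"
    and st: "0 \<le> s" "s \<le> 1 / 3" "0 \<le> t" "t \<le> 1 / 3" "(s, t) \<noteq> (0, 0)"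
  shows "half_edge_curve \<Gamma> h s \<noteq> half_edge_curve \<Gamma> h' t"
proof
  assume eq: "half_edge_curve \<Gamma> h s = half_edge_curve \<Gamma> h' t"
  have E: "fst h \<in> edges G" "fst h' \<in> edges G" using h unfolding half_edges_at_def by auto
  have 0: "half_edge_curve \<Gamma> h 0 = vertex_point \<Gamma> v" "half_edge_curve \<Gamma> h' 0 = vertex_point \<Gamma> v"
    using h unfolding half_edges_at_def by (auto simp: pathstart_def)
  have inV: "half_edge_curve \<Gamma> h s \<in> vertex_point \<Gamma> ` verts G \<longleftrightarrow> s = 0"
    "half_edge_curve \<Gamma> h' t \<in> vertex_point \<Gamma> ` verts G \<longleftrightarrow> t = 0"
    using half_edge_interior[OF pg fin E(1), of s] half_edge_interior[OF pg fin E(2), of t] 0 v st by force+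
  show False
  proof (cases "fst h = fst h'")
    case False
    have "half_edge_curve \<Gamma> h s \<in> path_image (edge_curve \<Gamma> (fst h))"
      using half_edge_curve_simps(1)[of \<Gamma> h] st unfolding path_image_def by auto
    moreover have "half_edge_curve \<Gamma> h' t \<in> path_image (edge_curve \<Gamma> (fst h'))"
      using half_edge_curve_simps(1)[of \<Gamma> h'] st unfolding path_image_def by auto
    ultimately have "half_edge_curve \<Gamma> h s \<in> vertex_point \<Gamma> ` verts G"
      using plane_graph_disjoint[OF pg E False] eq by auto
    then have "s = 0 \<and> t = 0" using inV eq by simp
    then show False using st(5) by simp
  next
    case True
    then have "h' = (fst h, \<not> snd h)" using h(3) by (cases h; cases h') auto
    then have "half_edge_curve \<Gamma> h' = reversepath (half_edge_curve \<Gamma> h)"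
      using half_edge_curve_simps(2)[of \<Gamma> "fst h" "snd h"] by simp
    then have "half_edge_curve \<Gamma> h s = half_edge_curve \<Gamma> h (1 - t)" using eq by (simp add: reversepath_def)
    moreover have "loop_free (half_edge_curve \<Gamma> h)"
      using half_edge_curve_simple[OF pg E(1)] unfolding simple_path_def by blast
    moreover have "s \<in> {0..1}" "1 - t \<in> {0..1}" using st by auto
    ultimately have "s = 1 - t \<or> s = 0 \<and> 1 - t = 1 \<or> s = 1 \<and> 1 - t = 0"
      unfolding loop_free_def by blast
    then show False using st by auto
  qed
qed

text \<open>The antipode of the vertex serves as centre of projection: it is at distance 2, and by
  continuity a short initial piece stays closer than that.\<close>

lemma half_edge_arm:
  assumes pg: "plane_graph G \<Gamma>" and v: "v \<in> verts G" and h: "h \<in> half_edges_at G \<Gamma> v"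
  obtains c where "0 < c" "c \<le> 1 / 3" "arm (- vertex_point \<Gamma> v) (vertex_point \<Gamma> v) (\<lambda>t. half_edge_curve \<Gamma> h (c * t))"
proof -
  let ?g = "half_edge_curve \<Gamma> h" and ?v = "vertex_point \<Gamma> v"
  have E: "fst h \<in> edges G" using h unfolding half_edges_at_def by auto
  have 0: "?g 0 = ?v" using h unfolding half_edges_at_def by (auto simp: pathstart_def)
  have cont: "continuous_on {0..1} ?g"
    using half_edge_curve_simple[OF pg E] unfolding simple_path_def path_def by blast
  have "\<exists>d>0. \<forall>t\<in>{0..1}. dist t 0 < d \<longrightarrow> dist (?g t) (?g 0) < 2"
    using cont unfolding continuous_on_iff by (meson atLeastAtMost_iff order_refl zero_le_one zero_less_numeral)
  then obtain d where d: "d > 0" "\<And>t. t \<in> {0..1} \<Longrightarrow> dist t 0 < d \<Longrightarrow> dist (?g t) ?v < 2" unfolding 0 by blast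
  define c where "c = min (d / 2) (1 / 3)"
  have c: "0 < c" "c \<le> 1 / 3" "c < d" using d(1) unfolding c_def by auto
  have nv: "norm ?v = 1" using plane_graph_vertex[OF pg v] by (simp add: sphere2_def)
  have ct: "c * t \<in> {0..1}" "c * t < d" if "t \<in> {0..1}" for t
  proof -
    have "c * t \<le> c" using mult_left_le[of t c] c that by simp
    moreover have "0 \<le> c * t" using c that by simp
    ultimately show "c * t \<in> {0..1}" "c * t < d" using c unfolding atLeastAtMost_iff by linarith+
  qed
  have "continuous_on {0..1} (\<lambda>t. ?g (c * t))"
    by (rule continuous_on_compose2[OF cont]) (use ct in \<open>auto intro: continuous_intros\<close>)
  then have "path (\<lambda>t. ?g (c * t))" unfolding path_def .
  moreover have "?g (c * t) \<in> sphere2 - {- ?v}" if t: "t \<in> {0..1}" for t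
  proof -
    have "?g (c * t) \<in> path_image ?g" using ct[OF t] unfolding path_image_def by (rule_tac imageI)
    then have "?g (c * t) \<in> sphere2" using plane_graph_edge(2)[OF pg E] half_edge_curve_simps(1)[of \<Gamma> h] by blast
    moreover have "dist (- ?v) ?v = 2"
    proof -
      have "- ?v - ?v = (-2) *\<^sub>R ?v" by (simp add: scaleR_2)
      then show ?thesis unfolding dist_norm using nv by simp
    qed
    moreover have "dist (?g (c * t)) ?v < 2" using d(2)[OF ct(1)[OF t]] ct[OF t] by (simp add: dist_real_def)
    ultimately show ?thesis by auto
  qed
  ultimately have "arm (- ?v) ?v (\<lambda>t. ?g (c * t))" unfolding arm_def path_image_def using 0 by auto
  then show thesis using c that by blast
qed

text \<open>Arcs without tangents might conceivably keep changing their order of exit as the radius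
  shrinks. The turning number of short initial pieces excludes this, so a cyclic order at the vertex
  exists.\<close>

lemma half_edges_turn:
  assumes pg: "plane_graph G \<Gamma>" and fin: "finite_multigraph G" and v: "v \<in> verts G"
    and h: "h1 \<in> half_edges_at G \<Gamma> v" "h2 \<in> half_edges_at G \<Gamma> v" "h3 \<in> half_edges_at G \<Gamma> v"
    and ne: "h1 \<noteq> h2" "h2 \<noteq> h3" "h3 \<noteq> h1"
  shows "turns \<Gamma> v h1 h2 h3 \<or> turns \<Gamma> v h1 h3 h2"
proof -
  let ?v = "vertex_point \<Gamma> v"
  obtain c1 where c1: "0 < c1" "c1 \<le> 1 / 3" "arm (- ?v) ?v (\<lambda>t. half_edge_curve \<Gamma> h1 (c1 * t))"
    using half_edge_arm[OF pg v h(1)] by blast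
  obtain c2 where c2: "0 < c2" "c2 \<le> 1 / 3" "arm (- ?v) ?v (\<lambda>t. half_edge_curve \<Gamma> h2 (c2 * t))"
    using half_edge_arm[OF pg v h(2)] by blast
  obtain c3 where c3: "0 < c3" "c3 \<le> 1 / 3" "arm (- ?v) ?v (\<lambda>t. half_edge_curve \<Gamma> h3 (c3 * t))"
    using half_edge_arm[OF pg v h(3)] by blast
  have disj: "disjoint_arms (\<lambda>t. half_edge_curve \<Gamma> h (c * t)) (\<lambda>t. half_edge_curve \<Gamma> h' (c' * t))"
    if "h \<in> half_edges_at G \<Gamma> v" "h' \<in> half_edges_at G \<Gamma> v" "h \<noteq> h'"
      and c: "0 < c" "c \<le> 1 / 3" "0 < c'" "c' \<le> 1 / 3" for h h' c c'
    unfolding disjoint_arms_def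
  proof (clarify, goal_cases)
    case (1 s t)
    have st: "s \<in> {0..1}" "t \<in> {0..1}" "(s, t) \<noteq> (0, 0)" using 1 unfolding corner_square_def by auto
    then have "0 \<le> c * s" "0 \<le> c' * t" "(c * s, c' * t) \<noteq> (0, 0)" using c by auto
    moreover have "c * s \<le> 1 / 3" "c' * t \<le> 1 / 3"
      using mult_left_le[of s c] mult_left_le[of t c'] st c by (meson atLeastAtMost_iff less_imp_le order_trans)+
    ultimately show False using half_edges_disjoint[OF pg fin v that(1-3), of "c * s" "c' * t"] 1(2) by simp
  qed
  have S: "?v \<in> sphere2" by (rule plane_graph_vertex[OF pg v])
  then have S': "- ?v \<in> sphere2" by (simp add: sphere2_def)
  have d: "dist ?v (- ?v) > 0"
  proof -
    have "?v \<noteq> 0" using S by (auto simp: sphere2_def)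
    then have "2 *\<^sub>R ?v \<noteq> 0" by simp
    then have "?v - (- ?v) \<noteq> 0" by (simp only: scaleR_2 diff_minus_eq_add not_False_eq_True)
    then show ?thesis unfolding right_minus_eq zero_less_dist_iff .
  qed
  have germ: "same_germ (\<lambda>t. half_edge_curve \<Gamma> h (c * t)) (half_edge_curve \<Gamma> h)" if "0 < c" "c \<le> 1 / 3" for h c
    unfolding same_germ_def using that by (intro exI[of _ 1] exI[of _ c]) auto
  have simp: "simple_path (half_edge_curve \<Gamma> h)" if "h \<in> half_edges_at G \<Gamma> v" for h
    using half_edge_curve_simple[OF pg] that unfolding half_edges_at_def by auto
  obtain \<tau> :: real where \<tau>: "\<tau> \<noteq> 0"
    "\<And>r z1 z2 z3. 0 < r \<Longrightarrow> r < dist ?v (- ?v) \<Longrightarrow> reaches (\<lambda>t. half_edge_curve \<Gamma> h1 (c1 * t)) r z1 \<Longrightarrow>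
       reaches (\<lambda>t. half_edge_curve \<Gamma> h2 (c2 * t)) r z2 \<Longrightarrow> reaches (\<lambda>t. half_edge_curve \<Gamma> h3 (c3 * t)) r z3
       \<Longrightarrow> sgn (cross3 (z2 - z1) (z3 - z1) \<bullet> ?v) = sgn \<tau>"
    by (rule triod_order[OF S' c1(3) c2(3) c3(3) disj[OF h(1,2) ne(1) c1(1,2) c2(1,2)]
      disj[OF h(2,3) ne(2) c2(1,2) c3(1,2)] disj[OF h(3,1) ne(3) c3(1,2) c1(1,2)]]) (rule that)
  have "if \<tau> > 0 then turns \<Gamma> v h1 h2 h3 else turns \<Gamma> v h1 h3 h2"
    by (rule turns_from_sgn[OF \<tau>(1) d refl \<tau>(2) germ[OF c1(1,2)] germ[OF c2(1,2)] germ[OF c3(1,2)]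
      simp[OF h(1)] simp[OF h(2)] simp[OF h(3)]])
  then show ?thesis by (auto split: if_splits)
qed

section \<open>Menger's theorem for three paths in trivalent graphs\<close>

lemma size_2_mset:
  assumes "size A = 2" obtains x y where "A = {#x, y#}"
proof -
  obtain x B where B: "A = add_mset x B" using assms size_eq_Suc_imp_eq_union[of A 1] by auto
  then obtain y where "B = {#y#}" using assms size_1_singleton_mset[of B] by auto
  then show thesis using B that by blast
qed

section \<open>Unit flows and small cuts\<close>

definition cut :: "('v, 'e) multigraph \<Rightarrow> 'v set \<Rightarrow> 'e set" where
  "cut G P = {e \<in> edges G. \<exists>u w. ends G e = {#u, w#} \<and> u \<in> P \<and> w \<notin> P}"

text \<open>\<open>\<phi> e x\<close> is the flow that leaves \<open>x\<close> along
  \<open>e\<close>. Antisymmetry forces the value 0 on loops, and vertexless circles carry nothing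
  because they have no end.\<close>

definition flow :: "('v, 'e) multigraph \<Rightarrow> ('e \<Rightarrow> 'v \<Rightarrow> int) \<Rightarrow> bool" where
  "flow G \<phi> \<longleftrightarrow> (\<forall>e\<in>edges G. \<forall>x. -1 \<le> \<phi> e x \<and> \<phi> e x \<le> 1 \<and> (x \<notin># ends G e \<longrightarrow> \<phi> e x = 0) \<and>
     (\<forall>y. ends G e = {#x, y#} \<longrightarrow> \<phi> e y = - \<phi> e x))"

definition excess :: "('v, 'e) multigraph \<Rightarrow> ('e \<Rightarrow> 'v \<Rightarrow> int) \<Rightarrow> 'v \<Rightarrow> int" where
  "excess G \<phi> x = (\<Sum>e\<in>edges G. \<phi> e x)"

text \<open>Simple paths whose edges can all take one more unit. Vertices are not repeated, so no
  edge is used twice and one augmentation changes its flow by a single unit.\<close>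

inductive residual_path :: "('v, 'e) multigraph \<Rightarrow> ('e \<Rightarrow> 'v \<Rightarrow> int) \<Rightarrow> 'v \<Rightarrow> 'v set \<Rightarrow> 'e set \<Rightarrow> 'v \<Rightarrow> bool"
  for G \<phi> u where
  start: "residual_path G \<phi> u {u} {} u"
| step: "\<lbrakk>residual_path G \<phi> u X D z; e \<in> edges G; ends G e = {#z, y#}; y \<notin> X; \<phi> e z < 1\<rbrakk>
    \<Longrightarrow> residual_path G \<phi> u (insert y X) (insert e D) y"

lemma residual_path_props:
  assumes "residual_path G \<phi> u X D z"
  shows "u \<in> X" "z \<in> X" "\<And>e. e \<in> D \<Longrightarrow> set_mset (ends G e) \<subseteq> X"
    "\<And>x. x \<in> X \<Longrightarrow> \<exists>X D. residual_path G \<phi> u X D x"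
proof -
  have "u \<in> X \<and> z \<in> X \<and> (\<forall>e\<in>D. set_mset (ends G e) \<subseteq> X) \<and> (\<forall>x\<in>X. \<exists>X D. residual_path G \<phi> u X D x)"
    using assms
  proof induction
    case start
    show ?case using residual_path.start by fastforce
  next
    case (step X D z e y)
    then show ?case using residual_path.step[OF step.hyps] by auto
  qed
  then show "u \<in> X" "z \<in> X" "\<And>e. e \<in> D \<Longrightarrow> set_mset (ends G e) \<subseteq> X"
    "\<And>x. x \<in> X \<Longrightarrow> \<exists>X D. residual_path G \<phi> u X D x" by blast+
qed

lemma augment_flow:
  assumes fin: "finite (edges G)" and flow: "flow G \<phi>" and "residual_path G \<phi> u X D z"
  shows "\<exists>\<psi>. flow G \<psi> \<and> (\<forall>e. e \<notin> D \<longrightarrow> \<psi> e = \<phi> e) \<and>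
    (\<forall>x. excess G \<psi> x = excess G \<phi> x + of_bool (x = u) - of_bool (x = z))"
  using assms(3)
proof induction
  case start
  show ?case using flow by (intro exI[of _ \<phi>]) auto
next
  case (step X D z e y)
  obtain \<psi> where \<psi>: "flow G \<psi>" "\<And>e. e \<notin> D \<Longrightarrow> \<psi> e = \<phi> e"
    "\<And>x. excess G \<psi> x = excess G \<phi> x + of_bool (x = u) - of_bool (x = z)" using step.IH by blast
  note rp = residual_path_props[OF step.hyps(1)]
  \<comment> \<open>\<open>e\<close> ends in the new vertex \<open>y\<close>, so the augmentation up
    to \<open>z\<close> has not touched it.\<close>
  have "e \<notin> D" using rp(3)[of e] step.hyps(3,4) by auto
  then have \<psi>e: "\<psi> e = \<phi> e" by (rule \<psi>(2))
  have yz: "y \<noteq> z" using rp(2) step.hyps(4) by auto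
  define \<psi>' where "\<psi>' = \<psi>(e := (\<psi> e)(z := \<psi> e z + 1, y := \<psi> e y - 1))"
  have neg: "\<psi> e y = - \<psi> e z" using \<psi>(1) step.hyps(2,3) unfolding flow_def by blast
  have "-1 \<le> \<psi> e z" using \<psi>(1) step.hyps(2) unfolding flow_def by blast
  moreover have "\<psi> e z < 1" using step.hyps(5) unfolding \<psi>e .
  ultimately have b: "-1 \<le> \<psi> e z" "\<psi> e z < 1" by blast+
  have "flow G \<psi>'" unfolding flow_def
  proof (intro ballI allI)
    fix f x assume f: "f \<in> edges G"
    show "-1 \<le> \<psi>' f x \<and> \<psi>' f x \<le> 1 \<and> (x \<notin># ends G f \<longrightarrow> \<psi>' f x = 0) \<and>
        (\<forall>y. ends G f = {#x, y#} \<longrightarrow> \<psi>' f y = - \<psi>' f x)"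
    proof (cases "f = e")
      case False
      then have "\<psi>' f = \<psi> f" by (simp add: \<psi>'_def)
      then show ?thesis using \<psi>(1) f unfolding flow_def by metis
    next
      case True
      have "-1 \<le> \<psi> e x" "\<psi> e x \<le> 1" "x \<notin># ends G e \<longrightarrow> \<psi> e x = 0"
        using \<psi>(1) step.hyps(2) unfolding flow_def by blast+
      moreover have "\<psi>' e t = - \<psi>' e x" if "ends G e = {#x, t#}" for t
      proof -
        have "x = z \<and> t = y \<or> x = y \<and> t = z" using that step.hyps(3) by (auto simp: add_eq_conv_ex)
        then show ?thesis using yz neg unfolding \<psi>'_def by auto
      qed
      ultimately show ?thesis unfolding True using yz neg b step.hyps(3) by (auto simp: \<psi>'_def)
    qed
  qed
  moreover have "excess G \<psi>' x = excess G \<phi> x + of_bool (x = u) - of_bool (x = y)" for x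
  proof -
    have "excess G \<psi>' x = \<psi>' e x + (\<Sum>f\<in>edges G - {e}. \<psi>' f x)"
      unfolding excess_def using fin step.hyps(2) by (simp add: sum.remove)
    also have "(\<Sum>f\<in>edges G - {e}. \<psi>' f x) = (\<Sum>f\<in>edges G - {e}. \<psi> f x)"
      by (intro sum.cong) (auto simp: \<psi>'_def)
    also have "\<dots> = excess G \<psi> x - \<psi> e x"
      unfolding excess_def using fin step.hyps(2) by (simp add: sum.remove)
    also have "\<psi>' e x = \<psi> e x + of_bool (x = z) - of_bool (x = y)"
      using yz by (simp add: \<psi>'_def)
    finally show ?thesis unfolding \<psi>(3) by simp
  qed
  moreover have "\<psi>' f = \<phi> f" if "f \<notin> insert e D" for f using that \<psi>(2)[of f] by (auto simp: \<psi>'_def)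
  ultimately show ?case by blast
qed

text \<open>Flow along edges inside \<open>R\<close> cancels. An edge leaving \<open>R\<close> must
  be saturated, for otherwise its other end would be reachable as well; so each cut edge contributes
  exactly 1.\<close>

lemma sum_excess_residual:
  assumes fin: "finite_multigraph G" and flow: "flow G \<phi>" and u: "u \<in> verts G"
  defines "R \<equiv> {z. \<exists>X D. residual_path G \<phi> u X D z}"
  shows "R \<subseteq> verts G" "(\<Sum>x\<in>R. excess G \<phi> x) = int (card (cut G R))"
proof -
  have endsV: "set_mset (ends G e) \<subseteq> verts G" "size (ends G e) = 2 \<or> ends G e = {#}" if "e \<in> edges G" for e
    using fin that unfolding finite_multigraph_def by auto
  have finE: "finite (edges G)" "finite (verts G)" using fin unfolding finite_multigraph_def by auto
  have "z \<in> verts G" if "residual_path G \<phi> u X D z" for X D z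
    using that by induction (use u endsV in force)+
  then show RV: "R \<subseteq> verts G" unfolding R_def by blast
  then have finR: "finite R" using finE finite_subset by blast
  have full: "\<phi> e x = 1" if e: "e \<in> edges G" "ends G e = {#x, y#}" "x \<in> R" "y \<notin> R" for e x y
  proof (rule ccontr)
    assume "\<phi> e x \<noteq> 1"
    then have lt: "\<phi> e x < 1" using flow e(1) unfolding flow_def by (simp add: order_less_le)
    obtain X D where X: "residual_path G \<phi> u X D x" using e(3) unfolding R_def by blast
    have "y \<notin> X" using residual_path_props(4)[OF X, of y] e(4) unfolding R_def by blast
    then have "y \<in> R" using residual_path.step[OF X e(1,2) _ lt] unfolding R_def by blast
    then show False using e(4) by simp
  qed
  have edge: "(\<Sum>x\<in>R. \<phi> e x) = of_bool (e \<in> cut G R)" if e: "e \<in> edges G" for e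
  proof -
    have zero: "\<phi> e x = 0" if "x \<notin># ends G e" for x using flow e that unfolding flow_def by blast
    consider "ends G e = {#}" | x y where "ends G e = {#x, y#}"
      using endsV(2)[OF e] size_2_mset by blast
    then show ?thesis
    proof cases
      case 1
      then show ?thesis using zero by (simp add: cut_def)
    next
      case (2 x y)
      have neg: "\<phi> e y = - \<phi> e x" using flow e 2 unfolding flow_def by blast
      have "(\<Sum>z\<in>R. \<phi> e z) = (\<Sum>z\<in>R \<inter> {x, y}. \<phi> e z)"
        using finR zero 2 by (intro sum.mono_neutral_right) auto
      also have "\<dots> = of_bool (e \<in> cut G R)"
      proof (cases "x = y")
        case True
        then have "\<phi> e x = 0" using neg by simp
        moreover have "e \<notin> cut G R" unfolding cut_def using 2 True by (auto simp: add_eq_conv_ex)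
        ultimately show ?thesis using True by auto
      next
        case xy: False
        have c: "e \<in> cut G R \<longleftrightarrow> (x \<in> R) \<noteq> (y \<in> R)"
          unfolding cut_def using 2 e by (auto simp: add_eq_conv_ex)
        have e2: "ends G e = {#y, x#}" using 2 by (simp add: add_mset_commute)
        show ?thesis
          using c xy neg full[OF e 2] full[OF e e2] by (cases "x \<in> R"; cases "y \<in> R") auto
      qed
      finally show ?thesis .
    qed
  qed
  have "(\<Sum>x\<in>R. excess G \<phi> x) = (\<Sum>e\<in>edges G. \<Sum>x\<in>R. \<phi> e x)"
    unfolding excess_def by (rule sum.swap)
  also have "\<dots> = (\<Sum>e\<in>edges G. of_bool (e \<in> cut G R))" using edge by simp
  also have "\<dots> = int (card (edges G \<inter> cut G R))" using finE by (simp add: sum.If_cases of_bool_def)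
  also have "edges G \<inter> cut G R = cut G R" unfolding cut_def by auto
  finally show "(\<Sum>x\<in>R. excess G \<phi> x) = int (card (cut G R))" .
qed

text \<open>Augmenting paths: if \<open>v\<close> is unreachable in the residual graph of a flow of
  value \<open>k\<close>, the reachable set has a cut of exactly \<open>k\<close> edges, too few for
  the next value.\<close>

lemma flow_exists:
  assumes fin: "finite_multigraph G" and uv: "u \<in> verts G" "u \<noteq> v"
    and nocut: "\<And>P. P \<subseteq> verts G \<Longrightarrow> u \<in> P \<Longrightarrow> v \<notin> P \<Longrightarrow> k \<le> card (cut G P)"
  shows "\<exists>\<phi>. flow G \<phi> \<and> (\<forall>x. excess G \<phi> x = int k * (of_bool (x = u) - of_bool (x = v)))"
  using nocut
proof (induction k)
  case 0
  show ?case by (intro exI[of _ "\<lambda>_ _. 0"]) (simp add: flow_def excess_def)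
next
  case (Suc k)
  have "k \<le> card (cut G P)" if "P \<subseteq> verts G" "u \<in> P" "v \<notin> P" for P
    using Suc.prems[OF that] by simp
  then obtain \<phi> where \<phi>: "flow G \<phi>" "\<And>x. excess G \<phi> x = int k * (of_bool (x = u) - of_bool (x = v))"
    using Suc.IH by blast
  define R where "R = {z. \<exists>X D. residual_path G \<phi> u X D z}"
  note R = sum_excess_residual[OF fin \<phi>(1) uv(1), folded R_def]
  have finE: "finite (edges G)" "finite (verts G)" using fin unfolding finite_multigraph_def by auto
  have "residual_path G \<phi> u {u} {} u" by (rule residual_path.start)
  then have uR: "u \<in> R" unfolding R_def by blast
  have "v \<in> R"
  proof (rule ccontr)
    assume v: "v \<notin> R"
    have "finite R" using R(1) finE(2) finite_subset by blast
    have "(\<Sum>x\<in>R. excess G \<phi> x) = (\<Sum>x\<in>R. if x = u then int k else 0)"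
      using v \<phi>(2) uv by (intro sum.cong) auto
    then have "card (cut G R) = k" using R(2) uR \<open>finite R\<close> by simp
    then show False using Suc.prems[OF R(1) uR v] by simp
  qed
  then obtain X D where "residual_path G \<phi> u X D v" unfolding R_def by blast
  then obtain \<psi> where "flow G \<psi>" "\<And>x. excess G \<psi> x = excess G \<phi> x + of_bool (x = u) - of_bool (x = v)"
    using augment_flow[OF finE(1) \<phi>(1)] by blast
  then show ?case unfolding \<phi>(2) by (intro exI[of _ \<psi>]) (auto simp: algebra_simps)
qed

section \<open>Splitting a flow of value three into disjoint paths\<close>

locale unit_flow3 =
  fixes G :: "('v, 'e) multigraph" and \<phi> :: "'e \<Rightarrow> 'v \<Rightarrow> int" and u v :: 'v
  assumes fin: "finite_multigraph G" and tri: "trivalent G" and flow: "flow G \<phi>"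
    and exc: "\<And>x. excess G \<phi> x = 3 * (of_bool (x = u) - of_bool (x = v))"
    and uv: "u \<in> verts G" "v \<in> verts G" "u \<noteq> v"
begin

definition outs :: "'v \<Rightarrow> 'e set" where "outs x = {e \<in> edges G. \<phi> e x = 1}"
definition ins :: "'v \<Rightarrow> 'e set" where "ins x = {e \<in> edges G. \<phi> e x = -1}"

lemma finite_E: "finite (edges G)" and finite_V: "finite (verts G)"
  using fin unfolding finite_multigraph_def by auto

lemma finite_outs: "finite (outs x)" and finite_ins: "finite (ins x)"
  using finite_E unfolding outs_def ins_def by auto

lemma outs_ins_ends: "e \<in> outs x \<union> ins x \<Longrightarrow> x \<in># ends G e"
  using flow unfolding flow_def outs_def ins_def by force

lemma card_outs_ins:
  assumes "x \<in> verts G"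
  shows "int (card (outs x)) - int (card (ins x)) = 3 * (of_bool (x = u) - of_bool (x = v))"
    "card (outs x) + card (ins x) \<le> 3"
proof -
  have "\<phi> e x = of_bool (e \<in> outs x) - of_bool (e \<in> ins x)" if "e \<in> edges G" for e
  proof -
    have "-1 \<le> \<phi> e x" "\<phi> e x \<le> 1" using flow that unfolding flow_def by blast+
    then have "\<phi> e x = -1 \<or> \<phi> e x = 0 \<or> \<phi> e x = 1" by linarith
    then show ?thesis using that unfolding outs_def ins_def by auto
  qed
  then have "excess G \<phi> x = (\<Sum>e\<in>edges G. of_bool (e \<in> outs x) - of_bool (e \<in> ins x))"
    unfolding excess_def by (intro sum.cong) auto
  also have "\<dots> = int (card (edges G \<inter> outs x)) - int (card (edges G \<inter> ins x))"
    using finite_E by (simp add: sum_subtractf sum.If_cases of_bool_def)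
  also have "\<dots> = int (card (outs x)) - int (card (ins x))"
    by (simp add: Int_absorb1 outs_def ins_def)
  finally show "int (card (outs x)) - int (card (ins x)) = 3 * (of_bool (x = u) - of_bool (x = v))"
    unfolding exc by simp
  have "outs x \<inter> ins x = {}" unfolding outs_def ins_def by auto
  then have "card (outs x) + card (ins x) = card (outs x \<union> ins x)"
    by (rule card_Un_disjoint[OF finite_outs finite_ins, symmetric])
  also have "\<dots> = (\<Sum>e\<in>outs x \<union> ins x. 1)" by simp
  also have "\<dots> \<le> (\<Sum>e\<in>outs x \<union> ins x. count (ends G e) x)"
    by (intro sum_mono) (use outs_ins_ends in \<open>force simp: Suc_le_eq\<close>)
  also have "\<dots> \<le> (\<Sum>e\<in>edges G. count (ends G e) x)"
    using finite_E by (intro sum_mono2) (auto simp: outs_def ins_def)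
  also have "\<dots> = 3" using tri assms unfolding trivalent_def degree_def by blast
  finally show "card (outs x) + card (ins x) \<le> 3" .
qed

lemma ins_u: "ins u = {}" and outs_u: "card (outs u) = 3"
proof -
  have "card (outs u) = 3 \<and> card (ins u) = 0" using card_outs_ins[OF uv(1)] uv(3) by simp
  then show "ins u = {}" "card (outs u) = 3" using finite_ins[of u] by simp_all
qed

lemma outs_v: "outs v = {}"
proof -
  have "card (outs v) = 0" using card_outs_ins[OF uv(2)] uv(3) by simp
  then show "outs v = {}" using finite_outs[of v] by simp
qed

text \<open>Inflow and outflow balance at an inner vertex, and three edge ends leave room for only
  one of each. This is what turns edge-disjoint paths into internally vertex-disjoint ones.\<close>

lemma ins_inner:
  assumes "x \<in> verts G" "x \<noteq> v" "d \<in> ins x" "e \<in> ins x" shows "d = e"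
proof -
  have "x \<noteq> u" using assms(3) ins_u by auto
  then have "card (ins x) \<le> 1" using card_outs_ins[OF assms(1)] assms(2) by simp
  then show ?thesis using assms(3,4) finite_ins card_le_Suc0_iff_eq[of "ins x"] by auto
qed

lemma outs_nonempty:
  assumes "x \<in> verts G" "x \<noteq> v" "d \<in> ins x" shows "outs x \<noteq> {}"
proof -
  have "x \<noteq> u" using assms(3) ins_u by auto
  then have "card (outs x) = card (ins x)" using card_outs_ins[OF assms(1)] assms(2) by simp
  moreover have "card (ins x) \<noteq> 0" using assms(3) finite_ins by auto
  ultimately show ?thesis by auto
qed

lemma outs_head:
  assumes "e \<in> outs x" obtains y where "ends G e = {#x, y#}" "y \<noteq> x" "e \<in> ins y" "y \<in> verts G"
proof -
  have e: "e \<in> edges G" "\<phi> e x = 1" using assms unfolding outs_def by auto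
  have "x \<in># ends G e" using assms outs_ins_ends by blast
  moreover have E: "set_mset (ends G e) \<subseteq> verts G" "size (ends G e) = 2 \<or> ends G e = {#}"
    using fin e(1) unfolding finite_multigraph_def by auto
  ultimately have "size (ends G e) = 2" by auto
  then obtain p q where "ends G e = {#p, q#}" using size_2_mset by blast
  then obtain y where y: "ends G e = {#x, y#}" using \<open>x \<in># ends G e\<close> by (auto simp: add_mset_commute)
  then have "\<phi> e y = - \<phi> e x" using flow e unfolding flow_def by blast
  then have "\<phi> e y = -1" "y \<noteq> x" using e by auto
  then show thesis using that[of y] y e E by (auto simp: ins_def)
qed

lemma outs_tail: "e \<in> outs x \<Longrightarrow> e \<in> outs y \<Longrightarrow> x = y"
proof (rule ccontr)
  assume e: "e \<in> outs x" "e \<in> outs y" "x \<noteq> y"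
  obtain z where z: "ends G e = {#x, z#}" "e \<in> ins z" using outs_head[OF e(1)] by blast
  have "y \<in># ends G e" using e outs_ins_ends by blast
  then have "y = z" using z(1) e(3) by auto
  then show False using z(2) e(2) unfolding outs_def ins_def by auto
qed

inductive directed_path :: "'e \<Rightarrow> 'v set \<Rightarrow> 'e set \<Rightarrow> 'e \<Rightarrow> 'v \<Rightarrow> bool" where
  single: "\<lbrakk>e \<in> outs u; ends G e = {#u, w#}\<rbrakk> \<Longrightarrow> directed_path e {u, w} {e} e w"
| extend: "\<lbrakk>directed_path a X D b w; e \<in> outs w; ends G e = {#w, z#}; z \<notin> X\<rbrakk>
    \<Longrightarrow> directed_path a (insert z X) (insert e D) e z"

text \<open>The edges that the unit entering along \<open>a\<close> can pass. These sets are easier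
  to separate than the paths, which only have to be contained in them.\<close>

inductive_set follow :: "'e \<Rightarrow> 'e set" for a where
  first: "a \<in> follow a"
| further: "\<lbrakk>d \<in> follow a; d \<in> ins w; e \<in> outs w; w \<in> verts G\<rbrakk> \<Longrightarrow> e \<in> follow a"

lemma directed_path_props:
  assumes "directed_path a X D b w"
  shows "gpath G u a X D b w \<and> X \<subseteq> verts G \<and> b \<in> ins w \<and> b \<in> D \<and> D \<subseteq> follow a \<and>
    (\<forall>x\<in>X. x \<noteq> u \<longrightarrow> (\<exists>d\<in>D. d \<in> ins x)) \<and> (\<forall>x\<in>X. x \<noteq> w \<longrightarrow> (\<exists>d\<in>D. d \<in> outs x)) \<and>
    (\<forall>d\<in>D. d \<notin> outs w)"
  using assms
proof induction
  case (single e w)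
  obtain y where y: "ends G e = {#u, y#}" "y \<noteq> u" "e \<in> ins y" "y \<in> verts G" using outs_head[OF single(1)] by blast
  then have "y = w" using single(2) by (auto simp: add_eq_conv_ex)
  moreover have "e \<notin> outs w" using y \<open>y = w\<close> unfolding outs_def ins_def by auto
  ultimately show ?case
    using y single uv(1) gpath.single[of e G u w] follow.first by (auto simp: outs_def)
next
  case (extend a X D b w e z)
  obtain y where y: "ends G e = {#w, y#}" "y \<noteq> w" "e \<in> ins y" "y \<in> verts G" using outs_head[OF extend.hyps(2)] by blast
  then have yz: "y = z" using extend.hyps(3) by (auto simp: add_eq_conv_ex)
  have E: "e \<in> edges G" using extend.hyps(2) unfolding outs_def by auto
  have gp: "gpath G u a X D b w" using extend.IH by blast
  have "d \<notin> outs z" if "d \<in> D" for d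
  proof
    assume "d \<in> outs z"
    then have "z \<in># ends G d" using outs_ins_ends by blast
    then have "z \<in> X" using gpath_props(2)[OF gp] that by blast
    then show False using extend.hyps(4) by simp
  qed
  moreover have "e \<notin> outs z" using y yz unfolding outs_def ins_def by auto
  moreover have "w \<in> verts G" using gpath_props(4)[OF gp] extend.IH by blast
  then have "e \<in> follow a" using extend.IH extend.hyps(2) follow.further by blast
  ultimately show ?case
    using extend.IH gpath.extend[OF gp E extend.hyps(3,4)] y yz extend.hyps(2) by auto
qed

text \<open>A path with the most vertices ends at \<open>v\<close>. Otherwise flow leaves its end
  \<open>w\<close> towards some \<open>z\<close>, which by maximality is already on the path; but
  the path entered \<open>z\<close> by the only inflow edge there, which would have to leave
  \<open>w\<close>, and no path edge does.\<close>

lemma directed_path_exists: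
  assumes "a \<in> outs u"
  shows "\<exists>X D b. directed_path a X D b v"
proof -
  obtain y where y: "ends G a = {#u, y#}" using outs_head[OF assms] by blast
  let ?P = "\<lambda>(X, D, b, w). directed_path a X D b w"
  have ex: "?P ({u, y}, {a}, a, y)" using directed_path.single[OF assms y] by simp
  have bound: "card (fst p) < Suc (card (verts G))" if "?P p" for p
  proof -
    obtain X D b w where p: "p = (X, D, b, w)" by (cases p)
    then have "X \<subseteq> verts G" using that directed_path_props[of a X D b w] by auto
    then show ?thesis using p finite_V by (simp add: less_Suc_eq_le card_mono)
  qed
  obtain X D b w where P: "directed_path a X D b w"
    and max: "\<And>X' D' b' w'. directed_path a X' D' b' w' \<Longrightarrow> card X' \<le> card X"
  proof -
    obtain p where p: "?P p" "\<And>q. ?P q \<Longrightarrow> card (fst q) \<le> card (fst p)"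
      using ex_has_greatest_nat[of ?P, OF ex, of "\<lambda>p. card (fst p)" "Suc (card (verts G))"] bound by blast
    obtain X D b w where "p = (X, D, b, w)" by (cases p)
    then show thesis using p(1) p(2)[of "(_, _, _, _)"] that[of X D b w] by simp
  qed
  note pr = directed_path_props[OF P]
  have gp: "gpath G u a X D b w" and XV: "X \<subseteq> verts G" and b: "b \<in> ins w"
    and insX: "\<And>x. x \<in> X \<Longrightarrow> x \<noteq> u \<Longrightarrow> \<exists>d\<in>D. d \<in> ins x"
    and outsX: "\<And>x. x \<in> X \<Longrightarrow> x \<noteq> w \<Longrightarrow> \<exists>d\<in>D. d \<in> outs x"
    and Dw: "\<And>d. d \<in> D \<Longrightarrow> d \<notin> outs w"
    using pr by simp_all
  have w: "w \<in> verts G" using gpath_props(4)[OF gp] XV by blast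
  have "w = v"
  proof (rule ccontr)
    assume "w \<noteq> v"
    then obtain e where e: "e \<in> outs w" using outs_nonempty[OF w _ b] by blast
    obtain z where z: "ends G e = {#w, z#}" "e \<in> ins z" "z \<in> verts G" using outs_head[OF e] by blast
    show False
    proof (cases "z \<in> X")
      case False
      have "card (insert z X) = Suc (card X)"
        using False finite_subset[OF XV finite_V] by simp
      then show False using max[OF directed_path.extend[OF P e z(1) False]] by simp
    next
      case True
      have "z \<noteq> u" using z(2) ins_u by auto
      then obtain d where d: "d \<in> D" "d \<in> ins z" using insX[OF True] by blast
      \<comment> \<open>Every path vertex except \<open>w\<close> is left along the flow, whereas
        nothing leaves \<open>v\<close>.\<close>
      have "z \<noteq> v" using outsX[OF True] outs_v \<open>w \<noteq> v\<close> by blast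
      then have "d = e" using ins_inner[OF z(3) _ d(2) z(2)] by blast
      then show False using Dw[OF d(1)] e by blast
    qed
  qed
  then show ?thesis using P by blast
qed

text \<open>The inflow edge at an inner vertex is unique, so an edge determines its predecessor;
  tracing back ends in a single edge at \<open>u\<close>, where nothing flows in.\<close>

lemma follow_disjoint:
  assumes "a \<in> outs u" "a' \<in> outs u" "a \<noteq> a'" "e \<in> follow a"
  shows "e \<notin> follow a'"
  using assms(4)
proof induction
  case first
  show ?case
  proof
    assume "a \<in> follow a'"
    then show False
    proof cases
      case first
      then show False using assms(3) by simp
    next
      case (further d w)
      then have "w = u" using outs_tail assms(1) by blast
      then show False using further ins_u by blast
    qed
  qed
next
  case (further d w e)
  show ?case
  proof
    assume "e \<in> follow a'"
    then show False
    proof cases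
      case first
      then have "w = u" using outs_tail assms(2) further(3) by blast
      then show False using further(2) ins_u by blast
    next
      case n: (further d' w')
      then have w: "w' = w" using outs_tail further(3) by blast
      have "w \<noteq> v" using further(3) outs_v by auto
      then have "d' = d" using ins_inner[OF further(4)] n(2) further(2) unfolding w by blast
      then show False using n(1) further(5) by blast
    qed
  qed
qed

lemma three_paths:
  obtains X :: "'e \<Rightarrow> 'v set" and D :: "'e \<Rightarrow> 'e set" and b :: "'e \<Rightarrow> 'e" where
    "\<And>a. a \<in> edges G \<Longrightarrow> u \<in># ends G a \<Longrightarrow> gpath G u a (X a) (D a) (b a) v"
    "\<And>a a'. a \<in> edges G \<Longrightarrow> a' \<in> edges G \<Longrightarrow> u \<in># ends G a \<Longrightarrow> u \<in># ends G a' \<Longrightarrow> a \<noteq> a' \<Longrightarrow>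
       X a \<inter> X a' \<subseteq> {u, v} \<and> D a \<inter> D a' = {}"
    "card {a \<in> edges G. u \<in># ends G a} = 3"
proof -
  have "outs u \<subseteq> {a \<in> edges G. u \<in># ends G a}" using outs_ins_ends unfolding outs_def by auto
  moreover have "card {a \<in> edges G. u \<in># ends G a} \<le> 3"
  proof -
    have "card {a \<in> edges G. u \<in># ends G a} = (\<Sum>a\<in>{a \<in> edges G. u \<in># ends G a}. 1)" by simp
    also have "\<dots> \<le> (\<Sum>a\<in>{a \<in> edges G. u \<in># ends G a}. count (ends G a) u)"
      by (intro sum_mono) (auto simp: Suc_le_eq)
    also have "\<dots> \<le> (\<Sum>e\<in>edges G. count (ends G e) u)"
      using finite_E by (intro sum_mono2) auto
    also have "\<dots> = 3" using tri uv(1) unfolding trivalent_def degree_def by blast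
    finally show ?thesis .
  qed
  \<comment> \<open>All three ends at \<open>u\<close> carry outflow, so the paths use every edge
    there.\<close>
  ultimately have outs: "outs u = {a \<in> edges G. u \<in># ends G a}"
    using finite_E outs_u by (intro card_seteq) auto
  have "\<forall>a\<in>outs u. \<exists>T. directed_path a (fst T) (fst (snd T)) (snd (snd T)) v"
    using directed_path_exists by (metis fst_conv snd_conv)
  then obtain T where T: "\<And>a. a \<in> outs u \<Longrightarrow> directed_path a (fst (T a)) (fst (snd (T a))) (snd (snd (T a))) v"
    by metis
  let ?X = "\<lambda>a. fst (T a)" and ?D = "\<lambda>a. fst (snd (T a))" and ?b = "\<lambda>a. snd (snd (T a))"
  show thesis
  proof (rule that[of ?X ?D ?b])
    show "gpath G u a (?X a) (?D a) (?b a) v" if "a \<in> edges G" "u \<in># ends G a" for a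
      using directed_path_props[OF T] that outs by blast
    show "card {a \<in> edges G. u \<in># ends G a} = 3" using outs outs_u by simp
    fix a a' assume "a \<in> edges G" "a' \<in> edges G" "u \<in># ends G a" "u \<in># ends G a'" and ne: "a \<noteq> a'"
    then have a: "a \<in> outs u" "a' \<in> outs u" using outs by auto
    note p = directed_path_props[OF T[OF a(1)]] and p' = directed_path_props[OF T[OF a(2)]]
    have DF: "?D a \<subseteq> follow a" "?D a' \<subseteq> follow a'" using p p' by simp_all
    have XV: "?X a \<subseteq> verts G" using p by simp
    have insX: "\<And>x. x \<in> ?X a \<Longrightarrow> x \<noteq> u \<Longrightarrow> \<exists>d\<in>?D a. d \<in> ins x"
      "\<And>x. x \<in> ?X a' \<Longrightarrow> x \<noteq> u \<Longrightarrow> \<exists>d\<in>?D a'. d \<in> ins x" using p p' by simp_all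
    have F: "follow a \<inter> follow a' = {}" using follow_disjoint[OF a ne] by blast
    then have "?D a \<inter> ?D a' = {}" using DF by blast
    \<comment> \<open>A common inner vertex would be entered by both paths along its only inflow
      edge.\<close>
    moreover have "?X a \<inter> ?X a' \<subseteq> {u, v}"
    proof
      fix x assume x: "x \<in> ?X a \<inter> ?X a'"
      show "x \<in> {u, v}"
      proof (rule ccontr)
        assume n: "x \<notin> {u, v}"
        have "\<exists>d\<in>?D a. d \<in> ins x" "\<exists>d\<in>?D a'. d \<in> ins x" using x n insX[of x] by simp_all
        then obtain d d' where d: "d \<in> ?D a" "d \<in> ins x" "d' \<in> ?D a'" "d' \<in> ins x" by blast
        have "x \<in> verts G" using x XV by blast
        then have "d = d'" using ins_inner[of x d d'] d n by blast
        then show False using d F DF by blast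
      qed
    qed
    ultimately show "?X a \<inter> ?X a' \<subseteq> {u, v} \<and> ?D a \<inter> ?D a' = {}" by blast
  qed
qed

end

lemma three_paths_or_small_cut:
  fixes G :: "('v, 'e) multigraph"
  assumes fin: "finite_multigraph G" and tri: "trivalent G"
    and uv: "u \<in> verts G" "v \<in> verts G" "u \<noteq> v"
    and nocut: "\<And>P. P \<subseteq> verts G \<Longrightarrow> u \<in> P \<Longrightarrow> v \<notin> P \<Longrightarrow> \<not> card (cut G P) \<le> 2"
  obtains X :: "'e \<Rightarrow> 'v set" and D :: "'e \<Rightarrow> 'e set" and b :: "'e \<Rightarrow> 'e" where
    "\<And>a. a \<in> edges G \<Longrightarrow> u \<in># ends G a \<Longrightarrow> gpath G u a (X a) (D a) (b a) v"
    "\<And>a a'. a \<in> edges G \<Longrightarrow> a' \<in> edges G \<Longrightarrow> u \<in># ends G a \<Longrightarrow> u \<in># ends G a' \<Longrightarrow> a \<noteq> a' \<Longrightarrow>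
       X a \<inter> X a' \<subseteq> {u, v} \<and> D a \<inter> D a' = {}"
    "card {a \<in> edges G. u \<in># ends G a} = 3"
proof -
  have "3 \<le> card (cut G P)" if "P \<subseteq> verts G" "u \<in> P" "v \<notin> P" for P
    using nocut[OF that] by simp
  then obtain \<phi> where "flow G \<phi>" "\<And>x. excess G \<phi> x = int 3 * (of_bool (x = u) - of_bool (x = v))"
    using flow_exists[OF fin uv(1,3)] by blast
  then interpret unit_flow3 G \<phi> u v
    using fin tri uv by unfold_locales auto
  show thesis by (rule three_paths[OF that])
qed

section \<open>Flipping the vertices behind a small cut\<close>

lemma equivclp_least:
  assumes "equivclp r x y" "\<And>x y. r x y \<Longrightarrow> equivclp s x y"
  shows "equivclp s x y"
  using assms(1)
proof (induction rule: equivclp_induct)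
  case base
  show ?case by (rule equivclp_refl)
next
  case (step y z)
  then have "equivclp s y z" using assms(2) equivclp_sym by metis
  then show ?case using step.IH by (metis equivclp_trans)
qed

lemma equivclp_eqI:
  assumes "\<And>x y. r x y \<Longrightarrow> equivclp s x y" "\<And>x y. s x y \<Longrightarrow> equivclp r x y"
  shows "equivclp r = equivclp s"
  using equivclp_least[of r _ _ s] equivclp_least[of s _ _ r] assms by (intro ext iffI) blast+

definition class_count :: "'a set \<Rightarrow> ('a \<Rightarrow> 'a \<Rightarrow> bool) \<Rightarrow> nat" where
  "class_count N r = card (N // {(x, y). equivclp r x y})"

lemma class_count_image: "class_count N r = card ((\<lambda>x. {y. equivclp r x y}) ` N)"
  unfolding class_count_def quotient_def by (intro arg_cong[where f = card]) auto

definition add_pairs :: "('a \<Rightarrow> 'a \<Rightarrow> bool) \<Rightarrow> ('a \<times> 'a) set \<Rightarrow> 'a \<Rightarrow> 'a \<Rightarrow> bool" where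
  "add_pairs r A x y \<longleftrightarrow> r x y \<or> (x, y) \<in> A"

lemma add_pairs_base: "equivclp r x y \<Longrightarrow> equivclp (add_pairs r A) x y"
  by (erule equivclp_least) (simp add: add_pairs_def r_into_equivclp)

lemma add_pairs_new: "(x, y) \<in> A \<Longrightarrow> equivclp (add_pairs r A) x y"
  by (simp add: add_pairs_def r_into_equivclp)

lemma equivclp_add_pair:
  "equivclp (add_pairs r {(a, b)}) x y \<longleftrightarrow>
     equivclp r x y \<or> equivclp r x a \<and> equivclp r b y \<or> equivclp r x b \<and> equivclp r a y" (is "?L \<longleftrightarrow> ?R x y")
proof
  show "?R x y" if ?L
    using that
  proof (induction rule: equivclp_induct)
    case base
    show ?case by simp
  next
    case (step y z)
    have "equivclp r y z \<or> y = a \<and> z = b \<or> y = b \<and> z = a"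
      using step.hyps(2) unfolding add_pairs_def by (auto intro: r_into_equivclp equivclp_sym)
    then show ?case using step.IH by (metis equivclp_trans equivclp_refl equivclp_sym)
  qed
  have ab: "equivclp (add_pairs r {(a, b)}) a b" by (rule add_pairs_new) simp
  show ?L if "?R x y"
    using that ab add_pairs_base[of r _ _ "{(a, b)}"] by (metis equivclp_trans equivclp_sym)
qed

text \<open>Exactly two classes merge, and since both meet \<open>N\<close> the count drops by
  one.\<close>

lemma class_count_add_pair:
  assumes "finite N" "a \<in> N" "b \<in> N" "\<not> equivclp r a b"
  shows "class_count N r = Suc (class_count N (add_pairs r {(a, b)}))"
proof -
  define C where "C x = {y. equivclp r x y}" for x
  define C' where "C' x = {y. equivclp (add_pairs r {(a, b)}) x y}" for x
  have C: "y \<in> C x \<longleftrightarrow> C x = C y" "x \<in> C x" for x y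
    unfolding C_def using equivclp_refl equivclp_sym equivclp_trans by (metis (mono_tags, lifting) mem_Collect_eq Collect_cong)+
  have ab: "C a \<noteq> C b" using assms(4) C(1)[of b a] unfolding C_def by auto
  have C': "C' x = (if C x = C a \<or> C x = C b then C a \<union> C b else C x)" for x
    using C unfolding C'_def equivclp_add_pair C_def by auto
  have "C' ` N = insert (C a \<union> C b) (C ` N - {C a, C b})"
    unfolding C' using assms(2,3) by (auto simp: image_iff)
  moreover have "C a \<union> C b \<notin> C ` N"
  proof
    assume "C a \<union> C b \<in> C ` N"
    then obtain z where "C z = C a \<union> C b" by auto
    then have "C z = C a" "C z = C b" using C by (metis UnI1, metis UnI2)
    then show False using ab by simp
  qed
  moreover have "card (C ` N) = Suc (Suc (card (C ` N - {C a, C b})))"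
  proof -
    have "card {C a, C b} \<le> card (C ` N)" using assms(1-3) by (intro card_mono) auto
    moreover have "card (C ` N - {C a, C b}) = card (C ` N) - card {C a, C b}"
      using assms(1-3) by (intro card_Diff_subset) auto
    ultimately show ?thesis using ab by simp
  qed
  ultimately have "card (C ` N) = Suc (card (C' ` N))" using assms(1) by simp
  then show ?thesis unfolding class_count_image C_def C'_def .
qed

lemma add_pairs_insert: "add_pairs r (insert p A) = add_pairs (add_pairs r {p}) A"
  unfolding add_pairs_def by auto

lemma class_count_add_two_pairs:
  assumes N: "finite N" "a \<in> N" "b \<in> N" "c \<in> N" "d \<in> N"
    and ne: "\<not> equivclp r a b" "\<not> equivclp r a c" "\<not> equivclp r a d" "\<not> equivclp r b c" "\<not> equivclp r b d"
  shows "class_count N r = Suc (Suc (class_count N (add_pairs r {(a, d), (b, c)})))"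
proof -
  have "\<not> equivclp (add_pairs r {(a, d)}) b c"
    unfolding equivclp_add_pair using ne equivclp_sym by metis
  then show ?thesis
    using class_count_add_pair[OF N(1,2,5) ne(3)] class_count_add_pair[OF N(1,3,4), of "add_pairs r {(a, d)}"]
    unfolding add_pairs_insert[of r "(a, d)" "{(b, c)}"] by simp
qed

lemma class_count_cong: "equivclp r = equivclp s \<Longrightarrow> class_count N r = class_count N s"
  unfolding class_count_def by simp

lemma add_pairs_eqI:
  assumes "\<And>x y. (x, y) \<in> A \<Longrightarrow> equivclp (add_pairs r B) x y" "\<And>x y. (x, y) \<in> B \<Longrightarrow> equivclp (add_pairs r A) x y"
  shows "equivclp (add_pairs r A) = equivclp (add_pairs r B)"
proof -
  have *: "equivclp (add_pairs r D) x y"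
    if "add_pairs r C x y" and pairs: "\<And>x y. (x, y) \<in> C \<Longrightarrow> equivclp (add_pairs r D) x y" for C D x y
  proof (cases "r x y")
    case True
    then show ?thesis by (intro add_pairs_base r_into_equivclp)
  next
    case False
    then have "(x, y) \<in> C" using that(1) by (simp add: add_pairs_def)
    then show ?thesis by (rule pairs)
  qed
  show ?thesis
    by (rule equivclp_eqI) (rule *[of A _ _ B], assumption, erule assms, rule *[of B _ _ A], assumption, erule assms)
qed

text \<open>If the two strands of a band are already connected at one of its ends, a half twist of
  the band changes no connection.\<close>

lemma swap_pair_equiv:
  assumes "equivclp r a b \<or> equivclp r c d"
  shows "equivclp (add_pairs r {(a, d), (b, c)}) = equivclp (add_pairs r {(a, c), (b, d)})"
proof -
  have *: "equivclp (add_pairs r {(a, d), (b, c)}) a c \<and> equivclp (add_pairs r {(a, d), (b, c)}) b d"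
    if r: "equivclp r a b \<or> equivclp r c d" for a b c d
  proof -
    let ?E = "equivclp (add_pairs r {(a, d), (b, c)})"
    have ad: "?E a d" and bc: "?E b c" by (rule add_pairs_new, simp)+
    from r show ?thesis
    proof
      assume "equivclp r a b"
      then have ab: "?E a b" by (rule add_pairs_base)
      show ?thesis using equivclp_trans[OF ab bc] equivclp_trans[OF equivclp_sym[OF ab] ad] by simp
    next
      assume "equivclp r c d"
      then have cd: "?E c d" by (rule add_pairs_base)
      show ?thesis using equivclp_trans[OF ad equivclp_sym[OF cd]] equivclp_trans[OF bc cd] by simp
    qed
  qed
  have "equivclp r a b \<or> equivclp r d c" using assms equivclp_sym[of r c d] by blast
  from *[OF assms] *[OF this] show ?thesis by (intro add_pairs_eqI) auto
qed

text \<open>The second pair of strands runs parallel to the first and repeats its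
  identifications.\<close>

lemma four_pairs_single:
  assumes "equivclp r p p'" "equivclp r q q'" "equivclp r s s'" "equivclp r t t'"
  shows "equivclp (add_pairs r {(p, q), (s, t), (p', q'), (s', t')}) = equivclp (add_pairs r {(p, q), (s, t)})"
proof (rule add_pairs_eqI)
  let ?E = "equivclp (add_pairs r {(p, q), (s, t)})"
  have 1: "?E p q" "?E s t" by (rule add_pairs_new, simp)+
  have 2: "?E p' p" "?E q q'" "?E s' s" "?E t t'"
    using assms by (auto intro: add_pairs_base equivclp_sym)
  have "?E p' q'" by (rule equivclp_trans[OF equivclp_trans[OF 2(1) 1(1)] 2(2)])
  moreover have "?E s' t'" by (rule equivclp_trans[OF equivclp_trans[OF 2(3) 1(2)] 2(4)])
  ultimately show "?E x y" if "(x, y) \<in> {(p, q), (s, t), (p', q'), (s', t')}" for x y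
    using that 1 by auto
qed (auto intro: add_pairs_new)

text \<open>
  Two bands join a piece with ends \<open>a, b, a', b'\<close> to a piece with ends \<open>c, d, c', d'\<close>, and
  both bands are given a half twist.
\<close>

lemma class_count_swap_two_bands:
  assumes N: "finite N" "a \<in> N" "b \<in> N" "c \<in> N" "d \<in> N"
    and P: "equivclp r a b \<and> equivclp r a' b' \<or> equivclp r a a' \<and> equivclp r b b' \<or> equivclp r a b' \<and> equivclp r b a'"
    and Q: "equivclp r c d \<and> equivclp r c' d' \<or> equivclp r c c' \<and> equivclp r d d' \<or> equivclp r c d' \<and> equivclp r d c'"
    and PQ: "\<not> equivclp r a c" "\<not> equivclp r a d" "\<not> equivclp r b c" "\<not> equivclp r b d"
  shows "class_count N (add_pairs r {(a, d), (b, c), (a', d'), (b', c')}) =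
    class_count N (add_pairs r {(a, c), (b, d), (a', c'), (b', d')})"
\<comment> \<open>If one of the pieces connects each band with itself, the two twists are invisible
  one after the other.\<close>
proof (cases "equivclp r a b \<and> equivclp r a' b' \<or> equivclp r c d \<and> equivclp r c' d'")
  case True
  have split: "add_pairs r {(p, q), (s, t), (p', q'), (s', t')} = add_pairs (add_pairs r {(p', q'), (s', t')}) {(p, q), (s, t)}"
    for p q s t p' q' s' t' unfolding add_pairs_def by auto
  have "equivclp (add_pairs r {(a, d), (b, c), (a', d'), (b', c')}) =
      equivclp (add_pairs r {(a, c), (b, d), (a', d'), (b', c')})"
    unfolding split by (rule swap_pair_equiv) (use True in \<open>blast intro: add_pairs_base\<close>)
  also have "add_pairs r {(a, c), (b, d), (a', d'), (b', c')} = add_pairs (add_pairs r {(a, c), (b, d)}) {(a', d'), (b', c')}"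
    unfolding add_pairs_def by auto
  also have "equivclp \<dots> = equivclp (add_pairs (add_pairs r {(a, c), (b, d)}) {(a', c'), (b', d')})"
    by (rule swap_pair_equiv) (use True in \<open>blast intro: add_pairs_base\<close>)
  also have "add_pairs (add_pairs r {(a, c), (b, d)}) {(a', c'), (b', d')} = add_pairs r {(a, c), (b, d), (a', c'), (b', d')}"
    unfolding add_pairs_def by auto
  finally show ?thesis by (rule class_count_cong)
next
  case F: False
  show ?thesis
  \<comment> \<open>By transitivity the alternatives in \<open>P\<close> and \<open>Q\<close> extend
    such a connection to the other band, so this leads back to the case excluded above.\<close>
  proof (cases "equivclp r a b \<or> equivclp r c d")
    case True
    have "equivclp r a' b'" if "equivclp r a b" using that P
      by (metis equivclp_trans equivclp_sym)
    moreover have "equivclp r c' d'" if "equivclp r c d" using that Q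
      by (metis equivclp_trans equivclp_sym)
    ultimately show ?thesis using True F by blast
  next
    case ne: False
    have P': "equivclp r a a' \<and> equivclp r b b' \<or> equivclp r a b' \<and> equivclp r b a'"
      and Q': "equivclp r c c' \<and> equivclp r d d' \<or> equivclp r c d' \<and> equivclp r d c'" using P Q ne by blast+
    \<comment> \<open>In either position the first band alone merges two pairs of classes.\<close>
    have two: "class_count N (add_pairs r {(a, d), (b, c)}) = class_count N (add_pairs r {(a, c), (b, d)})"
    proof -
      have "class_count N r = Suc (Suc (class_count N (add_pairs r {(a, d), (b, c)})))"
        using N PQ ne by (intro class_count_add_two_pairs) auto
      moreover have "class_count N r = Suc (Suc (class_count N (add_pairs r {(a, c), (b, d)})))"
        using N PQ ne by (intro class_count_add_two_pairs) auto
      ultimately show ?thesis by simp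
    qed
    \<comment> \<open>One piece leads the strands across straight and the other crossed: then all
      eight ends fall into a single class, before and after the twists. Here \<open>p\<close>,
      \<open>q\<close>, \<open>s\<close>, \<open>t\<close> are the ends joined to \<open>a\<close>,
      \<open>b\<close>, \<open>c\<close>, \<open>d\<close>.\<close>
    have mixed: ?thesis
      if "equivclp r a p" "equivclp r b q" "equivclp r c s" "equivclp r d t"
        "{(p, s), (q, t)} = {(a', d'), (b', c')}" "{(p, t), (q, s)} = {(a', c'), (b', d')}" for p q s t
    proof (rule class_count_cong, rule add_pairs_eqI)
      let ?E = "equivclp (add_pairs r {(a, d), (b, c), (a', d'), (b', c')})"
      have sets: "{(a, d), (b, c), (a', d'), (b', c')} = {(a, d), (b, c), (p, s), (q, t)}"
        "{(a, c), (b, d), (a', c'), (b', d')} = {(a, c), (b, d), (p, t), (q, s)}" using that(5,6) by auto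
      have all: "\<forall>x\<in>{a, b, c, d, p, q, s, t}. \<forall>y\<in>{a, b, c, d, p, q, s, t}. equivclp (add_pairs r A) x y"
        if A: "A = {(a, d), (b, c), (p, s), (q, t)} \<or> A = {(a, c), (b, d), (p, t), (q, s)}" for A
      proof -
        let ?F = "equivclp (add_pairs r A)"
        have e: "?F a p" "?F b q" "?F c s" "?F d t"
          using \<open>equivclp r a p\<close> \<open>equivclp r b q\<close> \<open>equivclp r c s\<close> \<open>equivclp r d t\<close> by (auto intro: add_pairs_base)
        have "\<forall>x\<in>{a, b, c, d, p, q, s, t}. ?F a x"
        proof (cases "A = {(a, d), (b, c), (p, s), (q, t)}")
          case True
          have n: "?F a d" "?F b c" "?F p s" "?F q t" unfolding True by (rule add_pairs_new, simp)+
          have "?F a s" by (rule equivclp_trans[OF e(1) n(3)])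
          then have ac: "?F a c" using e(3) by (metis equivclp_trans equivclp_sym)
          then have "?F a b" using n(2) by (metis equivclp_trans equivclp_sym)
          then show ?thesis using e n ac \<open>?F a s\<close> by (metis equivclp_trans equivclp_refl empty_iff insert_iff)
        next
          case False
          then have A: "A = {(a, c), (b, d), (p, t), (q, s)}" using A by blast
          have n: "?F a c" "?F b d" "?F p t" "?F q s" unfolding A by (rule add_pairs_new, simp)+
          have "?F a t" by (rule equivclp_trans[OF e(1) n(3)])
          then have ad: "?F a d" using e(4) by (metis equivclp_trans equivclp_sym)
          then have "?F a b" using n(2) by (metis equivclp_trans equivclp_sym)
          then show ?thesis using e n ad \<open>?F a t\<close> by (metis equivclp_trans equivclp_refl empty_iff insert_iff)
        qed
        then show ?thesis by (meson equivclp_trans equivclp_sym)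
      qed
      show "equivclp (add_pairs r {(a, c), (b, d), (a', c'), (b', d')}) x y" if "(x, y) \<in> {(a, d), (b, c), (a', d'), (b', c')}" for x y
        using that all[of "{(a, c), (b, d), (p, t), (q, s)}"] unfolding sets by auto
      show "?E x y" if "(x, y) \<in> {(a, c), (b, d), (a', c'), (b', d')}" for x y
        using that all[of "{(a, d), (b, c), (p, s), (q, t)}"] unfolding sets by auto
    qed
    \<comment> \<open>Both straight, both crossed, and the two mixed cases.\<close>
    consider "equivclp r a a'" "equivclp r b b'" "equivclp r c c'" "equivclp r d d'"
      | "equivclp r a b'" "equivclp r b a'" "equivclp r c d'" "equivclp r d c'"
      | "equivclp r a a'" "equivclp r b b'" "equivclp r c d'" "equivclp r d c'"
      | "equivclp r a b'" "equivclp r b a'" "equivclp r c c'" "equivclp r d d'"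
      using P' Q' by blast
    then show ?thesis
    proof cases
      case 1
      have "equivclp (add_pairs r {(a, d), (b, c), (a', d'), (b', c')}) = equivclp (add_pairs r {(a, d), (b, c)})"
        "equivclp (add_pairs r {(a, c), (b, d), (a', c'), (b', d')}) = equivclp (add_pairs r {(a, c), (b, d)})"
        using 1 by (auto intro: four_pairs_single)
      then show ?thesis using two by (simp add: class_count_def)
    next
      case 2
      have "equivclp (add_pairs r {(a, d), (b, c), (b', c'), (a', d')}) = equivclp (add_pairs r {(a, d), (b, c)})"
        "equivclp (add_pairs r {(a, c), (b, d), (b', d'), (a', c')}) = equivclp (add_pairs r {(a, c), (b, d)})"
        using 2 by (auto intro: four_pairs_single)
      moreover have "{(a, d), (b, c), (a', d'), (b', c')} = {(a, d), (b, c), (b', c'), (a', d')}"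
        "{(a, c), (b, d), (a', c'), (b', d')} = {(a, c), (b, d), (b', d'), (a', c')}" by auto
      ultimately show ?thesis using two by (simp add: class_count_def)
    next
      case 3
      then show ?thesis by (intro mixed[of a' b' d' c']) auto
    next
      case 4
      then show ?thesis by (intro mixed[of b' a' c' d']) auto
    qed
  qed
qed

text \<open>An order of the two unmatched ends at each vertex, not tied to any drawing, because a
  partial flip may not be realizable in the sphere. Edges suffice as entries since circles are
  classes of edges; at a loop both entries coincide.\<close>

definition rotation :: "('v, 'e) multigraph \<Rightarrow> 'e set \<Rightarrow> ('v \<Rightarrow> 'e \<times> 'e) \<Rightarrow> bool" where
  "rotation G M \<rho> \<longleftrightarrow> (\<forall>w\<in>verts G. fst (\<rho> w) \<in> edges G - M \<and> snd (\<rho> w) \<in> edges G - M \<and>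
     (\<forall>x\<in>edges G - M. count (ends G x) w = of_bool (x = fst (\<rho> w)) + of_bool (x = snd (\<rho> w))))"

definition band_arc :: "('v, 'e) multigraph \<Rightarrow> ('v \<Rightarrow> 'e \<times> 'e) \<Rightarrow> 'e set \<Rightarrow> 'e \<Rightarrow> 'e \<Rightarrow> 'e \<Rightarrow> bool" where
  "band_arc G \<rho> S e x y \<longleftrightarrow> (\<exists>u v. ends G e = {#u, v#} \<and>
     (if e \<in> S then x = fst (\<rho> u) \<and> y = fst (\<rho> v) \<or> x = snd (\<rho> u) \<and> y = snd (\<rho> v)
      else x = fst (\<rho> u) \<and> y = snd (\<rho> v) \<or> x = snd (\<rho> u) \<and> y = fst (\<rho> v)))"

definition state_arc :: "('v, 'e) multigraph \<Rightarrow> 'e set \<Rightarrow> ('v \<Rightarrow> 'e \<times> 'e) \<Rightarrow> 'e set \<Rightarrow> 'e \<Rightarrow> 'e \<Rightarrow> bool" where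
  "state_arc G M \<rho> S x y \<longleftrightarrow> (\<exists>e\<in>M. band_arc G \<rho> S e x y)"

text \<open>With the matching edge as starting point, reversing the cyclic order of three ends
  exchanges the other two.\<close>

definition flip :: "'v set \<Rightarrow> ('v \<Rightarrow> 'e \<times> 'e) \<Rightarrow> 'v \<Rightarrow> 'e \<times> 'e" where
  "flip P \<rho> = (\<lambda>w. if w \<in> P then prod.swap (\<rho> w) else \<rho> w)"

lemma band_arc_ends:
  assumes "ends G e = {#u, v#}"
  shows "band_arc G \<rho> S e x y \<longleftrightarrow>
     (if e \<in> S then (x, y) \<in> {(fst (\<rho> u), fst (\<rho> v)), (snd (\<rho> u), snd (\<rho> v)), (fst (\<rho> v), fst (\<rho> u)), (snd (\<rho> v), snd (\<rho> u))}
      else (x, y) \<in> {(fst (\<rho> u), snd (\<rho> v)), (snd (\<rho> u), fst (\<rho> v)), (snd (\<rho> v), fst (\<rho> u)), (fst (\<rho> v), snd (\<rho> u))})"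
proof -
  have "{#u, v#} = {#p, q#} \<longleftrightarrow> p = u \<and> q = v \<or> p = v \<and> q = u" for p q
    by (auto simp: add_eq_conv_ex)
  then show ?thesis unfolding band_arc_def assms by auto
qed

lemma sum_count_pair:
  fixes f :: "'a \<Rightarrow> nat"
  assumes "finite P"
  shows "(\<Sum>w\<in>P. count {#p, q#} w * f w) = of_bool (p \<in> P) * f p + of_bool (q \<in> P) * f q"
proof -
  have "count {#p, q#} w * f w = (if w = p then f w else 0) + (if w = q then f w else 0)" for w by auto
  then show ?thesis using assms by (simp add: sum.distrib)
qed

text \<open>Four ends of which every class contains an even number can be paired within classes; the
  alternatives are the three pairings.\<close>

lemma even_classes_pair_up:
  assumes "\<And>z. even (of_bool (equivclp r z a) + of_bool (equivclp r z b) + of_bool (equivclp r z a') + of_bool (equivclp r z b') :: nat)"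
  shows "equivclp r a b \<and> equivclp r a' b' \<or> equivclp r a a' \<and> equivclp r b b' \<or> equivclp r a b' \<and> equivclp r b a'"
proof -
  note tr = equivclp_trans[of r] and sy = equivclp_sym[of r]
  show ?thesis
  proof (cases "equivclp r a b")
    case True
    then have "equivclp r a' a \<longleftrightarrow> equivclp r a' b" using tr sy by blast
    then have "equivclp r a' b'" using assms[of a'] by (auto split: if_splits)
    then show ?thesis using True by simp
  next
    case False
    then have F': "\<not> equivclp r b a" using sy by blast
    have a: "equivclp r a a' \<noteq> equivclp r a b'" using assms[of a] False by (auto split: if_splits)
    have b: "equivclp r b a' \<noteq> equivclp r b b'" using assms[of b] F' by (auto split: if_splits)
    have "\<not> (equivclp r a a' \<and> equivclp r b a')" "\<not> (equivclp r a b' \<and> equivclp r b b')"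
      using False tr sy by blast+
    then show ?thesis using a b by blast
  qed
qed

locale matched_graph =
  fixes G :: "('v, 'e) multigraph" and M :: "'e set"
  assumes fin: "finite_multigraph G" and pm: "perfect_matching G M"
begin

lemma finite_E: "finite (edges G)" and finite_V: "finite (verts G)" and M_E: "M \<subseteq> edges G" and finite_M: "finite M"
  using fin pm finite_subset unfolding finite_multigraph_def perfect_matching_def by blast+

lemma M_ends: assumes "e \<in> M" obtains u v where "ends G e = {#u, v#}" "u \<noteq> v" "u \<in> verts G" "v \<in> verts G"
proof -
  obtain u v where uv: "ends G e = {#u, v#}" "u \<noteq> v" using pm assms unfolding perfect_matching_def by blast
  have "set_mset (ends G e) \<subseteq> verts G" using fin assms M_E unfolding finite_multigraph_def by blast
  then show thesis using uv that by simp
qed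

lemma edge_ends: 
  assumes "e \<in> edges G" obtains "ends G e = {#}" | p q where "ends G e = {#p, q#}" "p \<in> verts G" "q \<in> verts G"
proof -
  have "size (ends G e) = 2 \<or> ends G e = {#}" "set_mset (ends G e) \<subseteq> verts G"
    using fin assms unfolding finite_multigraph_def by blast+
  then show thesis using that size_2_mset[of "ends G e"] by (metis insert_subset set_mset_add_mset_insert)
qed

lemma sum_M_count: assumes "w \<in> verts G" shows "(\<Sum>e\<in>M. count (ends G e) w) = 1"
proof -
  have "\<exists>!e. e \<in> M \<and> w \<in># ends G e"
    using pm assms unfolding perfect_matching_def by (elim conjE) (erule bspec)
  then have "\<exists>e0. e0 \<in> M \<and> w \<in># ends G e0 \<and> (\<forall>e. e \<in> M \<and> w \<in># ends G e \<longrightarrow> e = e0)"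
    unfolding Ex1_def by simp
  then obtain e0 where e0: "e0 \<in> M" "w \<in># ends G e0" and "\<forall>e. e \<in> M \<and> w \<in># ends G e \<longrightarrow> e = e0"
    by (elim exE conjE)
  then have e0': "e = e0" if "e \<in> M" "w \<in># ends G e" for e using that by simp
  have "count (ends G e) w = (if e = e0 then 1 else 0)" if eM: "e \<in> M" for e
  proof (cases "e = e0")
    case True
    obtain u v where uv: "ends G e0 = {#u, v#}" "u \<noteq> v" "u \<in> verts G" "v \<in> verts G"
      by (rule M_ends[OF e0(1)])
    then have "w = u \<or> w = v" using e0(2) by auto
    then have "count (ends G e0) w = 1" unfolding uv(1) using uv(2) by (elim disjE) simp_all
    then show ?thesis using True by simp
  next
    case False
    then have "w \<notin># ends G e" using e0'[OF eM] by blast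
    then show ?thesis using False by (simp add: not_in_iff)
  qed
  then have "(\<Sum>e\<in>M. count (ends G e) w) = (\<Sum>e\<in>M. if e = e0 then 1 else 0)" by simp
  then show ?thesis using finite_M e0(1) by simp
qed

lemma cut_iff:
  assumes "ends G e = {#p, q#}" "e \<in> edges G" shows "e \<in> cut G P \<longleftrightarrow> (p \<in> P) \<noteq> (q \<in> P)"
  unfolding cut_def using assms by (auto simp: add_eq_conv_ex)

lemma cut_empty_ends: "ends G e = {#} \<Longrightarrow> e \<notin> cut G P"
  unfolding cut_def by auto

section \<open>Parity of edge ends behind a cut\<close>

lemma even_count_inside:
  assumes "e \<in> edges G" "P \<subseteq> verts G"
  shows "even (\<Sum>w\<in>P. count (ends G e) w) \<longleftrightarrow> e \<notin> cut G P"
proof -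
  have P: "finite P" using assms(2) finite_V finite_subset by blast
  from assms(1) show ?thesis
  proof (cases rule: edge_ends)
    case 1
    then show ?thesis by (simp add: cut_empty_ends)
  next
    case (2 p q)
    have "(\<Sum>w\<in>P. count (ends G e) w) = of_bool (p \<in> P) + of_bool (q \<in> P)"
      using sum_count_pair[OF P, of p q "\<lambda>_. 1"] 2 by simp
    then show ?thesis using cut_iff[OF 2(1) assms(1)] by auto
  qed
qed

lemma cut_complement: "cut G (verts G - P) = cut G P"
proof -
  have "e \<in> cut G (verts G - P) \<longleftrightarrow> e \<in> cut G P" if e: "e \<in> edges G" for e
    using e
  proof (cases rule: edge_ends)
    case (2 p q)
    then show ?thesis using cut_iff[OF 2(1) e] by auto
  qed (simp add: cut_empty_ends)
  then show ?thesis unfolding cut_def by blast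
qed

definition weight :: "('v \<Rightarrow> 'e \<times> 'e) \<Rightarrow> 'e set \<Rightarrow> 'v \<Rightarrow> nat" where
  "weight \<rho> K w = of_bool (fst (\<rho> w) \<in> K) + of_bool (snd (\<rho> w) \<in> K)"

lemma weight_count:
  assumes "rotation G M \<rho>" "K \<subseteq> edges G - M" "w \<in> verts G"
  shows "weight \<rho> K w = (\<Sum>x\<in>K. count (ends G x) w)"
proof -
  have K: "finite K" using assms(2) finite_E finite_subset by blast
  have "count (ends G x) w = of_bool (x = fst (\<rho> w)) + of_bool (x = snd (\<rho> w))" if "x \<in> K" for x
    using assms that unfolding rotation_def by blast
  then have "(\<Sum>x\<in>K. count (ends G x) w) = (\<Sum>x\<in>K. of_bool (x = fst (\<rho> w)) + of_bool (x = snd (\<rho> w)))" by simp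
  also have "\<dots> = weight \<rho> K w" unfolding weight_def sum.distrib using K by (simp add: of_bool_def sum.delta)
  finally show ?thesis by simp
qed

text \<open>The unmatched edges have degree 2 at every vertex, so the handshake count inside
  \<open>P\<close> is even, and only cut edges contribute odd terms.\<close>

lemma even_cut_unmatched:
  assumes \<rho>: "rotation G M \<rho>" and P: "P \<subseteq> verts G"
  shows "even (card (cut G P - M))"
proof -
  let ?N = "edges G - M"
  have "weight \<rho> ?N w = 2" if "w \<in> verts G" for w
    using \<rho> that unfolding rotation_def weight_def by auto
  then have "even (\<Sum>w\<in>P. weight \<rho> ?N w)" using P by (intro dvd_sum) auto
  also have "(\<Sum>w\<in>P. weight \<rho> ?N w) = (\<Sum>w\<in>P. \<Sum>x\<in>?N. count (ends G x) w)"
    using weight_count[OF \<rho> subset_refl] P by (intro sum.cong) auto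
  also have "\<dots> = (\<Sum>x\<in>?N. \<Sum>w\<in>P. count (ends G x) w)" by (rule sum.swap)
  also have "even \<dots> \<longleftrightarrow> even (card {x \<in> ?N. odd (\<Sum>w\<in>P. count (ends G x) w)})"
    using finite_E by (subst even_sum_iff) auto
  also have "{x \<in> ?N. odd (\<Sum>w\<in>P. count (ends G x) w)} = cut G P - M"
  proof -
    have "cut G P \<subseteq> edges G" unfolding cut_def by blast
    then show ?thesis using even_count_inside[OF _ P] by blast
  qed
  finally show ?thesis .
qed

text \<open>Arcs on both sides of the cut are included, so that one relation serves \<open>P\<close>
  and its complement alike.\<close>

definition inner_arc :: "('v \<Rightarrow> 'e \<times> 'e) \<Rightarrow> 'e set \<Rightarrow> 'v set \<Rightarrow> 'e \<Rightarrow> 'e \<Rightarrow> bool" where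
  "inner_arc \<rho> S P x y \<longleftrightarrow> (\<exists>e\<in>M - cut G P. band_arc G \<rho> S e x y)"

text \<open>
  Handshake argument: a union of classes of the inner arcs has an even number of ends in \<open>P\<close>,
  and the inner matching edges pair up those at inner vertices.
\<close>

lemma even_weight_cut:
  assumes \<rho>: "rotation G M \<rho>" and P: "P \<subseteq> verts G" and N: "cut G P \<subseteq> M"
    and K: "K \<subseteq> edges G - M" "\<And>x y. inner_arc \<rho> S P x y \<Longrightarrow> x \<in> K \<longleftrightarrow> y \<in> K"
  shows "even (\<Sum>e\<in>cut G P. \<Sum>w\<in>P. count (ends G e) w * weight \<rho> K w)"
proof -
  have fP: "finite P" using P finite_V finite_subset by blast
  let ?g = "\<lambda>e. \<Sum>w\<in>P. count (ends G e) w * weight \<rho> K w"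
  have "even (\<Sum>w\<in>P. count (ends G x) w)" if "x \<in> K" for x
    using even_count_inside[OF _ P, of x] that K(1) N by blast
  then have "even (\<Sum>x\<in>K. \<Sum>w\<in>P. count (ends G x) w)" by (rule dvd_sum)
  also have "(\<Sum>x\<in>K. \<Sum>w\<in>P. count (ends G x) w) = (\<Sum>w\<in>P. \<Sum>x\<in>K. count (ends G x) w)" by (rule sum.swap)
  also have "\<dots> = (\<Sum>w\<in>P. weight \<rho> K w)"
    using weight_count[OF \<rho> K(1)] P by (intro sum.cong) auto
  \<comment> \<open>Every vertex is on exactly one matching edge, so its weight can be charged to
    that edge.\<close>
  also have "\<dots> = (\<Sum>w\<in>P. \<Sum>e\<in>M. count (ends G e) w * weight \<rho> K w)"
  proof (rule sum.cong[OF refl])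
    fix w assume "w \<in> P"
    then have "w \<in> verts G" using P by blast
    then have "(\<Sum>e\<in>M. count (ends G e) w) * weight \<rho> K w = weight \<rho> K w" by (simp add: sum_M_count)
    then show "weight \<rho> K w = (\<Sum>e\<in>M. count (ends G e) w * weight \<rho> K w)"
      by (simp add: sum_distrib_right)
  qed
  also have "\<dots> = (\<Sum>e\<in>M. ?g e)" by (rule sum.swap)
  also have "\<dots> = (\<Sum>e\<in>M - cut G P. ?g e) + (\<Sum>e\<in>cut G P. ?g e)"
    by (rule sum.subset_diff[OF N finite_M])
  finally have "even ((\<Sum>e\<in>M - cut G P. ?g e) + (\<Sum>e\<in>cut G P. ?g e))" .
  \<comment> \<open>An uncut matching edge has both ends in \<open>P\<close> or none, and as its
    arcs respect \<open>K\<close>, its two ends have equal weight.\<close>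
  moreover have "even (\<Sum>e\<in>M - cut G P. ?g e)"
  proof (rule dvd_sum)
    fix e assume e: "e \<in> M - cut G P"
    then obtain u v where uv: "ends G e = {#u, v#}" using M_ends[of e] by blast
    have side: "u \<in> P \<longleftrightarrow> v \<in> P" using cut_iff[OF uv, of P] e M_E by blast
    have arc: "band_arc G \<rho> S e x y \<Longrightarrow> x \<in> K \<longleftrightarrow> y \<in> K" for x y
      using K(2) e unfolding inner_arc_def by blast
    have "weight \<rho> K u = weight \<rho> K v"
      unfolding weight_def
      using arc[of "fst (\<rho> u)" "fst (\<rho> v)"] arc[of "snd (\<rho> u)" "snd (\<rho> v)"]
        arc[of "fst (\<rho> u)" "snd (\<rho> v)"] arc[of "snd (\<rho> u)" "fst (\<rho> v)"]
      unfolding band_arc_ends[OF uv] by (cases "e \<in> S") auto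
    then show "even (?g e)" unfolding uv sum_count_pair[OF fP] using side by simp
  qed
  ultimately show ?thesis by simp
qed

text \<open>Exchanging the entries at both ends only permutes the two arcs, in either
  smoothing.\<close>

lemma band_arc_flip_inner:
  assumes "e \<in> M - cut G P"
  shows "band_arc G (flip P \<rho>) S e x y \<longleftrightarrow> band_arc G \<rho> S e x y"
proof -
  obtain u v where uv: "ends G e = {#u, v#}" using assms M_ends[of e] by blast
  have "u \<in> P \<longleftrightarrow> v \<in> P" using cut_iff[OF uv, of P] assms M_E by blast
  then show ?thesis unfolding band_arc_ends[OF uv] flip_def by (cases "u \<in> P") auto
qed

text \<open>When the whole cut is matched, every unmatched edge lies on one side and so does every
  uncut matching edge; no chain of arcs crosses.\<close>

lemma inner_arc_side:
  assumes \<rho>: "rotation G M \<rho>" and N: "cut G P \<subseteq> M" and "equivclp (inner_arc \<rho> S P) x y"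
  shows "(\<exists>w\<in>P. w \<in># ends G x) \<longleftrightarrow> (\<exists>w\<in>P. w \<in># ends G y)"
  using assms(3)
proof (induction rule: equivclp_induct)
  case (step y z)
  have at: "(\<exists>w\<in>P. w \<in># ends G x) \<longleftrightarrow> u \<in> P" if u: "u \<in> verts G" "x = fst (\<rho> u) \<or> x = snd (\<rho> u)" for x u
  proof -
    have x: "x \<in> edges G - M" "count (ends G x) u = of_bool (x = fst (\<rho> u)) + of_bool (x = snd (\<rho> u))"
      using \<rho> u unfolding rotation_def by auto
    then have "u \<in># ends G x" using u(2) by (auto simp flip: count_greater_zero_iff)
    have xE: "x \<in> edges G" "x \<notin> cut G P" using x N by blast+
    from xE(1) show ?thesis
    proof (cases rule: edge_ends)
      case (2 p q)
      then show ?thesis using \<open>u \<in># ends G x\<close> cut_iff[OF 2(1) xE(1), of P] xE(2) by auto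
    qed (use \<open>u \<in># ends G x\<close> in simp)
  qed
  have inv: "(\<exists>w\<in>P. w \<in># ends G y) \<longleftrightarrow> (\<exists>w\<in>P. w \<in># ends G z)" if yz: "inner_arc \<rho> S P y z" for y z
  proof -
    obtain e where e: "e \<in> M" "e \<notin> cut G P" "band_arc G \<rho> S e y z" using yz unfolding inner_arc_def by blast
    obtain u v where uv: "ends G e = {#u, v#}" "u \<in> verts G" "v \<in> verts G" using M_ends[OF e(1)] by blast
    have "u \<in> P \<longleftrightarrow> v \<in> P" using cut_iff[OF uv(1), of P] e M_E by blast
    moreover have "(y = fst (\<rho> u) \<or> y = snd (\<rho> u)) \<and> (z = fst (\<rho> v) \<or> z = snd (\<rho> v)) \<or>
        (y = fst (\<rho> v) \<or> y = snd (\<rho> v)) \<and> (z = fst (\<rho> u) \<or> z = snd (\<rho> u))"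
      using e(3) unfolding band_arc_ends[OF uv(1)] by (auto split: if_splits)
    ultimately show ?thesis using at uv by metis
  qed
  show ?case using step.hyps(2) inv step.IH by blast
qed simp

lemma class_parity:
  assumes \<rho>: "rotation G M \<rho>" and P: "P \<subseteq> verts G" and N: "cut G P \<subseteq> M"
  shows "even (\<Sum>e\<in>cut G P. \<Sum>w\<in>P. count (ends G e) w * weight \<rho> {y \<in> edges G - M. equivclp (inner_arc \<rho> S P) z y} w)"
proof (rule even_weight_cut[OF \<rho> P N])
  fix x y assume xy: "inner_arc \<rho> S P x y"
  obtain e where e: "e \<in> M" "e \<notin> cut G P" "band_arc G \<rho> S e x y" using xy unfolding inner_arc_def by blast
  obtain u v where uv: "ends G e = {#u, v#}" "u \<in> verts G" "v \<in> verts G" using M_ends[OF e(1)] by blast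
  have "fst (\<rho> u) \<in> edges G - M" "snd (\<rho> u) \<in> edges G - M" "fst (\<rho> v) \<in> edges G - M" "snd (\<rho> v) \<in> edges G - M"
    using \<rho> uv unfolding rotation_def by blast+
  then have "x \<in> edges G - M" "y \<in> edges G - M" using e(3) unfolding band_arc_ends[OF uv(1)] by (auto split: if_splits)
  moreover have "equivclp (inner_arc \<rho> S P) z x \<longleftrightarrow> equivclp (inner_arc \<rho> S P) z y"
    using equivclp_into_equivclp[of "inner_arc \<rho> S P" z] xy by blast
  ultimately show "x \<in> {y \<in> edges G - M. equivclp (inner_arc \<rho> S P) z y} \<longleftrightarrow> y \<in> {y \<in> edges G - M. equivclp (inner_arc \<rho> S P) z y}"
    by simp
qed blast

text \<open>Applied to a rotation and to its flip with the same inner arcs, so that only the arcs of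
  the cut edges remain to be compared. These are given up to the order of their ends.\<close>

lemma state_arc_split:
  assumes \<rho>: "\<And>e x y. e \<in> M - cut G P \<Longrightarrow> band_arc G \<rho>' S e x y \<longleftrightarrow> band_arc G \<rho> S e x y"
    and A: "\<And>x y. (\<exists>e\<in>M \<inter> cut G P. band_arc G \<rho>' S e x y) \<longleftrightarrow> (x, y) \<in> A \<or> (y, x) \<in> A"
  shows "equivclp (state_arc G M \<rho>' S) = equivclp (add_pairs (inner_arc \<rho> S P) A)"
proof -
  have *: "state_arc G M \<rho>' S x y \<longleftrightarrow> inner_arc \<rho> S P x y \<or> (x, y) \<in> A \<or> (y, x) \<in> A" for x y
    unfolding state_arc_def inner_arc_def using \<rho> A by blast
  show ?thesis
  proof (rule equivclp_eqI)
    show "equivclp (add_pairs (inner_arc \<rho> S P) A) x y" if "state_arc G M \<rho>' S x y" for x y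
      using that unfolding * by (auto simp: add_pairs_def intro: r_into_equivclp converse_r_into_equivclp)
    show "equivclp (state_arc G M \<rho>' S) x y" if "add_pairs (inner_arc \<rho> S P) A x y" for x y
      using that unfolding add_pairs_def by (intro r_into_equivclp) (unfold *, blast)
  qed
qed

text \<open>Flipping one end of a matching edge exchanges its two smoothings.\<close>

lemma cut_band:
  assumes \<rho>: "rotation G M \<rho>" and e: "e \<in> M" "e \<in> cut G P"
  obtains u v a b c d where "ends G e = {#u, v#}" "u \<in> P" "v \<notin> P" "u \<in> verts G" "v \<in> verts G"
    "a = fst (\<rho> u)" "b = snd (\<rho> u)" "(c, d) = \<rho> v \<or> (d, c) = \<rho> v"
    "\<And>x y. band_arc G \<rho> S e x y \<longleftrightarrow> (x, y) \<in> {(a, d), (b, c)} \<or> (y, x) \<in> {(a, d), (b, c)}"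
    "\<And>x y. band_arc G (flip P \<rho>) S e x y \<longleftrightarrow> (x, y) \<in> {(a, c), (b, d)} \<or> (y, x) \<in> {(a, c), (b, d)}"
proof -
  obtain p q where pq: "ends G e = {#p, q#}" "p \<in> verts G" "q \<in> verts G" using M_ends[OF e(1)] by blast
  have "(p \<in> P) \<noteq> (q \<in> P)" using cut_iff[OF pq(1), of P] e M_E by blast
  then obtain u v where uv: "ends G e = {#u, v#}" "u \<in> P" "v \<notin> P" "u \<in> verts G" "v \<in> verts G"
    using pq by (metis add_mset_commute)
  \<comment> \<open>Naming the far ends according to the smoothing gives one description for both
    cases: before the flip \<open>a\<close> goes to \<open>d\<close>, afterwards to
    \<open>c\<close>.\<close>
  define c d where "c = (if e \<in> S then snd (\<rho> v) else fst (\<rho> v))" and "d = (if e \<in> S then fst (\<rho> v) else snd (\<rho> v))"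
  show thesis
  proof (rule that[OF uv refl refl])
    show "(c, d) = \<rho> v \<or> (d, c) = \<rho> v" unfolding c_def d_def by simp
    show "band_arc G \<rho> S e x y \<longleftrightarrow> (x, y) \<in> {(fst (\<rho> u), d), (snd (\<rho> u), c)} \<or> (y, x) \<in> {(fst (\<rho> u), d), (snd (\<rho> u), c)}" for x y
      unfolding band_arc_ends[OF uv(1)] c_def d_def by auto
    show "band_arc G (flip P \<rho>) S e x y \<longleftrightarrow> (x, y) \<in> {(fst (\<rho> u), c), (snd (\<rho> u), d)} \<or> (y, x) \<in> {(fst (\<rho> u), c), (snd (\<rho> u), d)}" for x y
      unfolding band_arc_ends[OF uv(1)] c_def d_def flip_def using uv(2,3) by auto
  qed
qed

lemma class_count_flip_small_cut:
  assumes \<rho>: "rotation G M \<rho>" and P: "P \<subseteq> verts G" and cut: "card (cut G P) \<le> 2"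
  shows "class_count (edges G - M) (state_arc G M (flip P \<rho>) S) = class_count (edges G - M) (state_arc G M \<rho> S)"
proof (cases "cut G P \<inter> M = {}")
  case True
  then have "band_arc G (flip P \<rho>) S e x y \<longleftrightarrow> band_arc G \<rho> S e x y" if "e \<in> M" for e x y
    using that by (intro band_arc_flip_inner) blast
  then have "state_arc G M (flip P \<rho>) S = state_arc G M \<rho> S" unfolding state_arc_def by (intro ext) blast
  then show ?thesis by simp
next
  case False
  have fC: "finite (cut G P)" unfolding cut_def using finite_E by simp
  \<comment> \<open>One matched cut edge leaves room for at most one unmatched one, and the number
    of unmatched ones is even.\<close>
  have N: "cut G P \<subseteq> M"
  proof -
    have "card (cut G P - M) \<noteq> 2"
    proof
      assume "card (cut G P - M) = 2"
      moreover have "card (cut G P - M) < card (cut G P)"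
        using False fC by (intro psubset_card_mono) auto
      ultimately show False using cut by simp
    qed
    moreover have "card (cut G P - M) \<le> 2" using card_mono[OF fC, of "cut G P - M"] cut by auto
    ultimately have "card (cut G P - M) = 0 \<or> card (cut G P - M) = 1" by linarith
    then have "card (cut G P - M) = 0" using even_cut_unmatched[OF \<rho> P] by auto
    then show ?thesis using fC by auto
  qed
  let ?r = "inner_arc \<rho> S P"
  let ?K = "\<lambda>z. {y \<in> edges G - M. equivclp ?r z y}"
  \<comment> \<open>The complement has the same cut and the same inner arcs, so parity applies on
    the far side too.\<close>
  define Q where "Q = verts G - P"
  have Q: "Q \<subseteq> verts G" "cut G Q = cut G P" unfolding Q_def by (auto simp: cut_complement)
  have rQ: "inner_arc \<rho> S Q = ?r" unfolding inner_arc_def Q(2) ..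
  have parP: "even (\<Sum>e\<in>cut G P. \<Sum>w\<in>P. count (ends G e) w * weight \<rho> (?K z) w)" for z
    by (rule class_parity[OF \<rho> P N])
  have parQ: "even (\<Sum>e\<in>cut G P. \<Sum>w\<in>Q. count (ends G e) w * weight \<rho> (?K z) w)" for z
    using class_parity[OF \<rho> Q(1), of S z] N unfolding Q(2) rQ by blast
  have fPQ: "finite P" "finite Q" using P Q(1) finite_V finite_subset by blast+
  have side: "\<not> equivclp ?r x y" if "u \<in> verts G" "u \<in> P" "v \<in> verts G" "v \<notin> P"
    "x = fst (\<rho> u) \<or> x = snd (\<rho> u)" "y = fst (\<rho> v) \<or> y = snd (\<rho> v)" for x y u v
  proof -
    have in_ends: "x \<in> edges G - M \<and> u \<in># ends G x" if "u \<in> verts G" "x = fst (\<rho> u) \<or> x = snd (\<rho> u)" for x u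
    proof -
      have "x \<in> edges G - M" "count (ends G x) u = of_bool (x = fst (\<rho> u)) + of_bool (x = snd (\<rho> u))"
        using \<rho> that unfolding rotation_def by auto
      then show ?thesis using that(2) by (auto simp flip: count_greater_zero_iff)
    qed
    have x: "u \<in># ends G x" and y: "y \<in> edges G - M" "v \<in># ends G y" using in_ends that by blast+
    have yE: "y \<in> edges G" "y \<notin> cut G P" using y N by blast+
    from yE(1) have "\<not> (\<exists>w\<in>P. w \<in># ends G y)"
    proof (cases rule: edge_ends)
      case (2 p q)
      then show ?thesis using y(2) cut_iff[OF 2(1) yE(1), of P] yE(2) \<open>v \<notin> P\<close> by auto
    qed (use y in simp)
    then show ?thesis using inner_arc_side[OF \<rho> N, of S x y] x \<open>u \<in> P\<close> by blast
  qed
  have "card (cut G P) \<noteq> 0" using False fC by auto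
  then have "card (cut G P) = 1 \<or> card (cut G P) = 2" using cut by linarith
  then show ?thesis
  proof
    \<comment> \<open>The two strands of the only cut edge are the only ends leaving
      \<open>P\<close>, so by parity they belong to one class.\<close>
    assume "card (cut G P) = 1"
    then obtain e where e: "cut G P = {e}" using card_1_singletonE by blast
    have eM: "e \<in> M" "e \<in> cut G P" using e N by auto
    obtain u v a b c d where uv: "ends G e = {#u, v#}" "u \<in> P" "v \<notin> P" "u \<in> verts G" "v \<in> verts G"
      and ab: "a = fst (\<rho> u)" "b = snd (\<rho> u)"
      and arcs: "\<And>x y. band_arc G \<rho> S e x y \<longleftrightarrow> (x, y) \<in> {(a, d), (b, c)} \<or> (y, x) \<in> {(a, d), (b, c)}"
        "\<And>x y. band_arc G (flip P \<rho>) S e x y \<longleftrightarrow> (x, y) \<in> {(a, c), (b, d)} \<or> (y, x) \<in> {(a, c), (b, d)}"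
      using cut_band[OF \<rho> eM, of S] by metis
    have abN: "a \<in> edges G - M" "b \<in> edges G - M" using \<rho> uv(4) unfolding rotation_def ab by blast+
    have "(\<Sum>w\<in>P. count (ends G e) w * f w) = f u" for f
      unfolding uv(1) sum_count_pair[OF fPQ(1)] using uv by simp
    then have "even (weight \<rho> (?K a) u)" using parP[of a] unfolding e by simp
    then have "equivclp ?r a b" unfolding weight_def ab[symmetric] using abN by (simp split: if_splits)
    then have "equivclp (add_pairs ?r {(a, d), (b, c)}) = equivclp (add_pairs ?r {(a, c), (b, d)})"
      by (intro swap_pair_equiv) simp
    moreover have "equivclp (state_arc G M \<rho> S) = equivclp (add_pairs ?r {(a, d), (b, c)})"
      by (rule state_arc_split) (use e eM arcs in auto)
    moreover have "equivclp (state_arc G M (flip P \<rho>) S) = equivclp (add_pairs ?r {(a, c), (b, d)})"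
      by (rule state_arc_split) (use e eM arcs band_arc_flip_inner in auto)
    ultimately show ?thesis by (intro class_count_cong) simp
  next
    \<comment> \<open>Parity pairs up the four ends on each side, which is the situation of the two
      bands.\<close>
    assume "card (cut G P) = 2"
    then obtain e e' where e: "cut G P = {e, e'}" "e \<noteq> e'" using card_2_iff by metis
    have eM: "e \<in> M" "e \<in> cut G P" "e' \<in> M" "e' \<in> cut G P" using e N by auto
    obtain u v a b c d where uv: "ends G e = {#u, v#}" "u \<in> P" "v \<notin> P" "u \<in> verts G" "v \<in> verts G"
      and ab: "a = fst (\<rho> u)" "b = snd (\<rho> u)" and cd: "(c, d) = \<rho> v \<or> (d, c) = \<rho> v"
      and arcs: "\<And>x y. band_arc G \<rho> S e x y \<longleftrightarrow> (x, y) \<in> {(a, d), (b, c)} \<or> (y, x) \<in> {(a, d), (b, c)}"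
        "\<And>x y. band_arc G (flip P \<rho>) S e x y \<longleftrightarrow> (x, y) \<in> {(a, c), (b, d)} \<or> (y, x) \<in> {(a, c), (b, d)}"
      by (rule cut_band[OF \<rho> eM(1,2), of S]) (rule that)
    obtain u' v' a' b' c' d' where uv': "ends G e' = {#u', v'#}" "u' \<in> P" "v' \<notin> P" "u' \<in> verts G" "v' \<in> verts G"
      and ab': "a' = fst (\<rho> u')" "b' = snd (\<rho> u')" and cd': "(c', d') = \<rho> v' \<or> (d', c') = \<rho> v'"
      and arcs': "\<And>x y. band_arc G \<rho> S e' x y \<longleftrightarrow> (x, y) \<in> {(a', d'), (b', c')} \<or> (y, x) \<in> {(a', d'), (b', c')}"
        "\<And>x y. band_arc G (flip P \<rho>) S e' x y \<longleftrightarrow> (x, y) \<in> {(a', c'), (b', d')} \<or> (y, x) \<in> {(a', c'), (b', d')}"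
      by (rule cut_band[OF \<rho> eM(3,4), of S]) (rule that)
    have inN: "fst (\<rho> w) \<in> edges G - M" "snd (\<rho> w) \<in> edges G - M" if "w \<in> verts G" for w
      using \<rho> that unfolding rotation_def by blast+
    have cdw: "{c, d} = {fst (\<rho> v), snd (\<rho> v)}" "{c', d'} = {fst (\<rho> v'), snd (\<rho> v')}"
      using cd cd' by (metis fst_conv snd_conv insert_commute)+
    have abN: "a \<in> edges G - M" "b \<in> edges G - M" "a' \<in> edges G - M" "b' \<in> edges G - M"
      using inN[OF uv(4)] inN[OF uv'(4)] unfolding ab ab' by simp_all
    have cdN: "c \<in> edges G - M" "d \<in> edges G - M" "c' \<in> edges G - M" "d' \<in> edges G - M"
      using inN[OF uv(5)] inN[OF uv'(5)] cd cd' by (metis fst_conv snd_conv)+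
    have wK: "weight \<rho> (?K z) w = of_bool (equivclp ?r z x) + of_bool (equivclp ?r z y)"
      if "(x, y) = \<rho> w \<or> (y, x) = \<rho> w" "x \<in> edges G - M" "y \<in> edges G - M" for x y z w
    proof -
      have "x = fst (\<rho> w) \<and> y = snd (\<rho> w) \<or> y = fst (\<rho> w) \<and> x = snd (\<rho> w)"
        using that(1) by (metis fst_conv snd_conv)
      moreover have "of_bool (x \<in> ?K z) = (of_bool (equivclp ?r z x) :: nat)"
        "of_bool (y \<in> ?K z) = (of_bool (equivclp ?r z y) :: nat)" using that(2,3) by simp_all
      ultimately show ?thesis unfolding weight_def by auto
    qed
    have "(\<Sum>w\<in>P. count (ends G e) w * f w) = f u" "(\<Sum>w\<in>P. count (ends G e') w * f w) = f u'" for f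
      unfolding uv(1) uv'(1) sum_count_pair[OF fPQ(1)] using uv uv' by simp_all
    then have evenP: "even (weight \<rho> (?K z) u + weight \<rho> (?K z) u')" for z
      using parP[of z] e(2) unfolding e(1) by simp
    have parab: "even (of_bool (equivclp ?r z a) + of_bool (equivclp ?r z b) + of_bool (equivclp ?r z a') + of_bool (equivclp ?r z b') :: nat)" for z
    proof -
      have "weight \<rho> (?K z) u = of_bool (equivclp ?r z a) + of_bool (equivclp ?r z b)"
        "weight \<rho> (?K z) u' = of_bool (equivclp ?r z a') + of_bool (equivclp ?r z b')"
        by (rule wK, simp add: ab ab', rule abN, rule abN)+
      then show ?thesis using evenP[of z] by (simp only: add.assoc)
    qed
    have "v \<in> Q" "u \<notin> Q" "v' \<in> Q" "u' \<notin> Q" using uv uv' unfolding Q_def by auto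
    then have "(\<Sum>w\<in>Q. count (ends G e) w * f w) = f v" "(\<Sum>w\<in>Q. count (ends G e') w * f w) = f v'" for f
      unfolding uv(1) uv'(1) sum_count_pair[OF fPQ(2)] by simp_all
    then have evenQ: "even (weight \<rho> (?K z) v + weight \<rho> (?K z) v')" for z
      using parQ[of z] e(2) unfolding e(1) by simp
    have parcd: "even (of_bool (equivclp ?r z c) + of_bool (equivclp ?r z d) + of_bool (equivclp ?r z c') + of_bool (equivclp ?r z d') :: nat)" for z
      using evenQ[of z] unfolding wK[OF cd cdN(1,2), of z] wK[OF cd' cdN(3,4), of z] by (simp only: add.assoc)
    have ne: "\<not> equivclp ?r x y" if "x = a \<or> x = b" "y = c \<or> y = d" for x y
    proof (rule side[OF uv(4,2,5,3)])
      show "x = fst (\<rho> u) \<or> x = snd (\<rho> u)" using that(1) ab by simp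
      show "y = fst (\<rho> v) \<or> y = snd (\<rho> v)" using that(2) cdw(1) by blast
    qed
    have "class_count (edges G - M) (add_pairs ?r {(a, d), (b, c), (a', d'), (b', c')}) =
       class_count (edges G - M) (add_pairs ?r {(a, c), (b, d), (a', c'), (b', d')})"
      by (rule class_count_swap_two_bands[OF _ abN(1,2) cdN(1,2) even_classes_pair_up[OF parab] even_classes_pair_up[OF parcd]])
        (use finite_E ne in auto)
    moreover have "equivclp (state_arc G M \<rho> S) = equivclp (add_pairs ?r {(a, d), (b, c), (a', d'), (b', c')})"
    proof (rule state_arc_split)
      show "(\<exists>f\<in>M \<inter> cut G P. band_arc G \<rho> S f x y) \<longleftrightarrow> (x, y) \<in> {(a, d), (b, c), (a', d'), (b', c')} \<or> (y, x) \<in> {(a, d), (b, c), (a', d'), (b', c')}" for x y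
        using eM arcs(1)[of x y] arcs'(1)[of x y] unfolding e(1) by auto
    qed simp
    moreover have "equivclp (state_arc G M (flip P \<rho>) S) = equivclp (add_pairs ?r {(a, c), (b, d), (a', c'), (b', d')})"
    proof (rule state_arc_split)
      show "(\<exists>f\<in>M \<inter> cut G P. band_arc G (flip P \<rho>) S f x y) \<longleftrightarrow> (x, y) \<in> {(a, c), (b, d), (a', c'), (b', d')} \<or> (y, x) \<in> {(a, c), (b, d), (a', c'), (b', d')}" for x y
        using eM arcs(2)[of x y] arcs'(2)[of x y] unfolding e(1) by auto
    qed (rule band_arc_flip_inner)
    ultimately show ?thesis by (simp add: class_count_def)
  qed
qed

end

section \<open>Sets generated by small cuts\<close>

context matched_graph
begin

text \<open>Holds edge by edge, by the positions of the two ends relative to \<open>A\<close> and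
  \<open>B\<close>.\<close>

lemma cut_submodular:
  "card (cut G (A \<inter> B)) + card (cut G (A \<union> B)) \<le> card (cut G A) + card (cut G B)"
proof -
  have card_sum: "card (cut G P) = (\<Sum>e\<in>edges G. of_bool (e \<in> cut G P))" for P
  proof -
    have "cut G P = {e \<in> edges G. e \<in> cut G P}" unfolding cut_def by blast
    then have "card (cut G P) = card {e \<in> edges G. e \<in> cut G P}" by (rule arg_cong)
    also have "\<dots> = (\<Sum>e\<in>edges G. of_bool (e \<in> cut G P))"
      using finite_E by (simp add: of_bool_def sum.If_cases Int_def)
    finally show ?thesis .
  qed
  have "of_bool (e \<in> cut G (A \<inter> B)) + of_bool (e \<in> cut G (A \<union> B)) \<le> (of_bool (e \<in> cut G A) + of_bool (e \<in> cut G B) :: nat)"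
    if e: "e \<in> edges G" for e
    using e
  proof (cases rule: edge_ends)
    case (2 p q)
    then show ?thesis unfolding cut_iff[OF 2(1) e] by (auto simp: of_bool_def)
  qed (simp add: cut_empty_ends)
  then show ?thesis unfolding card_sum sum.distrib[symmetric] by (rule sum_mono)
qed

text \<open>The span of the small-cut sets over the field with two elements. Symmetric differences
  generate it because successive flips cancel on common vertices.\<close>

inductive_set cut_span :: "'v set set" where
  empty: "{} \<in> cut_span"
| step: "\<lbrakk>P \<in> cut_span; Q \<subseteq> verts G; card (cut G Q) \<le> 2\<rbrakk> \<Longrightarrow> (P - Q) \<union> (Q - P) \<in> cut_span"

lemma cut_span_subset: "P \<in> cut_span \<Longrightarrow> P \<subseteq> verts G"
  by (induction rule: cut_span.induct) auto

lemma cut_span_base: "Q \<subseteq> verts G \<Longrightarrow> card (cut G Q) \<le> 2 \<Longrightarrow> Q \<in> cut_span"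
  using cut_span.step[OF cut_span.empty, of Q] by simp

lemma cut_span_sym_diff:
  assumes "P \<in> cut_span" "Q \<in> cut_span" shows "(P - Q) \<union> (Q - P) \<in> cut_span"
  using assms(2)
proof induction
  case empty
  show ?case using assms(1) by simp
next
  case (step Q R)
  have "(P - (Q - R \<union> (R - Q))) \<union> ((Q - R \<union> (R - Q)) - P) =
      (((P - Q) \<union> (Q - P)) - R) \<union> (R - ((P - Q) \<union> (Q - P)))" by blast
  then show ?case using cut_span.step[OF step.IH step.hyps(2,3)] by simp
qed

text \<open>
  Modulo 2, the indicator functions of \<open>P\<close>, \<open>Q\<close>, \<open>P \<inter> Q\<close>, \<open>P \<union> Q\<close> add up to zero, and by
  submodularity one of the last two sets has a small cut as well.
\<close>

lemma cut_span_Int_base: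
  assumes "P \<subseteq> verts G" "card (cut G P) \<le> 2" "Q \<subseteq> verts G" "card (cut G Q) \<le> 2"
  shows "P \<inter> Q \<in> cut_span"
proof (cases "card (cut G (P \<inter> Q)) \<le> 2")
  case True
  then show ?thesis using assms(1) by (intro cut_span_base) auto
next
  case False
  then have "card (cut G (P \<union> Q)) \<le> 2" using cut_submodular[of P Q] assms by simp
  then have "P \<union> Q \<in> cut_span" using assms by (intro cut_span_base) auto
  moreover have "(P - Q) \<union> (Q - P) \<in> cut_span" using assms cut_span_sym_diff cut_span_base by blast
  moreover have "P \<inter> Q = ((P \<union> Q) - ((P - Q) \<union> (Q - P))) \<union> (((P - Q) \<union> (Q - P)) - (P \<union> Q))" by blast
  ultimately show ?thesis using cut_span_sym_diff by metis
qed

text \<open>Intersection distributes over symmetric difference, so closure on generators extends to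
  the span; with \<open>verts G\<close> in it, the span is a Boolean algebra of vertex sets.\<close>

lemma cut_span_Int:
  assumes "P \<in> cut_span" "Q \<in> cut_span" shows "P \<inter> Q \<in> cut_span"
proof -
  have base: "P \<inter> R \<in> cut_span" if P: "P \<in> cut_span" and R: "R \<subseteq> verts G" "card (cut G R) \<le> 2" for P R
    using P
  proof induction
    case empty
    show ?case by (simp add: cut_span.empty)
  next
    case (step P Q)
    have "(P - Q \<union> (Q - P)) \<inter> R = (P \<inter> R - Q \<inter> R) \<union> (Q \<inter> R - P \<inter> R)" by blast
    then show ?case using cut_span_sym_diff[OF step.IH cut_span_Int_base[OF step.hyps(2,3) R]] by simp
  qed
  show ?thesis using assms(2)
  proof induction
    case empty
    show ?case by (simp add: cut_span.empty)
  next
    case (step Q R)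
    have "P \<inter> (Q - R \<union> (R - Q)) = (P \<inter> Q - P \<inter> R) \<union> (P \<inter> R - P \<inter> Q)" by blast
    then show ?case using cut_span_sym_diff[OF step.IH base[OF assms(1) step.hyps(2,3)]] by simp
  qed
qed

lemma cut_span_verts: "verts G \<in> cut_span"
proof -
  have "cut G (verts G) = {}" using cut_complement[of "{}"] unfolding cut_def by auto
  then show ?thesis by (intro cut_span_base) auto
qed

lemma cut_span_Un:
  assumes "P \<in> cut_span" "Q \<in> cut_span" shows "P \<union> Q \<in> cut_span"
proof -
  have "P \<union> Q = (((P - Q) \<union> (Q - P)) - P \<inter> Q) \<union> (P \<inter> Q - ((P - Q) \<union> (Q - P)))" by blast
  then show ?thesis using cut_span_sym_diff[OF cut_span_sym_diff[OF assms] cut_span_Int[OF assms]] by simp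
qed

text \<open>A finite Boolean algebra contains every set whose points it separates from the points
  outside: intersect over all outside points, then take the union over all inside points.\<close>

lemma cut_span_separated:
  assumes W: "W \<subseteq> verts G" and sep: "\<And>u v. u \<in> W \<Longrightarrow> v \<in> verts G - W \<Longrightarrow> \<exists>P\<in>cut_span. u \<in> P \<and> v \<notin> P"
  shows "W \<in> cut_span"
proof -
  have pt: "\<exists>P\<in>cut_span. u \<in> P \<and> P \<subseteq> W" if u: "u \<in> W" for u
  proof -
    have "\<exists>P\<in>cut_span. u \<in> P \<and> P \<inter> F = {}" if "finite F" "F \<subseteq> verts G - W" for F
      using that
    proof induction
      case empty
      show ?case using cut_span_verts u W by blast
    next
      case (insert v F)
      have "F \<subseteq> verts G - W" "v \<in> verts G - W" using insert.prems by simp_all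
      from insert.IH[OF this(1)] obtain P where P: "P \<in> cut_span" "u \<in> P" "P \<inter> F = {}" by (elim bexE conjE)
      obtain P' where P': "P' \<in> cut_span" "u \<in> P'" "v \<notin> P'"
        using sep[OF u \<open>v \<in> verts G - W\<close>] by (elim bexE conjE)
      have "P \<inter> P' \<in> cut_span" by (rule cut_span_Int[OF P(1) P'(1)])
      moreover have "u \<in> P \<inter> P' \<and> P \<inter> P' \<inter> insert v F = {}" using P(2,3) P'(2,3) by auto
      ultimately show ?case by (rule bexI[rotated])
    qed
    from this[OF finite_Diff[OF finite_V] subset_refl]
    obtain P where P: "P \<in> cut_span" "u \<in> P" "P \<inter> (verts G - W) = {}" by (elim bexE conjE)
    then have "u \<in> P \<and> P \<subseteq> W" using cut_span_subset[OF P(1)] by auto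
    then show ?thesis using P(1) by (rule bexI)
  qed
  have "\<exists>P\<in>cut_span. F \<subseteq> P \<and> P \<subseteq> W" if "finite F" "F \<subseteq> W" for F
    using that
  proof induction
    case empty
    show ?case using cut_span.empty by blast
  next
    case (insert u F)
    then obtain P where P: "P \<in> cut_span" "F \<subseteq> P" "P \<subseteq> W" by auto
    have "u \<in> W" using insert.prems by simp
    from pt[OF this] obtain P' where P': "P' \<in> cut_span" "u \<in> P'" "P' \<subseteq> W" by (elim bexE conjE)
    have "P \<union> P' \<in> cut_span" by (rule cut_span_Un[OF P(1) P'(1)])
    moreover have "insert u F \<subseteq> P \<union> P' \<and> P \<union> P' \<subseteq> W" using P(2,3) P'(2,3) by auto
    ultimately show ?case by (rule bexI[rotated])
  qed
  from this[OF finite_subset[OF W finite_V] subset_refl]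
  obtain P where P: "P \<in> cut_span" "W \<subseteq> P" "P \<subseteq> W" by (elim bexE conjE)
  have "P = W" using P(2,3) by (rule subset_antisym[rotated])
  then show ?thesis using P(1) by simp
qed

lemma rotation_flip: "rotation G M \<rho> \<Longrightarrow> rotation G M (flip P \<rho>)"
  unfolding rotation_def flip_def by (auto simp: add.commute)

text \<open>Flipping a symmetric difference is flipping one set after the other. The rotation is
  kept general because each step starts from one already flipped.\<close>

lemma class_count_flip:
  assumes "P \<in> cut_span" "rotation G M \<rho>"
  shows "class_count (edges G - M) (state_arc G M (flip P \<rho>) S) = class_count (edges G - M) (state_arc G M \<rho> S)"
  using assms
proof (induction arbitrary: \<rho>)
  case empty
  have "flip {} \<rho> = \<rho>" unfolding flip_def by simp
  then show ?case by simp
next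
  case (step P Q)
  have "flip ((P - Q) \<union> (Q - P)) \<rho> = flip Q (flip P \<rho>)" unfolding flip_def by (rule ext) auto
  then show ?case
    using class_count_flip_small_cut[OF rotation_flip[OF step.prems] step.hyps(2,3), where S = S] step.IH[OF step.prems]
    by simp
qed

end

section \<open>Comparing two drawings\<close>

text \<open>The direction in which an edge is parametrized may differ between drawings, so
  half-edges cannot be compared directly while edges can. With three distinct edges at the vertex
  nothing is lost.\<close>

definition cyclic_order :: "('v, 'e) multigraph \<Rightarrow> ('v, 'e) drawing \<Rightarrow> 'v \<Rightarrow> 'e \<Rightarrow> 'e \<Rightarrow> 'e \<Rightarrow> bool" where
  "cyclic_order G \<Gamma> w a b c \<longleftrightarrow> (\<exists>i j k. ccw G \<Gamma> w (a, i) (b, j) (c, k))"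

lemma ccw_rotate: "ccw G \<Gamma> w h1 h2 h3 \<Longrightarrow> ccw G \<Gamma> w h2 h3 h1"
  unfolding ccw_turns using turns_rotate[of \<Gamma> w h1 h2 h3] by auto

lemma cyclic_order_rotate: "cyclic_order G \<Gamma> w a b c \<Longrightarrow> cyclic_order G \<Gamma> w b c a"
  unfolding cyclic_order_def by (elim exE, drule ccw_rotate) (intro exI)

lemma cyclic_order_asym:
  assumes "cyclic_order G \<Gamma> w a b c" "distinct [a, b, c]" shows "\<not> cyclic_order G \<Gamma> w a c b"
proof
  assume "cyclic_order G \<Gamma> w a c b"
  then obtain i' j' k' where 2: "ccw G \<Gamma> w (a, i') (c, k') (b, j')" unfolding cyclic_order_def by blast
  obtain i j k where 1: "ccw G \<Gamma> w (a, i) (b, j) (c, k)" using assms(1) unfolding cyclic_order_def by blast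
  have "{(a, i), (b, j), (c, k)} = {(a, i'), (c, k'), (b, j')}" using 1 2 unfolding ccw_turns by simp
  then have "i = i'" "j = j'" "k = k'" using assms(2) by auto
  then have t: "turns \<Gamma> w (a, i) (b, j) (c, k)" "turns \<Gamma> w (a, i) (c, k) (b, j)"
    using 1 2 unfolding ccw_turns by simp_all
  show False using turns_asym[OF t(1)] t(2) by (rule notE)
qed

section \<open>The rotation read off from a drawing\<close>

locale plane_matched_graph = matched_graph G M for G :: "('v, 'e) multigraph" and M :: "'e set" +
  fixes \<Gamma> :: "('v, 'e) drawing"
  assumes pg: "plane_graph G \<Gamma>" and tri: "trivalent G"
begin

lemma count_half_edges:
  assumes "e \<in> edges G" "w \<in> verts G"
  shows "count (ends G e) w = of_bool ((e, False) \<in> half_edges_at G \<Gamma> w) + of_bool ((e, True) \<in> half_edges_at G \<Gamma> w)"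
proof -
  have at: "(e, b) \<in> half_edges_at G \<Gamma> w \<longleftrightarrow>
      (if b then pathfinish (edge_curve \<Gamma> e) else pathstart (edge_curve \<Gamma> e)) = vertex_point \<Gamma> w" for b
    unfolding half_edges_at_def half_edge_curve_def using assms(1) by simp
  from assms(1) show ?thesis
  proof (cases rule: edge_ends)
    case 1
    have "path_image (edge_curve \<Gamma> e) \<inter> vertex_point \<Gamma> ` verts G = {}"
      using plane_graph_edge(3)[OF pg assms(1)] 1 by simp
    then have "vertex_point \<Gamma> w \<notin> path_image (edge_curve \<Gamma> e)" using assms(2) by blast
    then have "pathstart (edge_curve \<Gamma> e) \<noteq> vertex_point \<Gamma> w" "pathfinish (edge_curve \<Gamma> e) \<noteq> vertex_point \<Gamma> w"
      using pathstart_in_path_image[of "edge_curve \<Gamma> e"] pathfinish_in_path_image[of "edge_curve \<Gamma> e"] by auto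
    then show ?thesis using 1 at by simp
  next
    case (2 p q)
    have "p = w \<longleftrightarrow> vertex_point \<Gamma> p = vertex_point \<Gamma> w" "q = w \<longleftrightarrow> vertex_point \<Gamma> q = vertex_point \<Gamma> w"
      using plane_graph_inj[OF pg] 2 assms(2) by (auto dest: inj_onD)
    moreover have "{#pathstart (edge_curve \<Gamma> e), pathfinish (edge_curve \<Gamma> e)#} = {#vertex_point \<Gamma> p, vertex_point \<Gamma> q#}"
      using plane_graph_edge(4)[OF pg assms(1)] 2 by simp
    then have "count {#pathstart (edge_curve \<Gamma> e), pathfinish (edge_curve \<Gamma> e)#} (vertex_point \<Gamma> w) =
       count {#vertex_point \<Gamma> p, vertex_point \<Gamma> q#} (vertex_point \<Gamma> w)" by (rule arg_cong)
    then have "of_bool (pathstart (edge_curve \<Gamma> e) = vertex_point \<Gamma> w) + of_bool (pathfinish (edge_curve \<Gamma> e) = vertex_point \<Gamma> w) =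
       (of_bool (vertex_point \<Gamma> p = vertex_point \<Gamma> w) + of_bool (vertex_point \<Gamma> q = vertex_point \<Gamma> w) :: nat)"
      by (simp split: if_splits)
    moreover have "count (ends G e) w = of_bool (p = w) + of_bool (q = w)" using 2(1) by simp
    ultimately show ?thesis using at by simp
  qed
qed

lemma card_half_edges:
  assumes "w \<in> verts G" shows "card (half_edges_at G \<Gamma> w) = 3"
proof -
  define B where "B e = {b. (e, b) \<in> half_edges_at G \<Gamma> w}" for e
  have "half_edges_at G \<Gamma> w = Sigma (edges G) B" unfolding B_def half_edges_at_def by auto
  then have "card (half_edges_at G \<Gamma> w) = (\<Sum>e\<in>edges G. card (B e))"
    using finite_E by (simp add: card_SigmaI)
  also have "\<dots> = (\<Sum>e\<in>edges G. count (ends G e) w)"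
  proof (rule sum.cong[OF refl])
    fix e assume e: "e \<in> edges G"
    have "card (B e) = (\<Sum>b\<in>UNIV. of_bool ((e, b) \<in> half_edges_at G \<Gamma> w))"
      unfolding B_def by (simp add: of_bool_def sum.If_cases)
    then show "card (B e) = count (ends G e) w"
      unfolding count_half_edges[OF e assms] by (simp add: UNIV_bool)
  qed
  also have "\<dots> = 3" using tri assms unfolding trivalent_def degree_def by blast
  finally show ?thesis .
qed

lemma matched_half_edge:
  assumes "w \<in> verts G"
  obtains m b h2 h3 where "m \<in> M" "ccw G \<Gamma> w (m, b) h2 h3" "fst h2 \<notin> M" "fst h3 \<notin> M"
proof -
  let ?H = "half_edges_at G \<Gamma> w"
  have "\<exists>!e. e \<in> M \<and> w \<in># ends G e"
    using pm assms unfolding perfect_matching_def by (elim conjE) (erule bspec)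
  then have "\<exists>e0. e0 \<in> M \<and> w \<in># ends G e0 \<and> (\<forall>e. e \<in> M \<and> w \<in># ends G e \<longrightarrow> e = e0)"
    unfolding Ex1_def by simp
  then obtain m where m: "m \<in> M" "w \<in># ends G m" "\<forall>e. e \<in> M \<and> w \<in># ends G e \<longrightarrow> e = m"
    by (elim exE conjE)
  have mE: "m \<in> edges G" using m(1) M_E by blast
  obtain u v where uv: "ends G m = {#u, v#}" "u \<noteq> v" "u \<in> verts G" "v \<in> verts G" by (rule M_ends[OF m(1)])
  have "w = u \<or> w = v" using m(2) uv(1) by auto
  then have "count (ends G m) w = 1" unfolding uv(1) using uv(2) by (elim disjE) simp_all
  then have "((m, False) \<in> ?H) \<noteq> ((m, True) \<in> ?H)"
    unfolding count_half_edges[OF mE assms]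
    by (cases "(m, False) \<in> ?H"; cases "(m, True) \<in> ?H") simp_all
  then obtain b where b: "(m, b) \<in> ?H" "(m, \<not> b) \<notin> ?H"
    using that[of True] that[of False] by (cases "(m, True) \<in> ?H") simp_all
  have "card (?H - {(m, b)}) = 2" using card_half_edges[OF assms] b(1) by simp
  then obtain h2 h3 where h: "?H - {(m, b)} = {h2, h3}" "h2 \<noteq> h3" using card_2_iff by metis
  have hH: "h2 \<in> ?H" "h3 \<in> ?H" "h2 \<noteq> (m, b)" "h3 \<noteq> (m, b)" using h by auto
  have H: "?H = {(m, b), h2, h3}" using h(1) b(1) by auto
  have notM: "fst h \<notin> M" if "h \<in> ?H" "h \<noteq> (m, b)" for h
  proof
    assume M: "fst h \<in> M"
    have E: "fst h \<in> edges G" using M M_E by blast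
    have "(fst h, False) \<in> ?H \<or> (fst h, True) \<in> ?H" using that(1) by (cases h; cases "snd h") auto
    then have "count (ends G (fst h)) w > 0" unfolding count_half_edges[OF E assms] by auto
    then have "fst h = m" using m(3) M by (simp add: count_greater_zero_iff)
    then have "h = (m, \<not> b)" using that(2) by (cases h) auto
    then show False using that(1) b(2) by simp
  qed
  have "turns \<Gamma> w (m, b) h2 h3 \<or> turns \<Gamma> w (m, b) h3 h2"
    using half_edges_turn[OF pg fin assms b(1) hH(1,2)] hH(3,4) h(2) by auto
  then show thesis
  proof
    assume "turns \<Gamma> w (m, b) h2 h3"
    then have "ccw G \<Gamma> w (m, b) h2 h3" unfolding ccw_turns using assms H by simp
    from that[OF m(1) this notM[OF hH(1,3)] notM[OF hH(2,4)]] show thesis .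
  next
    assume "turns \<Gamma> w (m, b) h3 h2"
    then have "ccw G \<Gamma> w (m, b) h3 h2" unfolding ccw_turns using assms H by auto
    from that[OF m(1) this notM[OF hH(2,4)] notM[OF hH(1,3)]] show thesis .
  qed
qed

text \<open>At a vertex the choice is forced: \<open>ccw_matched\<close> shows that all admissible
  pairs agree.\<close>

definition plane_rotation :: "'v \<Rightarrow> 'e \<times> 'e" where
  "plane_rotation w = (SOME r. \<exists>m\<in>M. \<exists>b h2 h3. ccw G \<Gamma> w (m, b) h2 h3 \<and> r = (fst h2, fst h3) \<and> fst h2 \<notin> M \<and> fst h3 \<notin> M)"

lemma plane_rotation:
  assumes "w \<in> verts G"
  obtains m b i j where "m \<in> M" "ccw G \<Gamma> w (m, b) (fst (plane_rotation w), i) (snd (plane_rotation w), j)"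
    "fst (plane_rotation w) \<notin> M" "snd (plane_rotation w) \<notin> M"
proof -
  obtain m b h2 h3 where "m \<in> M" "ccw G \<Gamma> w (m, b) h2 h3" "fst h2 \<notin> M" "fst h3 \<notin> M"
    by (rule matched_half_edge[OF assms]) (rule that)
  then have "\<exists>r. \<exists>m\<in>M. \<exists>b h2 h3. ccw G \<Gamma> w (m, b) h2 h3 \<and> r = (fst h2, fst h3) \<and> fst h2 \<notin> M \<and> fst h3 \<notin> M" by blast
  then have "\<exists>m\<in>M. \<exists>b h2 h3. ccw G \<Gamma> w (m, b) h2 h3 \<and> plane_rotation w = (fst h2, fst h3) \<and> fst h2 \<notin> M \<and> fst h3 \<notin> M"
    unfolding plane_rotation_def by (rule someI_ex)
  then obtain m b h2 h3 where *: "m \<in> M" "ccw G \<Gamma> w (m, b) h2 h3" "plane_rotation w = (fst h2, fst h3)" "fst h2 \<notin> M" "fst h3 \<notin> M"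
    by blast
  then show thesis using that[of m b "snd h2" "snd h3"] by simp
qed

lemma rotation_plane_rotation: "rotation G M plane_rotation"
  unfolding rotation_def
proof (intro ballI conjI)
  fix w assume w: "w \<in> verts G"
  obtain m b i j where *: "m \<in> M" "ccw G \<Gamma> w (m, b) (fst (plane_rotation w), i) (snd (plane_rotation w), j)"
    "fst (plane_rotation w) \<notin> M" "snd (plane_rotation w) \<notin> M"
    by (rule plane_rotation[OF w]) (rule that)
  let ?x = "fst (plane_rotation w)" and ?y = "snd (plane_rotation w)"
  have H: "half_edges_at G \<Gamma> w = {(m, b), (?x, i), (?y, j)}" and t: "turns \<Gamma> w (m, b) (?x, i) (?y, j)"
    using *(2) unfolding ccw_turns by simp_all
  have E: "fst h \<in> edges G" if "h \<in> half_edges_at G \<Gamma> w" for h using that unfolding half_edges_at_def by simp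
  show "?x \<in> edges G - M" "?y \<in> edges G - M" using E[of "(?x, i)"] E[of "(?y, j)"] H *(3,4) by auto
  fix x assume x: "x \<in> edges G - M"
  have ne: "(?x, i) \<noteq> (?y, j)" by (rule turns_distinct(2)[OF t])
  have "count (ends G x) w = of_bool ((x, False) \<in> half_edges_at G \<Gamma> w) + of_bool ((x, True) \<in> half_edges_at G \<Gamma> w)"
    using count_half_edges x w by blast
  also have "\<dots> = of_bool (x = ?x) + of_bool (x = ?y)"
    unfolding H using x *(1) ne by (cases i; cases j) auto
  finally show "count (ends G x) w = of_bool (x = ?x) + of_bool (x = ?y)" .
qed

lemma ccw_matched:
  assumes "e \<in> M" "ccw G \<Gamma> w (e, b) h2 h3"
  shows "plane_rotation w = (fst h2, fst h3)"
proof -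
  have w: "w \<in> verts G" using assms(2) unfolding ccw_turns by blast
  obtain m c i j where *: "m \<in> M" "ccw G \<Gamma> w (m, c) (fst (plane_rotation w), i) (snd (plane_rotation w), j)"
    "fst (plane_rotation w) \<notin> M" "snd (plane_rotation w) \<notin> M"
    by (rule plane_rotation[OF w]) (rule that)
  let ?x = "(fst (plane_rotation w), i)" and ?y = "(snd (plane_rotation w), j)"
  have sets: "{(e, b), h2, h3} = {(m, c), ?x, ?y}" using assms(2) *(2) unfolding ccw_turns by simp
  have t: "turns \<Gamma> w (e, b) h2 h3" "turns \<Gamma> w (m, c) ?x ?y" using assms(2) *(2) unfolding ccw_turns by blast+
  have "(e, b) \<in> {(m, c), ?x, ?y}" unfolding sets[symmetric] by simp
  then have em: "(e, b) = (m, c)" using assms(1) *(3,4) by auto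
  have "{h2, h3} = {?x, ?y}"
  proof (rule insert_ident[THEN iffD1])
    show "insert (m, c) {h2, h3} = insert (m, c) {?x, ?y}" using sets unfolding em .
    show "(m, c) \<notin> {h2, h3}" "(m, c) \<notin> {?x, ?y}"
      using turns_distinct(1,3)[OF t(1)] turns_distinct(1,3)[OF t(2)] unfolding em by blast+
  qed
  then have "h2 = ?x \<and> h3 = ?y \<or> h2 = ?y \<and> h3 = ?x" by (auto simp: doubleton_eq_iff)
  moreover have "\<not> (h2 = ?y \<and> h3 = ?x)" using t(1) turns_asym[OF t(2)] unfolding em by auto
  ultimately show ?thesis by auto
qed

lemma ccw_exists:
  assumes "e \<in> M" "(e, b) \<in> half_edges_at G \<Gamma> w" "w \<in> verts G"
  obtains i j where "ccw G \<Gamma> w (e, b) (fst (plane_rotation w), i) (snd (plane_rotation w), j)"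
proof -
  obtain m c i j where *: "m \<in> M" "ccw G \<Gamma> w (m, c) (fst (plane_rotation w), i) (snd (plane_rotation w), j)"
    "fst (plane_rotation w) \<notin> M" "snd (plane_rotation w) \<notin> M"
    by (rule plane_rotation[OF assms(3)]) (rule that)
  have "(e, b) \<in> {(m, c), (fst (plane_rotation w), i), (snd (plane_rotation w), j)}"
    using *(2) assms(2) unfolding ccw_turns by simp
  then have "(e, b) = (m, c)" using assms(1) *(3,4) by auto
  then show thesis using that *(2) by simp
qed

text \<open>The relations differ, as \<open>smoothing_arc\<close> reads each matching edge from its
  beginning to its end while \<open>state_arc\<close> is symmetric; the generated equivalences
  agree.\<close>

lemma equivclp_smoothing:
  "equivclp (\<lambda>e f. \<exists>i j. smoothing_arc G M \<Gamma> S (e, i) (f, j)) = equivclp (state_arc G M plane_rotation S)"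
proof (rule equivclp_eqI)
  fix x y assume "\<exists>i j. smoothing_arc G M \<Gamma> S (x, i) (y, j)"
  then obtain i j where "smoothing_arc G M \<Gamma> S (x, i) (y, j)" by blast
  then obtain e u v x1 x2 y1 y2 where e: "e \<in> M" "ccw G \<Gamma> u (e, False) x1 x2" "ccw G \<Gamma> v (e, True) y1 y2"
    and xy: "if e \<in> S then x = fst x1 \<and> y = fst y1 \<or> x = fst x2 \<and> y = fst y2
       else x = fst x1 \<and> y = fst y2 \<or> x = fst x2 \<and> y = fst y1"
  proof cases
    case (zero_12 e u x2 v y1)
    then show thesis by (intro that[of e u "(x, i)" x2 v y1 "(y, j)"]) auto
  next
    case (zero_21 e u x1 v y2)
    then show thesis by (intro that[of e u x1 "(x, i)" v "(y, j)" y2]) auto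
  next
    case (one_11 e u x2 v y2)
    then show thesis by (intro that[of e u "(x, i)" x2 v "(y, j)" y2]) auto
  next
    case (one_22 e u x1 v y1)
    then show thesis by (intro that[of e u x1 "(x, i)" v y1 "(y, j)"]) auto
  qed
  have eE: "e \<in> edges G" using e(1) M_E by blast
  have uv: "u \<in> verts G" "v \<in> verts G" "(e, False) \<in> half_edges_at G \<Gamma> u" "(e, True) \<in> half_edges_at G \<Gamma> v"
    using e unfolding ccw_turns by auto
  obtain p q where pq: "ends G e = {#p, q#}" "p \<noteq> q" "p \<in> verts G" "q \<in> verts G" by (rule M_ends[OF e(1)])
  have "count (ends G e) u > 0" "count (ends G e) v > 0"
    using count_half_edges[OF eE uv(1)] count_half_edges[OF eE uv(2)] uv(3,4) by auto
  then have "(u = p \<or> u = q) \<and> (v = p \<or> v = q)" unfolding pq(1) by (auto split: if_splits)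
  moreover have "u \<noteq> v"
  proof
    assume "u = v"
    then have "count (ends G e) u = 2" using count_half_edges[OF eE uv(1)] uv(3,4) by simp
    then show False unfolding pq(1) using pq(2) by (auto split: if_splits)
  qed
  ultimately have ends: "ends G e = {#u, v#}" using pq(1) by (auto simp: add_mset_commute)
  have "state_arc G M plane_rotation S x y"
    unfolding state_arc_def
    by (rule bexI[OF _ e(1)], unfold band_arc_def, rule exI[of _ u], rule exI[of _ v])
      (use ends xy in \<open>simp add: ccw_matched[OF e(1,2)] ccw_matched[OF e(1,3)]\<close>)
  then show "equivclp (state_arc G M plane_rotation S) x y" by (rule r_into_equivclp)
next
  fix x y assume "state_arc G M plane_rotation S x y"
  then obtain e where e: "e \<in> M" "band_arc G plane_rotation S e x y" unfolding state_arc_def by blast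
  let ?R = "\<lambda>e f. \<exists>i j. smoothing_arc G M \<Gamma> S (e, i) (f, j)"
  have eE: "e \<in> edges G" using e(1) M_E by blast
  obtain p q where pq: "ends G e = {#p, q#}" "p \<noteq> q" "p \<in> verts G" "q \<in> verts G" by (rule M_ends[OF e(1)])
  have pt: "vertex_point \<Gamma> p \<noteq> vertex_point \<Gamma> q" using plane_graph_inj[OF pg] pq by (auto dest: inj_onD)
  obtain i where i: "pathstart (half_edge_curve \<Gamma> (e, i)) = vertex_point \<Gamma> p" "pathfinish (half_edge_curve \<Gamma> (e, i)) = vertex_point \<Gamma> q"
    by (rule half_edge_exists[OF pg eE pq(1)])
  have at: "(e, i) \<in> half_edges_at G \<Gamma> p" "(e, \<not> i) \<in> half_edges_at G \<Gamma> q"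
    using i eE half_edge_curve_simps(2)[of \<Gamma> e i] unfolding half_edges_at_def by simp_all
  \<comment> \<open>Named so that \<open>e\<close> runs from \<open>u\<close> to \<open>v\<close>,
    as the rules of \<open>smoothing_arc\<close> require.\<close>
  define u v where "u = (if i then q else p)" and "v = (if i then p else q)"
  have uv: "(e, False) \<in> half_edges_at G \<Gamma> u" "(e, True) \<in> half_edges_at G \<Gamma> v" "u \<in> verts G" "v \<in> verts G"
    "ends G e = {#u, v#}"
    using at pq unfolding u_def v_def by (auto simp: add_mset_commute)
  obtain i1 i2 where u: "ccw G \<Gamma> u (e, False) (fst (plane_rotation u), i1) (snd (plane_rotation u), i2)"
    by (rule ccw_exists[OF e(1) uv(1,3)])
  obtain j1 j2 where v: "ccw G \<Gamma> v (e, True) (fst (plane_rotation v), j1) (snd (plane_rotation v), j2)"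
    by (rule ccw_exists[OF e(1) uv(2,4)])
  have arcs: "if e \<in> S then ?R (fst (plane_rotation u)) (fst (plane_rotation v)) \<and> ?R (snd (plane_rotation u)) (snd (plane_rotation v))
    else ?R (fst (plane_rotation u)) (snd (plane_rotation v)) \<and> ?R (snd (plane_rotation u)) (fst (plane_rotation v))"
    using smoothing_arc.zero_12[OF e(1) _ u v, of S] smoothing_arc.zero_21[OF e(1) _ u v, of S]
      smoothing_arc.one_11[OF e(1) _ u v, of S] smoothing_arc.one_22[OF e(1) _ u v, of S] by (cases "e \<in> S") auto
  have "?R x y \<or> ?R y x"
    using e(2) arcs unfolding band_arc_ends[OF uv(5)] by (auto split: if_splits)
  then show "equivclp ?R x y" by (elim disjE) (rule r_into_equivclp, assumption, rule converse_r_into_equivclp, assumption)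
qed

lemma circle_count_plane_rotation:
  "circle_count G M \<Gamma> S = class_count (edges G - M) (state_arc G M plane_rotation S)"
  unfolding circle_count_def same_circle_def class_count_def equivclp_smoothing ..

lemma cyclic_order_plane_rotation:
  assumes "w \<in> verts G"
  obtains m where "m \<in> M" "w \<in># ends G m" "cyclic_order G \<Gamma> w m (fst (plane_rotation w)) (snd (plane_rotation w))"
proof -
  obtain m b i j where *: "m \<in> M" "ccw G \<Gamma> w (m, b) (fst (plane_rotation w), i) (snd (plane_rotation w), j)"
    "fst (plane_rotation w) \<notin> M" "snd (plane_rotation w) \<notin> M"
    by (rule plane_rotation[OF assms]) (rule that)
  have "(m, False) \<in> half_edges_at G \<Gamma> w \<or> (m, True) \<in> half_edges_at G \<Gamma> w"
    using *(2) unfolding ccw_turns by (cases b) auto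
  moreover have "m \<in> edges G" using *(1) M_E by blast
  ultimately have "count (ends G m) w > 0" using count_half_edges[OF _ assms, of m] by auto
  then show thesis using that[of m] * unfolding cyclic_order_def by auto
qed

text \<open>Three distinct edges already account for the three half-edges at the vertex.\<close>

lemma cyclic_order_turns:
  assumes w: "w \<in> verts G" and abc: "distinct [a, b, c]" "a \<in> edges G" "b \<in> edges G" "c \<in> edges G"
    and h: "pathstart (half_edge_curve \<Gamma> (a, i)) = vertex_point \<Gamma> w" "pathstart (half_edge_curve \<Gamma> (b, j)) = vertex_point \<Gamma> w"
      "pathstart (half_edge_curve \<Gamma> (c, k)) = vertex_point \<Gamma> w"
    and t: "turns \<Gamma> w (a, i) (b, j) (c, k)"
  shows "cyclic_order G \<Gamma> w a b c"
proof -
  have sub: "{(a, i), (b, j), (c, k)} \<subseteq> half_edges_at G \<Gamma> w"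
    using h abc unfolding half_edges_at_def by auto
  have "card {(a, i), (b, j), (c, k)} = 3" using abc(1) by auto
  moreover have "finite (half_edges_at G \<Gamma> w)" using card_half_edges[OF w] by (metis card.infinite zero_neq_numeral)
  ultimately have "half_edges_at G \<Gamma> w = {(a, i), (b, j), (c, k)}"
    using card_half_edges[OF w] sub by (metis card_subset_eq)
  then show ?thesis using w t unfolding cyclic_order_def ccw_turns by blast
qed

lemma theta_cyclic_order:
  assumes uv: "u \<in> verts G" "v \<in> verts G" and a: "distinct [a1, a2, a3]"
    and p: "gpath G u a1 X1 D1 b1 v" "gpath G u a2 X2 D2 b2 v" "gpath G u a3 X3 D3 b3 v"
    and X: "X1 \<inter> X2 \<subseteq> {u, v}" "X2 \<inter> X3 \<subseteq> {u, v}" "X3 \<inter> X1 \<subseteq> {u, v}"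
    and D: "D1 \<inter> D2 = {}" "D2 \<inter> D3 = {}" "D3 \<inter> D1 = {}"
  shows "cyclic_order G \<Gamma> u a1 a2 a3 \<and> cyclic_order G \<Gamma> v b1 b3 b2 \<or>
     cyclic_order G \<Gamma> u a1 a3 a2 \<and> cyclic_order G \<Gamma> v b1 b2 b3"
proof -
  have E: "a1 \<in> edges G" "a2 \<in> edges G" "a3 \<in> edges G" "b1 \<in> edges G" "b2 \<in> edges G" "b3 \<in> edges G"
    using gpath_props(1,6,7)[OF p(1)] gpath_props(1,6,7)[OF p(2)] gpath_props(1,6,7)[OF p(3)] by blast+
  have b: "distinct [b1, b2, b3]"
    using gpath_props(7)[OF p(1)] gpath_props(7)[OF p(2)] gpath_props(7)[OF p(3)] D by auto
  have b': "distinct [b1, b3, b2]" and a': "distinct [a1, a3, a2]" using a b by auto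
  show ?thesis
  proof (rule theta_turns[OF pg fin p X D], goal_cases)
    case (1 i1 i2 i3 j1 j2 j3)
    from 1(7) show ?case
    proof (elim disjE conjE)
      assume t: "turns \<Gamma> u (a1, i1) (a2, i2) (a3, i3)" "turns \<Gamma> v (b1, j1) (b3, j3) (b2, j2)"
      show ?thesis
        using cyclic_order_turns[OF uv(1) a E(1,2,3) 1(1,2,3) t(1)]
          cyclic_order_turns[OF uv(2) b' E(4,6,5) 1(4,6,5) t(2)] by simp
    next
      assume t: "turns \<Gamma> u (a1, i1) (a3, i3) (a2, i2)" "turns \<Gamma> v (b1, j1) (b2, j2) (b3, j3)"
      show ?thesis
        using cyclic_order_turns[OF uv(1) a' E(1,3,2) 1(1,3,2) t(1)]
          cyclic_order_turns[OF uv(2) b E(4,5,6) 1(4,5,6) t(2)] by simp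
    qed
  qed
qed

end

section \<open>Theta graphs compared in two drawings\<close>

lemma (in plane_matched_graph) cyclic_order_edges:
  assumes "cyclic_order G \<Gamma> w a b c"
  shows "{e \<in> edges G. w \<in># ends G e} = {a, b, c}" "w \<in> verts G"
proof -
  obtain i j k where "ccw G \<Gamma> w (a, i) (b, j) (c, k)" using assms unfolding cyclic_order_def by blast
  then have H: "half_edges_at G \<Gamma> w = {(a, i), (b, j), (c, k)}" and w: "w \<in> verts G" unfolding ccw_turns by simp_all
  have "w \<in># ends G e \<longleftrightarrow> (\<exists>l. (e, l) \<in> half_edges_at G \<Gamma> w)" if "e \<in> edges G" for e
  proof -
    have "w \<in># ends G e \<longleftrightarrow> count (ends G e) w > 0" by simp
    also have "\<dots> \<longleftrightarrow> (e, False) \<in> half_edges_at G \<Gamma> w \<or> (e, True) \<in> half_edges_at G \<Gamma> w"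
      unfolding count_half_edges[OF that w] by auto
    also have "\<dots> \<longleftrightarrow> (\<exists>l. (e, l) \<in> half_edges_at G \<Gamma> w)" using ex_bool_eq[of "\<lambda>l. (e, l) \<in> half_edges_at G \<Gamma> w"] by blast
    finally show ?thesis .
  qed
  moreover have "e \<in> edges G" if "(e, l) \<in> half_edges_at G \<Gamma> w" for e l
    using that unfolding half_edges_at_def by simp
  ultimately have "{e \<in> edges G. w \<in># ends G e} = {e. \<exists>l. (e, l) \<in> half_edges_at G \<Gamma> w}" by blast
  also have "\<dots> = {a, b, c}" unfolding H by auto
  finally show "{e \<in> edges G. w \<in># ends G e} = {a, b, c}" .
  show "w \<in> verts G" by (rule w)
qed

text \<open>The multiplicities fix the two entries and leave only their order open.\<close>

lemma rotation_unique:
  assumes "rotation G M \<rho>" "rotation G M \<rho>'" "w \<in> verts G"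
  shows "\<rho>' w = \<rho> w \<or> \<rho>' w = prod.swap (\<rho> w)"
proof -
  have N: "fst (\<rho>' w) \<in> edges G - M" "snd (\<rho>' w) \<in> edges G - M" "fst (\<rho> w) \<in> edges G - M" "snd (\<rho> w) \<in> edges G - M"
    using assms unfolding rotation_def by blast+
  have eq: "of_bool (x = fst (\<rho> w)) + of_bool (x = snd (\<rho> w)) = (of_bool (x = fst (\<rho>' w)) + of_bool (x = snd (\<rho>' w)) :: nat)"
    if "x \<in> edges G - M" for x
  proof -
    have "count (ends G x) w = of_bool (x = fst (\<rho> w)) + of_bool (x = snd (\<rho> w))"
      "count (ends G x) w = of_bool (x = fst (\<rho>' w)) + of_bool (x = snd (\<rho>' w))"
      using assms that unfolding rotation_def by blast+
    then show ?thesis by (rule trans[OF sym])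
  qed
  have "fst (\<rho>' w) = fst (\<rho> w) \<or> fst (\<rho>' w) = snd (\<rho> w)" using eq[OF N(1)] by (auto intro: ccontr)
  then show ?thesis
  proof
    assume fst: "fst (\<rho>' w) = fst (\<rho> w)"
    then have "snd (\<rho>' w) = snd (\<rho> w)" using eq[OF N(4)] by (auto intro: ccontr)
    then show ?thesis using fst by (simp add: prod_eq_iff)
  next
    assume fst: "fst (\<rho>' w) = snd (\<rho> w)"
    then have "snd (\<rho>' w) = fst (\<rho> w)" using eq[OF N(3)] by (auto intro: ccontr)
    then show ?thesis using fst by (simp add: prod_eq_iff)
  qed
qed

text \<open>
  By Menger's theorem, two vertices that no cut of size at most 2 separates are the branch
  vertices of a theta graph, whose cyclic orders are opposite in every drawing.
\<close>

lemma small_cut_between_flips: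
  assumes A: "plane_matched_graph G M \<Gamma>" and B: "plane_matched_graph G M \<Gamma>'"
    and u: "u \<in> verts G" "plane_matched_graph.plane_rotation G M \<Gamma> u \<noteq> plane_matched_graph.plane_rotation G M \<Gamma>' u"
    and v: "v \<in> verts G" "plane_matched_graph.plane_rotation G M \<Gamma> v = plane_matched_graph.plane_rotation G M \<Gamma>' v"
  shows "\<exists>P\<subseteq>verts G. u \<in> P \<and> v \<notin> P \<and> card (cut G P) \<le> 2"
proof (rule ccontr)
  interpret A: plane_matched_graph G M \<Gamma> by (rule A)
  interpret B: plane_matched_graph G M \<Gamma>' by (rule B)
  assume "\<not> ?thesis"
  then have nocut: "\<not> card (cut G P) \<le> 2" if "P \<subseteq> verts G" "u \<in> P" "v \<notin> P" for P using that by blast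
  have uv: "u \<noteq> v" using u v by auto
  obtain X D b where paths: "\<And>a. a \<in> edges G \<Longrightarrow> u \<in># ends G a \<Longrightarrow> gpath G u a (X a) (D a) (b a) v"
    "\<And>a a'. a \<in> edges G \<Longrightarrow> a' \<in> edges G \<Longrightarrow> u \<in># ends G a \<Longrightarrow> u \<in># ends G a' \<Longrightarrow> a \<noteq> a' \<Longrightarrow>
       X a \<inter> X a' \<subseteq> {u, v} \<and> D a \<inter> D a' = {}"
    "card {a \<in> edges G. u \<in># ends G a} = 3"
    by (rule three_paths_or_small_cut[OF A.fin A.tri u(1) v(1) uv], erule (2) nocut, rule that)
  have matched: "m = m'" if "m \<in> M" "m' \<in> M" "w \<in># ends G m" "w \<in># ends G m'" "w \<in> verts G" for m m' w
  proof -
    have "\<exists>!e. e \<in> M \<and> w \<in># ends G e"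
      using A.pm that(5) unfolding perfect_matching_def by (elim conjE) (erule bspec)
    from the1_equality[OF this, of m] the1_equality[OF this, of m'] show ?thesis using that by simp
  qed
  define x y where "x = fst (A.plane_rotation u)" and "y = snd (A.plane_rotation u)"
  obtain m where m: "m \<in> M" "u \<in># ends G m" "cyclic_order G \<Gamma> u m x y"
    by (rule A.cyclic_order_plane_rotation[OF u(1)]) (rule that, unfold x_def y_def)
  obtain m' where m': "m' \<in> M" "u \<in># ends G m'"
      "cyclic_order G \<Gamma>' u m' (fst (B.plane_rotation u)) (snd (B.plane_rotation u))"
    by (rule B.cyclic_order_plane_rotation[OF u(1)]) (rule that)
  \<comment> \<open>The rotations at \<open>u\<close> differ, so the two drawings have opposite
    cyclic orders there, and the theta graph carries this over to \<open>v\<close>.\<close>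
  have "B.plane_rotation u = prod.swap (A.plane_rotation u)"
    using rotation_unique[OF A.rotation_plane_rotation B.rotation_plane_rotation u(1)] u(2) by auto
  then have "fst (B.plane_rotation u) = y" "snd (B.plane_rotation u) = x" by (simp_all add: x_def y_def)
  moreover have "m' = m" by (rule matched[OF m'(1) m(1) m'(2) m(2) u(1)])
  ultimately have Bu: "cyclic_order G \<Gamma>' u m y x" using m'(3) by simp
  have Eu: "{a \<in> edges G. u \<in># ends G a} = {m, x, y}" by (rule A.cyclic_order_edges(1)[OF m(3)])
  have dist: "distinct [m, x, y]" using paths(3) unfolding Eu by (auto simp: card_insert_if split: if_splits)
  have E: "m \<in> edges G" "u \<in># ends G m" "x \<in> edges G" "u \<in># ends G x" "y \<in> edges G" "u \<in># ends G y"
    using Eu by auto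
  have gp: "gpath G u m (X m) (D m) (b m) v" "gpath G u x (X x) (D x) (b x) v" "gpath G u y (X y) (D y) (b y) v"
    using paths(1) E by simp_all
  have XD: "X m \<inter> X x \<subseteq> {u, v}" "X x \<inter> X y \<subseteq> {u, v}" "X y \<inter> X m \<subseteq> {u, v}"
    "D m \<inter> D x = {}" "D x \<inter> D y = {}" "D y \<inter> D m = {}"
    using paths(2)[of m x] paths(2)[of x y] paths(2)[of y m] E dist by auto
  have "cyclic_order G \<Gamma> u m x y \<and> cyclic_order G \<Gamma> v (b m) (b y) (b x) \<or>
     cyclic_order G \<Gamma> u m y x \<and> cyclic_order G \<Gamma> v (b m) (b x) (b y)"
    by (rule A.theta_cyclic_order[OF u(1) v(1) dist gp XD])
  then have Av: "cyclic_order G \<Gamma> v (b m) (b y) (b x)" using cyclic_order_asym[OF m(3) dist] by blast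
  have "cyclic_order G \<Gamma>' u m x y \<and> cyclic_order G \<Gamma>' v (b m) (b y) (b x) \<or>
     cyclic_order G \<Gamma>' u m y x \<and> cyclic_order G \<Gamma>' v (b m) (b x) (b y)"
    by (rule B.theta_cyclic_order[OF u(1) v(1) dist gp XD])
  moreover have "distinct [m, y, x]" using dist by auto
  ultimately have Bv: "cyclic_order G \<Gamma>' v (b m) (b x) (b y)" using cyclic_order_asym[OF Bu] by blast
  define p q where "p = fst (A.plane_rotation v)" and "q = snd (A.plane_rotation v)"
  obtain n where n: "n \<in> M" "v \<in># ends G n" "cyclic_order G \<Gamma> v n p q"
    by (rule A.cyclic_order_plane_rotation[OF v(1)]) (rule that, unfold p_def q_def)
  obtain n' where n': "n' \<in> M" "v \<in># ends G n'" "cyclic_order G \<Gamma>' v n' p q"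
    by (rule B.cyclic_order_plane_rotation[OF v(1)]) (rule that, unfold p_def q_def v(2))
  \<comment> \<open>The rotations at \<open>v\<close> agree, so one and the same cyclic order of its
    edges holds in both drawings.\<close>
  have "n' = n" by (rule matched[OF n'(1) n(1) n'(2) n(2) v(1)])
  then have n'': "cyclic_order G \<Gamma>' v n p q" using n'(3) by simp
  have sets: "{n, p, q} = {b m, b y, b x}"
    using A.cyclic_order_edges(1)[OF n(3)] A.cyclic_order_edges(1)[OF Av] by simp
  have "b m \<in> D m" "b x \<in> D x" "b y \<in> D y" using gpath_props(7)[OF gp(1)] gpath_props(7)[OF gp(2)] gpath_props(7)[OF gp(3)] .
  then have bd: "distinct [b m, b y, b x]" using XD by auto
  \<comment> \<open>Each of the six orders is a rotation of one of the two cyclic orders, and so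
    contradicts one of the drawings.\<close>
  then have perm: "(n, p, q) \<in> {(b m, b y, b x), (b y, b x, b m), (b x, b m, b y)} \<union> {(b m, b x, b y), (b x, b y, b m), (b y, b m, b x)}"
    using sets by (simp add: set_eq_iff) metis
  have bd': "distinct [b m, b x, b y]" using bd by auto
  have notA: "\<not> cyclic_order G \<Gamma> v (b m) (b x) (b y)" by (rule cyclic_order_asym[OF Av bd])
  have notB: "\<not> cyclic_order G \<Gamma>' v (b m) (b y) (b x)" by (rule cyclic_order_asym[OF Bv bd'])
  from perm show False
  proof
    assume "(n, p, q) \<in> {(b m, b y, b x), (b y, b x, b m), (b x, b m, b y)}"
    then have "cyclic_order G \<Gamma>' v (b m) (b y) (b x)"
      using n'' cyclic_order_rotate[OF n''] cyclic_order_rotate[OF cyclic_order_rotate[OF n'']] by auto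
    then show False using notB by simp
  next
    assume "(n, p, q) \<in> {(b m, b x, b y), (b x, b y, b m), (b y, b m, b x)}"
    then have "cyclic_order G \<Gamma> v (b m) (b x) (b y)"
      using n(3) cyclic_order_rotate[OF n(3)] cyclic_order_rotate[OF cyclic_order_rotate[OF n(3)]] by auto
    then show False using notA by simp
  qed
qed

lemma circle_count_independent:
  assumes "plane_matched_graph G M \<Gamma>" "plane_matched_graph G M \<Gamma>'"
  shows "circle_count G M \<Gamma> S = circle_count G M \<Gamma>' S"
proof -
  interpret A: plane_matched_graph G M \<Gamma> by (rule assms(1))
  interpret B: plane_matched_graph G M \<Gamma>' by (rule assms(2))
  define W where "W = {w \<in> verts G. A.plane_rotation w \<noteq> B.plane_rotation w}"
  have "W \<in> A.cut_span"
  proof (rule A.cut_span_separated)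
    show "W \<subseteq> verts G" unfolding W_def by blast
    fix u v assume "u \<in> W" "v \<in> verts G - W"
    then have "u \<in> verts G" "A.plane_rotation u \<noteq> B.plane_rotation u" "v \<in> verts G" "A.plane_rotation v = B.plane_rotation v"
      unfolding W_def by simp_all
    from small_cut_between_flips[OF assms this]
    obtain P where P: "P \<subseteq> verts G" "u \<in> P" "v \<notin> P" "card (cut G P) \<le> 2" by (elim exE conjE)
    have "u \<in> P \<and> v \<notin> P" using P(2,3) ..
    then show "\<exists>P\<in>A.cut_span. u \<in> P \<and> v \<notin> P" using A.cut_span_base[OF P(1,4)] by (rule bexI)
  qed
  have flip: "flip W A.plane_rotation w = B.plane_rotation w" if "w \<in> verts G" for w
    using rotation_unique[OF A.rotation_plane_rotation B.rotation_plane_rotation that] that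
    unfolding flip_def W_def by auto
  \<comment> \<open>Outside the vertex set the two rotations may differ, so agreement is claimed
    only for the arcs of matching edges, whose ends are vertices.\<close>
  have "band_arc G (flip W A.plane_rotation) S e = band_arc G B.plane_rotation S e" if e: "e \<in> M" for e
  proof -
    obtain u v where uv: "ends G e = {#u, v#}" "u \<noteq> v" "u \<in> verts G" "v \<in> verts G" by (rule A.M_ends[OF e])
    show ?thesis unfolding band_arc_ends[OF uv(1), abs_def] flip[OF uv(3)] flip[OF uv(4)] by (intro ext) (rule refl)
  qed
  then have "state_arc G M (flip W A.plane_rotation) S = state_arc G M B.plane_rotation S"
    unfolding state_arc_def by (intro ext bex_cong) simp_all
  then show ?thesis
    using A.class_count_flip[OF \<open>W \<in> A.cut_span\<close> A.rotation_plane_rotation, of S]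
    unfolding A.circle_count_plane_rotation B.circle_count_plane_rotation by simp
qed

theorem theorem1:
  fixes G :: "('v, 'e) multigraph" and M :: "'e set" and \<Gamma> \<Gamma>' :: "('v, 'e) drawing"
  assumes "finite_multigraph G" and "planar G" and "trivalent G"
    and "perfect_matching G M"
    and "plane_graph G \<Gamma>" and "plane_graph G \<Gamma>'"
  shows "bracket G M \<Gamma> = bracket G M \<Gamma>'"
proof -
  have "plane_matched_graph G M \<Gamma>" "plane_matched_graph G M \<Gamma>'"
    using assms by unfold_locales
  then have "circle_count G M \<Gamma> S = circle_count G M \<Gamma>' S" for S by (rule circle_count_independent)
  then show ?thesis unfolding bracket_def by simp
qed

end
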